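(* Let $Q \subseteq L$ be fields, where $L$ is quasireal. Let $E \supseteq L$ be Galois over $Q$, and suppose that $F$ is a field with $Q \subseteq F \subseteq E$ such that $F$ is abelian over $Q$ and contains all roots of unity in $E$. Write $G = \mathrm{Gal}(E/Q)$, $N = \mathrm{Gal}(E/F)$, $U = \mathrm{Gal}(E/L)$ and $M = N \cap U$. Then $L$ is a repeated radical extension of $Q$ if and only if there is a chain of $U$-invariant subgroups $M = M_0 \subseteq M_1 \subseteq \cdots \subseteq M_r = N$ such that all of the following hold: (i) $|F \cap L : Q|$ is a power of $2$; (ii) each index $|M_i : M_{i-1}|$ (for $0 < i \le r$) is prime; (iii) $M_{i-1} \triangleleft M_i$ for each integer $i$ with $0 < i \le r$; (iv) each factor $M_i/M_{i-1}$ (for $0 < i \le r$) is $U$-isomorphic to a subgroup of $E^\times$.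
   Context: A field is quasireal if it has characteristic zero and the only roots of unity it contains are $\pm 1$. "Galois" includes the assumption that the extension has finite degree; an extension $Q \subseteq F$ is abelian if it is Galois with $\mathrm{Gal}(F/Q)$ abelian. A field extension $F_0 \subseteq L_0$ is a radical extension if $L_0 = F_0[\alpha]$ for some $\alpha \in L_0$ with $\alpha^n \in F_0$ for some positive integer $n$. An extension is a repeated radical extension if it is the union of a finite tower of fields starting at the ground field and ending at the top field in which each field is a radical extension of the preceding one. A $U$-group is a group on which $U$ acts by automorphisms; two $U$-groups are $U$-isomorphic if there is a group isomorphism between them commuting with the actions of $U$. The group $U$ acts on $N$ (a normal subgroup of $G$) by conjugation, so a subgroup of $N$ is $U$-invariant if it is normalized by $U$, and $U$ acts on the quotient of two $U$-invariant subgroups, one normal in the other. $E^\times$ is the multiplicative group of $E$, on which $U \subseteq G$ acts as Galois automorphisms; every finite subgroup of $E^\times$ is cyclic, uniquely determined by its order, and hence $U$-invariant, and so is viewed as a $U$-group. *)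

theory Defs
  imports "HOL-Algebra.Algebra" "HOL-Algebra.Bij" "HOL-Algebra.Multiplicative_Group"
    "HOL-Computational_Algebra.Primes"
begin

text \<open>
  All fields live inside one field record \<open>E\<close>: an intermediate field is given by its carrier
  \<open>K\<close>, and \<open>E\<lparr>carrier := K\<rparr>\<close> is \<open>K\<close> as a field in its own right.
\<close>

definition quasireal :: "('a, 'b) ring_scheme \<Rightarrow> bool" where
  "quasireal R \<longleftrightarrow> field R
     \<and> (\<forall>n::nat. n > 0 \<longrightarrow> [n] \<cdot>\<^bsub>R\<^esub> \<one>\<^bsub>R\<^esub> \<noteq> \<zero>\<^bsub>R\<^esub>)
     \<and> (\<forall>x \<in> carrier R. \<forall>n::nat. n > 0 \<and> x [^]\<^bsub>R\<^esub> n = \<one>\<^bsub>R\<^esub>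
          \<longrightarrow> x = \<one>\<^bsub>R\<^esub> \<or> x = \<ominus>\<^bsub>R\<^esub> \<one>\<^bsub>R\<^esub>)"

text \<open>
  \<open>Gal R K\<close> is the group of field automorphisms of \<open>R\<close> fixing \<open>K\<close> pointwise. As in
  \<^const>\<open>BijGroup\<close>, its elements are extensional on \<open>carrier R\<close> and the product of \<open>g\<close> and \<open>f\<close>
  is \<open>x \<mapsto> g (f x)\<close>.
\<close>

definition Gal :: "('a, 'b) ring_scheme \<Rightarrow> 'a set \<Rightarrow> ('a \<Rightarrow> 'a) monoid" where
  "Gal R K = BijGroup (carrier R)
     \<lparr>carrier := {\<sigma> \<in> ring_hom R R \<inter> Bij (carrier R). \<forall>x \<in> K. \<sigma> x = x}\<rparr>"

definition galois_extension :: "('a, 'b) ring_scheme \<Rightarrow> 'a set \<Rightarrow> bool" where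
  "galois_extension R K \<longleftrightarrow> field R \<and> subfield K R
     \<and> ring.finite_dimension R K (carrier R)
     \<and> {x \<in> carrier R. \<forall>\<sigma> \<in> carrier (Gal R K). \<sigma> x = x} = K"

definition abelian_extension :: "('a, 'b) ring_scheme \<Rightarrow> 'a set \<Rightarrow> bool" where
  "abelian_extension R K \<longleftrightarrow> galois_extension R K \<and> comm_group (Gal R K)"

definition radical_extension :: "('a, 'b) ring_scheme \<Rightarrow> 'a set \<Rightarrow> 'a set \<Rightarrow> bool" where
  "radical_extension R K L \<longleftrightarrow> subfield K R \<and> subfield L R \<and> K \<subseteq> L
     \<and> (\<exists>\<alpha> \<in> L. \<exists>n::nat. n > 0 \<and> \<alpha> [^]\<^bsub>R\<^esub> n \<in> K \<and> L = ring.simple_extension R K \<alpha>)"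

definition repeated_radical_extension :: "('a, 'b) ring_scheme \<Rightarrow> 'a set \<Rightarrow> 'a set \<Rightarrow> bool" where
  "repeated_radical_extension R K L \<longleftrightarrow> subfield K R \<and> subfield L R
     \<and> (\<exists>(T :: nat \<Rightarrow> 'a set) n. T 0 = K \<and> T n = L
          \<and> (\<forall>i < n. radical_extension R (T i) (T (Suc i))))"

text \<open>
  A \<open>U\<close>-group is a group \<open>A\<close> together with its action \<open>\<phi>\<close>, written on the left. Elements of
  \<^const>\<open>AutoGroup\<close> are extensional, hence the restrictions in the two actions below.
\<close>

definition U_group ::
  "('u, 'b) monoid_scheme \<Rightarrow> ('a, 'c) monoid_scheme \<Rightarrow> ('u \<Rightarrow> 'a \<Rightarrow> 'a) \<Rightarrow> bool" where
  "U_group U A \<phi> \<longleftrightarrow> group U \<and> group A \<and> \<phi> \<in> hom U (AutoGroup A)"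

definition U_isomorphic ::
  "('u, 'b) monoid_scheme \<Rightarrow> ('a, 'c) monoid_scheme \<Rightarrow> ('u \<Rightarrow> 'a \<Rightarrow> 'a)
     \<Rightarrow> ('d, 'e) monoid_scheme \<Rightarrow> ('u \<Rightarrow> 'd \<Rightarrow> 'd) \<Rightarrow> bool" where
  "U_isomorphic U A \<phi> B \<psi> \<longleftrightarrow> U_group U A \<phi> \<and> U_group U B \<psi>
     \<and> (\<exists>f \<in> iso A B. \<forall>u \<in> carrier U. \<forall>x \<in> carrier A. f (\<phi> u x) = \<psi> u (f x))"

definition U_invariant :: "('a, 'b) monoid_scheme \<Rightarrow> 'a set \<Rightarrow> 'a set \<Rightarrow> bool" where
  "U_invariant G U H \<longleftrightarrow> (\<forall>u \<in> U. u <#\<^bsub>G\<^esub> H #>\<^bsub>G\<^esub> (inv\<^bsub>G\<^esub> u) = H)"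

text \<open>Conjugation on a set \<open>A\<close> of subsets of \<open>G\<close>, used for \<open>A\<close> a set of cosets.\<close>

definition conj_action :: "('a, 'b) monoid_scheme \<Rightarrow> 'a set set \<Rightarrow> 'a \<Rightarrow> 'a set \<Rightarrow> 'a set" where
  "conj_action G A = (\<lambda>u. \<lambda>S \<in> A. u <#\<^bsub>G\<^esub> S #>\<^bsub>G\<^esub> (inv\<^bsub>G\<^esub> u))"

definition galois_action :: "'a set \<Rightarrow> ('a \<Rightarrow> 'a) \<Rightarrow> 'a \<Rightarrow> 'a" where
  "galois_action C = (\<lambda>\<sigma>. restrict \<sigma> C)"

definition subgroup_index :: "('a, 'b) monoid_scheme \<Rightarrow> 'a set \<Rightarrow> 'a set \<Rightarrow> nat" where
  "subgroup_index G A B = card (rcosets\<^bsub>G\<lparr>carrier := A\<rparr>\<^esub> B)"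

end

theory Submission
  imports Defs
begin

text \<open>
  Throughout, \<open>fixer K\<close> is the group of automorphisms of \<open>E\<close> over \<open>Q\<close> that fix \<open>K\<close> pointwise, so that
  \<open>N = fixer F\<close> and \<open>U = fixer L\<close>. The group \<open>G/N\<close> is abelian, \<open>N\<close> fixes every root of unity, and
  the roots of unity in \<open>L\<close> are \<open>1\<close> and \<open>-1\<close>.

  A radical tower from \<open>Q\<close> to \<open>L\<close> gives a descending sequence of groups \<open>V\<close> from \<open>G\<close> to \<open>U\<close>, and the
  groups \<open>N \<inter> V\<close> form the required chain. To see this, refine the tower so that each step replaces
  \<open>V\<close> by the stabilizer \<open>V'\<close> of some \<open>\<alpha>\<close> in \<open>L\<close> with \<open>\<alpha>\<^sup>p\<close> fixed by \<open>V\<close> and \<open>p\<close> prime, and put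
  \<open>\<chi>(s) = s(\<alpha>)/\<alpha>\<close>, a \<open>p\<close>-th root of unity. If \<open>N \<inter> V\<close> moves \<open>\<alpha>\<close>, then \<open>\<chi>\<close> is a homomorphism from
  \<open>N \<inter> V\<close> onto the group of \<open>p\<close>-th roots of unity, because \<open>N\<close> fixes these; its kernel is \<open>N \<inter> V'\<close>, and
  it commutes with \<open>U\<close> because \<open>U\<close> fixes \<open>\<alpha>\<close>. This is one link of the chain, and \<open>NV = NV'\<close>. If
  \<open>N \<inter> V\<close> fixes \<open>\<alpha>\<close>, then so do the commutators of \<open>V\<close>; hence \<open>U\<close> fixes each \<open>s(\<alpha>)\<close>, so \<open>\<chi>(s)\<close>
  lies in \<open>L\<close> and is \<open>1\<close> or \<open>-1\<close>. The chain then stays as it is, and \<open>|V : V'|\<close> is \<open>1\<close> or \<open>2\<close>. So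
  \<open>|G : NV|\<close> is always a power of \<open>2\<close> (\<open>tower_stage_prime_step\<close>), and for \<open>V = U\<close> it is the degree
  of \<open>F \<inter> L\<close> over \<open>Q\<close> (\<open>degree_intersection\<close>).

  Conversely, a link \<open>A \<subseteq> B\<close> of the chain provides a homomorphism \<open>\<chi>\<close> on \<open>B\<close> with kernel \<open>A\<close> and with
  roots of unity as values that commutes with \<open>U\<close>. Since \<open>B\<close> fixes roots of unity, \<open>bu \<mapsto> \<chi>(b)\<close>
  is a cocycle on \<open>BU\<close>; Hilbert's Theorem 90 writes it as \<open>s \<mapsto> s(\<alpha>)/\<alpha>\<close>, and \<open>\<alpha>\<close> generates the
  fixed field of \<open>AU\<close> over that of \<open>BU\<close> as a radical extension (\<open>kummer_radical\<close>,
  \<open>radical_step_fixed_fields\<close>). The chain thus leads from the fixed field \<open>F \<inter> L\<close> of \<open>NU\<close> up to \<open>L\<close>.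
  If the degree of \<open>F \<inter> L\<close> is a power of \<open>2\<close>, then \<open>G/NU\<close> is an abelian \<open>2\<close>-group, and successive
  square roots lead from \<open>Q\<close> to \<open>F \<inter> L\<close> (\<open>quadratic_tower\<close>).

  The Galois theory behind this comes from Dedekind's independence of characters
  (\<open>characters_independent\<close>) and from functions on \<open>G\<close> of the form \<open>s \<mapsto> \<Sum> x\<^sub>i s(y\<^sub>i)\<close> with \<open>y\<^sub>i\<close> in an
  intermediate field \<open>K\<close>. Such a function can be chosen as the indicator of \<open>fixer K\<close>
  (\<open>separating_exists\<close>); summing it over a group, and taking traces, yields the fixed field of
  \<open>fixer K\<close> (\<open>fixed_field_intermediate\<close>) and the degree of \<open>K\<close> (\<open>degree_times_fixer\<close>).
\<close>

section \<open>Dedekind's independence of characters\<close>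

lemma (in abelian_monoid) finsum_additive_map:
  assumes "finite A" and "f \<in> A \<rightarrow> carrier G" and "h \<in> carrier G \<rightarrow> carrier G" and "h \<zero> = \<zero>"
    and "\<And>x y. x \<in> carrier G \<Longrightarrow> y \<in> carrier G \<Longrightarrow> h (x \<oplus> y) = h x \<oplus> h y"
  shows "h (finsum G f A) = finsum G (\<lambda>a. h (f a)) A"
  using assms(1,2)
proof (induction A)
  case empty
  then show ?case using assms(4) by simp
next
  case (insert a A)
  then show ?case using assms(3,5) by (simp add: Pi_iff)
qed

text \<open>
  Replacing \<open>z\<close> by \<open>yz\<close> in a relation and subtracting \<open>t(y)\<close> times the relation removes the term of
  \<open>t\<close> and multiplies each remaining coefficient \<open>c s\<close> by \<open>s(y) - t(y)\<close>, which is nonzero for a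
  suitable \<open>y\<close>.
\<close>

lemma (in field) characters_independent:
  assumes "finite S" and K: "K \<subseteq> carrier R" "\<one> \<in> K" "\<And>x y. x \<in> K \<Longrightarrow> y \<in> K \<Longrightarrow> x \<otimes> y \<in> K"
    and char_closed: "\<And>s x. s \<in> S \<Longrightarrow> x \<in> K \<Longrightarrow> s x \<in> carrier R"
    and char_mult: "\<And>s x y. s \<in> S \<Longrightarrow> x \<in> K \<Longrightarrow> y \<in> K \<Longrightarrow> s (x \<otimes> y) = s x \<otimes> s y"
    and char_one: "\<And>s. s \<in> S \<Longrightarrow> s \<one> = \<one>"
    and distinct: "\<And>s t. s \<in> S \<Longrightarrow> t \<in> S \<Longrightarrow> s \<noteq> t \<Longrightarrow> \<exists>x \<in> K. s x \<noteq> t x"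
    and "c \<in> S \<rightarrow> carrier R"
    and "\<And>z. z \<in> K \<Longrightarrow> (\<Oplus>s\<in>S. c s \<otimes> s z) = \<zero>"
  shows "\<forall>s \<in> S. c s = \<zero>"
  using assms(1,5-)
proof (induction S arbitrary: c)
  case empty
  then show ?case by simp
next
  case (insert t S)
  have cS: "c \<in> S \<rightarrow> carrier R" "c t \<in> carrier R"
    using insert.prems(5) by auto
  have t: "t x \<in> carrier R" if "x \<in> K" for x
    using insert.prems(1) that by auto
  have S: "s x \<in> carrier R" if "s \<in> S" "x \<in> K" for s x
    using insert.prems(1) that by auto
  have rel: "c t \<otimes> t z \<oplus> (\<Oplus>s\<in>S. c s \<otimes> s z) = \<zero>" if "z \<in> K" for z
    using insert.prems(6)[OF that] insert.hyps cS S t that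
    by (subst (asm) finsum_insert) (auto simp: Pi_iff)
  have coeff: "c s \<otimes> (s y \<ominus> t y) = \<zero>" if "y \<in> K" "s \<in> S" for y s
  proof -
    have "\<forall>s \<in> S. c s \<otimes> (s y \<ominus> t y) = \<zero>"
    proof (rule insert.IH)
      show "(\<lambda>s. c s \<otimes> (s y \<ominus> t y)) \<in> S \<rightarrow> carrier R"
        using cS S t that(1) by (auto simp: Pi_iff)
      fix z assume z: "z \<in> K"
      let ?a = "\<Oplus>s\<in>S. c s \<otimes> s (y \<otimes> z)" and ?b = "\<Oplus>s\<in>S. c s \<otimes> s z"
      have ab: "?a \<in> carrier R" "?b \<in> carrier R"
        using cS S z that(1) K(3) by (auto intro!: finsum_closed simp: Pi_iff)
      have "(\<Oplus>s\<in>S. c s \<otimes> (s y \<ominus> t y) \<otimes> s z)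
          = (\<Oplus>s\<in>S. c s \<otimes> s (y \<otimes> z) \<oplus> (\<ominus> t y) \<otimes> (c s \<otimes> s z))"
      proof (rule finsum_cong')
        fix s assume "s \<in> S"
        moreover from this have "c s \<in> carrier R" "s y \<in> carrier R" "s z \<in> carrier R" "t y \<in> carrier R"
          using cS S t z that(1) by auto
        ultimately show "c s \<otimes> (s y \<ominus> t y) \<otimes> s z = c s \<otimes> s (y \<otimes> z) \<oplus> (\<ominus> t y) \<otimes> (c s \<otimes> s z)"
          using insert.prems(2)[of s y z] z that(1)
          by (simp add: minus_eq r_distr l_distr l_minus r_minus m_ac)
      qed (use cS S t z that(1) K(3) in \<open>auto simp: Pi_iff\<close>)
      also have "\<dots> = ?a \<oplus> (\<Oplus>s\<in>S. (\<ominus> t y) \<otimes> (c s \<otimes> s z))"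
        using cS S t z that(1) K(3) by (intro finsum_addf) (auto simp: Pi_iff)
      also have "(\<Oplus>s\<in>S. (\<ominus> t y) \<otimes> (c s \<otimes> s z)) = (\<ominus> t y) \<otimes> ?b"
        using cS S t z that(1) insert.hyps by (intro finsum_rdistr[symmetric]) (auto simp: Pi_iff)
      also have "?a \<oplus> (\<ominus> t y) \<otimes> ?b = \<zero>"
      proof -
        have cl: "c t \<in> carrier R" "t y \<in> carrier R" "t z \<in> carrier R"
          using cS t that(1) z by auto
        have "?a = \<ominus> (c t \<otimes> (t y \<otimes> t z))"
          using rel[OF K(3)[OF that(1) z]] insert.prems(2)[of t y z] that(1) z ab cl
          by (intro sum_zero_eq_neg) (auto simp: a_comm)
        moreover have "?b = \<ominus> (c t \<otimes> t z)"
          using rel[OF z] ab cl by (intro sum_zero_eq_neg) (auto simp: a_comm)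
        ultimately show ?thesis
          using cl by (simp add: l_minus r_minus m_lcomm l_neg)
      qed
      finally show "(\<Oplus>s\<in>S. c s \<otimes> (s y \<ominus> t y) \<otimes> s z) = \<zero>" .
    qed (use insert.prems in auto)
    then show ?thesis using that by blast
  qed
  have zero: "\<forall>s \<in> S. c s = \<zero>"
  proof
    fix s assume s: "s \<in> S"
    then have "s \<noteq> t" using insert.hyps by auto
    then obtain y where y: "y \<in> K" "s y \<noteq> t y" using insert.prems(4)[of s t] s by auto
    then have "s y \<ominus> t y \<noteq> \<zero>" using S[OF s y(1)] t[OF y(1)] r_right_minus_eq by blast
    then show "c s = \<zero>"
      using coeff[OF y(1) s] integral cS s S[OF s y(1)] t[OF y(1)] by blast
  qed
  moreover have "c t = \<zero>"
  proof -
    have "(\<Oplus>s\<in>S. c s \<otimes> s \<one>) = (\<Oplus>s\<in>S. \<zero>)"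
      using zero S K(2) by (intro finsum_cong') auto
    then show ?thesis
      using rel[OF K(2)] insert.prems(3)[of t] cS by simp
  qed
  ultimately show ?case by simp
qed

section \<open>Automorphism groups of field extensions\<close>

lemma carrier_Gal: "carrier (Gal R K) = {\<sigma> \<in> ring_hom R R \<inter> Bij (carrier R). \<forall>x \<in> K. \<sigma> x = x}"
  by (simp add: Gal_def)

lemma (in field) subgroup_Gal:
  assumes "K \<subseteq> carrier R"
  shows "subgroup (carrier (Gal R K)) (BijGroup (carrier R))"
proof (rule group.subgroupI[OF group_BijGroup])
  show "carrier (Gal R K) \<subseteq> carrier (BijGroup (carrier R))"
    by (auto simp: carrier_Gal BijGroup_def)
  have "(\<lambda>x\<in>carrier R. x) \<in> carrier (Gal R K)"
    using assms by (auto simp: carrier_Gal id_Bij intro!: ring_hom_memI)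
  then show "carrier (Gal R K) \<noteq> {}" by blast
next
  fix s assume "s \<in> carrier (Gal R K)"
  then have s: "s \<in> ring_hom R R" "s \<in> Bij (carrier R)" "\<And>x. x \<in> K \<Longrightarrow> s x = x"
    by (auto simp: carrier_Gal)
  have bij: "bij_betw s (carrier R) (carrier R)" using s(2) by (simp add: Bij_def)
  let ?t = "\<lambda>x\<in>carrier R. inv_into (carrier R) s x"
  have t: "?t x \<in> carrier R" "s (?t x) = x" if "x \<in> carrier R" for x
    using bij that by (auto simp: bij_betw_def f_inv_into_f inv_into_into)
  have eqI: "?t x = y" if "s y = x" "x \<in> carrier R" "y \<in> carrier R" for x y
    using bij that by (auto simp: bij_betw_def)
  have "?t \<in> ring_hom R R"
  proof (rule ring_hom_memI)
    show "?t x \<in> carrier R" if "x \<in> carrier R" for x using t that by blast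
    show "?t (x \<otimes> y) = ?t x \<otimes> ?t y" if "x \<in> carrier R" "y \<in> carrier R" for x y
      using that t ring_hom_mult[OF s(1)] by (intro eqI) simp_all
    show "?t (x \<oplus> y) = ?t x \<oplus> ?t y" if "x \<in> carrier R" "y \<in> carrier R" for x y
      using that t ring_hom_add[OF s(1)] by (intro eqI) simp_all
    show "?t \<one> = \<one>"
      using ring_hom_one[OF s(1)] by (intro eqI) simp_all
  qed
  moreover have "?t x = x" if "x \<in> K" for x
    using that s(3) assms by (intro eqI) auto
  ultimately show "inv\<^bsub>BijGroup (carrier R)\<^esub> s \<in> carrier (Gal R K)"
    using s(2) inv_BijGroup[OF s(2)] restrict_inv_into_Bij[OF s(2)] by (simp add: carrier_Gal)
next
  fix s t assume "s \<in> carrier (Gal R K)" "t \<in> carrier (Gal R K)"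
  then have s: "s \<in> ring_hom R R" "s \<in> Bij (carrier R)" "\<And>x. x \<in> K \<Longrightarrow> s x = x"
    and t: "t \<in> ring_hom R R" "t \<in> Bij (carrier R)" "\<And>x. x \<in> K \<Longrightarrow> t x = x"
    by (auto simp: carrier_Gal)
  have "compose (carrier R) s t \<in> ring_hom R R"
    using ring_hom_memE[OF s(1)] ring_hom_memE[OF t(1)]
    by (auto intro!: ring_hom_memI simp: compose_def)
  then show "s \<otimes>\<^bsub>BijGroup (carrier R)\<^esub> t \<in> carrier (Gal R K)"
    using s t compose_Bij[OF s(2) t(2)] assms by (auto simp: BijGroup_def carrier_Gal compose_def)
qed

lemma (in field) group_Gal:
  assumes "K \<subseteq> carrier R"
  shows "group (Gal R K)"
proof -
  have "Gal R K = BijGroup (carrier R)\<lparr>carrier := carrier (Gal R K)\<rparr>"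
    by (simp add: Gal_def)
  then show ?thesis
    using subgroup.subgroup_is_group[OF subgroup_Gal[OF assms] group_BijGroup] by simp
qed

lemma Gal_mult:
  assumes "s \<in> carrier (Gal R K)" "t \<in> carrier (Gal R K)"
  shows "s \<otimes>\<^bsub>Gal R K\<^esub> t = compose (carrier R) s t"
  using assms by (simp add: Gal_def BijGroup_def)

lemma Gal_one: "\<one>\<^bsub>Gal R K\<^esub> = (\<lambda>x\<in>carrier R. x)"
  by (simp add: Gal_def BijGroup_def)

text \<open>
  An automorphism is determined by its values on a basis, and it can only move a basis vector
  to another root of a polynomial over the ground field.
\<close>

lemma (in field) finite_Gal:
  assumes Q: "subfield Q R" and "finite_dimension Q (carrier R)"
  shows "finite (carrier (Gal R Q))"
proof -
  obtain n where n: "dimension n Q (carrier R)"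
    using assms(2) by (auto simp: finite_dimension_def)
  obtain B where B: "set B \<subseteq> carrier R" "Span Q B = carrier R"
    using exists_base[OF Q n] by blast
  have alg: "\<exists>p. p \<in> carrier (Q[X]) \<and> p \<noteq> [] \<and> eval p x = \<zero>" if "x \<in> carrier R" for x
    by (rule algebraicE[OF subfieldE(1)[OF Q] that
          finite_dimension_imp_algebraic[OF Q carrier_is_subring assms(2) that]]) blast
  define p where "p x = (SOME p. p \<in> carrier (Q[X]) \<and> p \<noteq> [] \<and> eval p x = \<zero>)" for x
  have p: "p x \<in> carrier (Q[X])" "p x \<noteq> []" "eval (p x) x = \<zero>" if "x \<in> carrier R" for x
    using someI_ex[OF alg[OF that]] unfolding p_def by blast+
  define Z where "Z x = {y. is_root (p x) y}" for x
  have finZ: "finite (Z x)" if "x \<in> carrier R" for x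
    using finite_number_of_roots[of "p x"] p(1)[OF that] carrier_polynomial_shell[OF subfieldE(1)[OF Q]]
    unfolding Z_def by simp
  have hom_combine: "s (combine Ks Us) = combine (map s Ks) (map s Us)"
    if "s \<in> ring_hom R R" "set Ks \<subseteq> carrier R" "set Us \<subseteq> carrier R" for s Ks Us
    using that(2,3)
    by (induction Ks Us rule: combine.induct)
       (auto simp: ring_hom_add[OF that(1)] ring_hom_mult[OF that(1)] ring_hom_zero[OF that(1)] ring_axioms)
  have root: "s x \<in> Z x" if s: "s \<in> carrier (Gal R Q)" and x: "x \<in> carrier R" for s x
  proof -
    have sh: "s \<in> ring_hom R R" "\<And>x. x \<in> Q \<Longrightarrow> s x = x" using s by (auto simp: carrier_Gal)
    interpret S: ring_hom_ring R R s by (rule ring_hom_ringI2[OF ring_axioms ring_axioms sh(1)])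
    have px: "set (p x) \<subseteq> Q"
      using p(1)[OF x] by (auto simp: univ_poly_def polynomial_def)
    have "eval (map s (p x)) (s x) = s (eval (p x) x)"
      using S.eval_hom[OF carrier_is_subring x]
        carrier_polynomial_shell[OF subfieldE(1)[OF Q] p(1)[OF x]] by simp
    moreover have "map s (p x) = p x" using px sh(2) by (intro map_idI) blast
    ultimately have "eval (p x) (s x) = \<zero>"
      using p(3)[OF x] S.hom_zero by simp
    then show ?thesis
      using p(2)[OF x] ring_hom_closed[OF sh(1) x] by (simp add: Z_def is_root_def)
  qed
  have "inj_on (\<lambda>s. map s B) (carrier (Gal R Q))"
  proof (rule inj_onI)
    fix s t assume st: "s \<in> carrier (Gal R Q)" "t \<in> carrier (Gal R Q)" "map s B = map t B"
    have "s x = t x" if x: "x \<in> carrier R" for x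
    proof -
      obtain Ks where Ks: "set Ks \<subseteq> Q" "x = combine Ks B"
        using Span_mem_iff_length_version[OF Q B(1), of x] x unfolding B(2) by blast
      have st': "s \<in> ring_hom R R" "t \<in> ring_hom R R" using st(1,2) by (simp_all add: carrier_Gal)
      have Ks': "set Ks \<subseteq> carrier R" using Ks(1) subfieldE(3)[OF Q] by blast
      have "s k = k" "t k = k" if "k \<in> set Ks" for k
        using Ks(1) st(1,2) that unfolding carrier_Gal by blast+
      then have "map s Ks = map t Ks" by simp
      then show ?thesis
        unfolding Ks(2) hom_combine[OF st'(1) Ks' B(1)] hom_combine[OF st'(2) Ks' B(1)] st(3)
        by (simp only:)
    qed
    then show "s = t"
      using st(1,2) extensionalityI[of s "carrier R" t] unfolding carrier_Gal Bij_def by blast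
  qed
  moreover have "(\<lambda>s. map s B) ` carrier (Gal R Q) \<subseteq> {xs. set xs \<subseteq> \<Union> (Z ` set B) \<and> length xs = length B}"
  proof (rule image_subsetI)
    fix s assume "s \<in> carrier (Gal R Q)"
    then have "s x \<in> \<Union> (Z ` set B)" if "x \<in> set B" for x
      using root[of s x] B(1) that by blast
    then show "map s B \<in> {xs. set xs \<subseteq> \<Union> (Z ` set B) \<and> length xs = length B}"
      by (simp add: image_subset_iff)
  qed
  moreover have "finite {xs. set xs \<subseteq> \<Union> (Z ` set B) \<and> length xs = length B}"
    using finZ B(1) by (intro finite_lists_length_eq) blast
  ultimately show ?thesis
    using finite_imageD finite_subset by blast
qed

section \<open>Fixed fields in characteristic zero\<close>

locale galois_char_zero = field R for R :: "('a, 'b) ring_scheme" (structure) +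
  fixes Q :: "'a set"
  assumes galois: "galois_extension R Q"
    and char_zero: "n > 0 \<Longrightarrow> [(n::nat)] \<cdot>\<^bsub>R\<^esub> \<one> \<noteq> \<zero>"
begin

abbreviation G :: "('a \<Rightarrow> 'a) monoid" where "G \<equiv> Gal R Q"

lemma Q_subfield: "subfield Q R"
  using galois by (simp add: galois_extension_def)

lemma Q_carrier: "Q \<subseteq> carrier R"
  using subfieldE(3)[OF Q_subfield] .

end

sublocale galois_char_zero \<subseteq> grp: group "Gal R Q"
  by (rule group_Gal) (rule Q_carrier)

context galois_char_zero
begin

lemma finite_G: "finite (carrier G)"
  using galois finite_Gal by (simp add: galois_extension_def)

lemma G_hom: "s \<in> carrier G \<Longrightarrow> s \<in> ring_hom R R"
  by (simp add: carrier_Gal)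

lemma G_closed [simp]: "s \<in> carrier G \<Longrightarrow> x \<in> carrier R \<Longrightarrow> s x \<in> carrier R"
  using ring_hom_closed[OF G_hom] .

lemma G_add: "s \<in> carrier G \<Longrightarrow> x \<in> carrier R \<Longrightarrow> y \<in> carrier R \<Longrightarrow> s (x \<oplus> y) = s x \<oplus> s y"
  using ring_hom_add[OF G_hom] .

lemma G_mult: "s \<in> carrier G \<Longrightarrow> x \<in> carrier R \<Longrightarrow> y \<in> carrier R \<Longrightarrow> s (x \<otimes> y) = s x \<otimes> s y"
  using ring_hom_mult[OF G_hom] .

lemma G_one [simp]: "s \<in> carrier G \<Longrightarrow> s \<one> = \<one>"
  using ring_hom_one[OF G_hom] .

lemma G_zero [simp]: "s \<in> carrier G \<Longrightarrow> s \<zero> = \<zero>"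
  using ring_hom_zero[OF G_hom] ring_axioms by blast

lemma G_minus: "s \<in> carrier G \<Longrightarrow> x \<in> carrier R \<Longrightarrow> s (\<ominus> x) = \<ominus> (s x)"
proof -
  assume s: "s \<in> carrier G" and x: "x \<in> carrier R"
  have "s (\<ominus> x) \<oplus> s x = \<zero>"
    using G_add[OF s a_inv_closed[OF x] x] x s by (simp add: l_neg)
  then show ?thesis
    using minus_equality[of "s (\<ominus> x)" "s x"] s x by simp
qed

lemma G_pow: "s \<in> carrier G \<Longrightarrow> x \<in> carrier R \<Longrightarrow> s (x [^] (n::nat)) = s x [^] n"
  by (induction n) (simp_all add: G_mult)

lemma G_Bij: "s \<in> carrier G \<Longrightarrow> s \<in> Bij (carrier R)"
  by (simp add: carrier_Gal)

lemma G_inj: "s \<in> carrier G \<Longrightarrow> x \<in> carrier R \<Longrightarrow> y \<in> carrier R \<Longrightarrow> s x = s y \<longleftrightarrow> x = y"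
  using G_Bij by (auto simp: Bij_def bij_betw_def inj_on_def)

lemma G_inverse: "s \<in> carrier G \<Longrightarrow> x \<in> carrier R \<Longrightarrow> x \<noteq> \<zero> \<Longrightarrow> s (inv x) = inv (s x)"
proof -
  assume s: "s \<in> carrier G" and x: "x \<in> carrier R" "x \<noteq> \<zero>"
  then have ix: "inv x \<in> carrier R" "x \<otimes> inv x = \<one>" by (simp_all add: field_Units)
  then have "s x \<otimes> s (inv x) = \<one>" using s x G_mult[of s x "inv x"] by simp
  then show ?thesis using comm_inv_char[of "s x" "s (inv x)"] s x ix by simp
qed

lemma G_Q: "s \<in> carrier G \<Longrightarrow> x \<in> Q \<Longrightarrow> s x = x"
  by (simp add: carrier_Gal)

lemma mult_apply:
  "s \<in> carrier G \<Longrightarrow> t \<in> carrier G \<Longrightarrow> x \<in> carrier R \<Longrightarrow> (s \<otimes>\<^bsub>G\<^esub> t) x = s (t x)"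
  by (simp add: Gal_mult compose_def)

lemma one_apply: "x \<in> carrier R \<Longrightarrow> \<one>\<^bsub>G\<^esub> x = x"
  by (simp add: Gal_one)

lemma inv_apply:
  assumes "s \<in> carrier G" "x \<in> carrier R"
  shows "(inv\<^bsub>G\<^esub> s) (s x) = x" and "s ((inv\<^bsub>G\<^esub> s) x) = x"
  using mult_apply[of "inv\<^bsub>G\<^esub> s" s x] mult_apply[of s "inv\<^bsub>G\<^esub> s" x] assms one_apply by simp_all

lemma G_eqI:
  assumes "s \<in> carrier G" "t \<in> carrier G" "\<And>x. x \<in> carrier R \<Longrightarrow> s x = t x"
  shows "s = t"
  using assms extensionalityI[of s "carrier R" t] by (auto simp: carrier_Gal Bij_def)

definition fixed_field :: "('a \<Rightarrow> 'a) set \<Rightarrow> 'a set" where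
  "fixed_field V = {x \<in> carrier R. \<forall>s \<in> V. s x = x}"

definition fixer :: "'a set \<Rightarrow> ('a \<Rightarrow> 'a) set" where
  "fixer K = {s \<in> carrier G. \<forall>x \<in> K. s x = x}"

lemma fixed_field_carrier: "fixed_field (carrier G) = Q"
  using galois by (simp add: galois_extension_def fixed_field_def)

lemma fixed_field_subfield:
  assumes "V \<subseteq> carrier G"
  shows "subfield (fixed_field V) R"
proof (rule subfieldI'[OF subringI])
  show "inv k \<in> fixed_field V" if "k \<in> fixed_field V - {\<zero>}" for k
  proof -
    have k: "k \<in> carrier R" "k \<noteq> \<zero>" "\<And>s. s \<in> V \<Longrightarrow> s k = k"
      using that by (auto simp: fixed_field_def)
    then have "s (inv k) = inv k" if "s \<in> V" for s
      using G_inverse[of s k] that assms by (metis subsetD)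
    then show ?thesis using k by (simp add: fixed_field_def field_Units)
  qed
next
  have V: "s \<in> carrier G" if "s \<in> V" for s using that assms by blast
  show "\<ominus> x \<in> fixed_field V" if "x \<in> fixed_field V" for x
  proof -
    have x: "x \<in> carrier R" "s x = x" if "s \<in> V" for s
      using \<open>x \<in> fixed_field V\<close> that by (auto simp: fixed_field_def)
    have "s (\<ominus> x) = \<ominus> x" if "s \<in> V" for s
      using G_minus[OF V[OF that] x(1)[OF that]] x(2)[OF that] by simp
    then show ?thesis using that by (simp add: fixed_field_def)
  qed
  show "x \<otimes> y \<in> fixed_field V" if xy: "x \<in> fixed_field V" "y \<in> fixed_field V" for x y
  proof -
    have x: "x \<in> carrier R" "s x = x" "y \<in> carrier R" "s y = y" if "s \<in> V" for s
      using xy that by (auto simp: fixed_field_def)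
    have "s (x \<otimes> y) = x \<otimes> y" if "s \<in> V" for s
      using G_mult[OF V[OF that] x(1)[OF that] x(3)[OF that]] x(2,4)[OF that] by simp
    then show ?thesis using xy by (simp add: fixed_field_def)
  qed
  show "x \<oplus> y \<in> fixed_field V" if xy: "x \<in> fixed_field V" "y \<in> fixed_field V" for x y
  proof -
    have x: "x \<in> carrier R" "s x = x" "y \<in> carrier R" "s y = y" if "s \<in> V" for s
      using xy that by (auto simp: fixed_field_def)
    have "s (x \<oplus> y) = x \<oplus> y" if "s \<in> V" for s
      using G_add[OF V[OF that] x(1)[OF that] x(3)[OF that]] x(2,4)[OF that] by simp
    then show ?thesis using xy by (simp add: fixed_field_def)
  qed
qed (use assms in \<open>auto simp: fixed_field_def subset_iff\<close>)

lemma Q_fixed_field: "V \<subseteq> carrier G \<Longrightarrow> Q \<subseteq> fixed_field V"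
  using G_Q Q_carrier by (auto simp: fixed_field_def)

lemma fixer_subgroup:
  assumes "K \<subseteq> carrier R"
  shows "subgroup (fixer K) G"
proof (rule grp.subgroupI)
  show "fixer K \<noteq> {}"
    using assms one_apply grp.one_closed by (auto simp: fixer_def subset_iff)
  show "inv\<^bsub>G\<^esub> s \<in> fixer K" if s: "s \<in> fixer K" for s
  proof -
    have "(inv\<^bsub>G\<^esub> s) x = x" if "x \<in> K" for x
      using inv_apply(1)[of s x] s that assms by (auto simp: fixer_def)
    then show ?thesis using s by (simp add: fixer_def)
  qed
  show "s \<otimes>\<^bsub>G\<^esub> t \<in> fixer K" if "s \<in> fixer K" "t \<in> fixer K" for s t
  proof -
    have "(s \<otimes>\<^bsub>G\<^esub> t) x = x" if "x \<in> K" for x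
      using mult_apply[of s t x] \<open>s \<in> fixer K\<close> \<open>t \<in> fixer K\<close> that assms by (auto simp: fixer_def)
    then show ?thesis using \<open>s \<in> fixer K\<close> \<open>t \<in> fixer K\<close> by (simp add: fixer_def)
  qed
qed (auto simp: fixer_def)

lemma carrier_Gal_fixer: "Q \<subseteq> K \<Longrightarrow> carrier (Gal R K) = fixer K"
  by (auto simp: fixer_def carrier_Gal)

lemma Gal_fixer: "Q \<subseteq> K \<Longrightarrow> Gal R K = G\<lparr>carrier := fixer K\<rparr>"
  using carrier_Gal_fixer[of K] by (simp add: Gal_def)

lemma nat_mult_closed_subfield:
  assumes "subfield K R" "x \<in> K"
  shows "[(n::nat)] \<cdot>\<^bsub>R\<^esub> x \<in> K"
  using assms subringE[OF subfieldE(1)[OF assms(1)]]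
  by (induction n) (simp_all add: add.nat_pow_Suc)

lemma nat_mult_eq:
  assumes "x \<in> carrier R"
  shows "[(n::nat)] \<cdot>\<^bsub>R\<^esub> x = [n] \<cdot>\<^bsub>R\<^esub> \<one> \<otimes> x"
  using assms add_pow_ldistr[of \<one> x n] by simp

lemma nat_mult_cancel:
  assumes K: "subfield K R" and "n > 0" "x \<in> carrier R" "[(n::nat)] \<cdot>\<^bsub>R\<^esub> x \<in> K"
  shows "x \<in> K"
proof -
  let ?n = "[n] \<cdot>\<^bsub>R\<^esub> \<one>"
  have n: "?n \<in> K" "?n \<noteq> \<zero>" "?n \<in> carrier R"
    using nat_mult_closed_subfield[OF K subringE(3)[OF subfieldE(1)[OF K]]] char_zero assms(2) by auto
  then have "inv ?n \<in> K" using subfield_m_inv(1)[OF K] by simp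
  then have "inv ?n \<otimes> (?n \<otimes> x) \<in> K"
    using subringE(6)[OF subfieldE(1)[OF K]] assms(4) nat_mult_eq[OF assms(3)] by metis
  moreover have "inv ?n \<otimes> (?n \<otimes> x) = x"
    using n assms(3) by (simp add: m_assoc[symmetric] field_Units)
  ultimately show ?thesis by simp
qed

lemma nat_mult_one_inj:
  assumes "[(m::nat)] \<cdot>\<^bsub>R\<^esub> \<one> = [(n::nat)] \<cdot>\<^bsub>R\<^esub> \<one>"
  shows "m = n"
  using assms
proof (induction m n rule: linorder_wlog)
  case (le m n)
  then have "[m] \<cdot>\<^bsub>R\<^esub> \<one> \<oplus> [(n - m)] \<cdot>\<^bsub>R\<^esub> \<one> = [m] \<cdot>\<^bsub>R\<^esub> \<one> \<oplus> \<zero>"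
    using add.nat_pow_mult[of \<one> m "n - m"] by simp
  then have "[(n - m)] \<cdot>\<^bsub>R\<^esub> \<one> = \<zero>"
    using add.l_cancel by simp
  then show ?case using char_zero[of "n - m"] le(1) by fastforce
qed simp

definition trace :: "('a \<Rightarrow> 'a) set \<Rightarrow> 'a \<Rightarrow> 'a" where
  "trace V z = (\<Oplus>s\<in>V. s z)"

lemma subgroup_sum_shift:
  assumes V: "subgroup V G" and u: "u \<in> V" and f: "f \<in> V \<rightarrow> carrier R"
  shows "(\<Oplus>s\<in>V. f (u \<otimes>\<^bsub>G\<^esub> s)) = (\<Oplus>s\<in>V. f s)"
proof -
  have car: "s \<in> carrier G" if "s \<in> V" for s using that subgroup.subset[OF V] by blast
  have img: "(\<lambda>s. u \<otimes>\<^bsub>G\<^esub> s) ` V = V"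
  proof
    show "(\<lambda>s. u \<otimes>\<^bsub>G\<^esub> s) ` V \<subseteq> V" using V u by (auto simp: subgroup.m_closed)
    show "V \<subseteq> (\<lambda>s. u \<otimes>\<^bsub>G\<^esub> s) ` V"
    proof
      fix s assume s: "s \<in> V"
      have "s = u \<otimes>\<^bsub>G\<^esub> (inv\<^bsub>G\<^esub> u \<otimes>\<^bsub>G\<^esub> s)"
        using car[OF u] car[OF s] by (simp add: grp.m_assoc[symmetric])
      moreover have "inv\<^bsub>G\<^esub> u \<otimes>\<^bsub>G\<^esub> s \<in> V"
        using V u s by (simp add: subgroup.m_closed subgroup.m_inv_closed)
      ultimately show "s \<in> (\<lambda>s. u \<otimes>\<^bsub>G\<^esub> s) ` V" by blast
    qed
  qed
  have "inj_on (\<lambda>s. u \<otimes>\<^bsub>G\<^esub> s) V"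
    using car u by (auto simp: inj_on_def)
  then show ?thesis
    using finsum_reindex[of f "\<lambda>s. u \<otimes>\<^bsub>G\<^esub> s" V] f unfolding img by simp
qed

lemma G_finsum:
  assumes "finite A" "f \<in> A \<rightarrow> carrier R" "s \<in> carrier G"
  shows "s (\<Oplus>a\<in>A. f a) = (\<Oplus>a\<in>A. s (f a))"
  using finsum_additive_map[OF assms(1,2), of s] assms(3) G_add by auto

lemma finite_subgroup: "subgroup V G \<Longrightarrow> finite V"
  using finite_G subgroup.subset finite_subset by metis

lemma trace_closed: "subgroup V G \<Longrightarrow> z \<in> carrier R \<Longrightarrow> trace V z \<in> carrier R"
  using subgroup.subset by (fastforce simp: trace_def intro!: finsum_closed)

lemma trace_fixed:
  assumes V: "subgroup V G" and z: "z \<in> carrier R"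
  shows "trace V z \<in> fixed_field V"
proof -
  have car: "s \<in> carrier G" if "s \<in> V" for s using that subgroup.subset[OF V] by blast
  have "u (trace V z) = trace V z" if u: "u \<in> V" for u
  proof -
    have "u (trace V z) = (\<Oplus>s\<in>V. u (s z))"
      using G_finsum[OF finite_subgroup[OF V] _ car[OF u], of "\<lambda>s. s z"] car z by (simp add: trace_def)
    also have "\<dots> = (\<Oplus>s\<in>V. (u \<otimes>\<^bsub>G\<^esub> s) z)"
      using car u z by (intro finsum_cong') (auto simp: mult_apply)
    also have "\<dots> = trace V z"
      using subgroup_sum_shift[OF V u, of "\<lambda>s. s z"] car z by (simp add: trace_def)
    finally show ?thesis .
  qed
  then show ?thesis using trace_closed[OF V z] by (simp add: fixed_field_def)
qed

lemma trace_add: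
  assumes "subgroup V G" "x \<in> carrier R" "y \<in> carrier R"
  shows "trace V (x \<oplus> y) = trace V x \<oplus> trace V y"
proof -
  have car: "s \<in> carrier G" if "s \<in> V" for s using that subgroup.subset[OF assms(1)] by blast
  have "trace V (x \<oplus> y) = (\<Oplus>s\<in>V. s x \<oplus> s y)"
    unfolding trace_def using car assms by (intro finsum_cong') (auto simp: G_add)
  also have "\<dots> = trace V x \<oplus> trace V y"
    unfolding trace_def using car assms by (intro finsum_addf) auto
  finally show ?thesis .
qed

lemma trace_zero: "subgroup V G \<Longrightarrow> trace V \<zero> = \<zero>"
  using trace_add[of V \<zero> \<zero>] trace_closed[of V \<zero>] by simp

lemma trace_scale:
  assumes "subgroup V G" "x \<in> carrier R" "q \<in> fixed_field V"
  shows "trace V (q \<otimes> x) = q \<otimes> trace V x"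
proof -
  have car: "s \<in> carrier G" if "s \<in> V" for s using that subgroup.subset[OF assms(1)] by blast
  have q: "q \<in> carrier R" "\<And>s. s \<in> V \<Longrightarrow> s q = q" using assms(3) by (auto simp: fixed_field_def)
  have "trace V (q \<otimes> x) = (\<Oplus>s\<in>V. q \<otimes> s x)"
    unfolding trace_def using car assms(2) q G_mult by (intro finsum_cong') (auto simp del: G_one, metis)
  also have "\<dots> = q \<otimes> trace V x"
    unfolding trace_def using car assms(2) q(1) finite_subgroup[OF assms(1)]
    by (intro finsum_rdistr[symmetric]) auto
  finally show ?thesis .
qed

subsection \<open>Separating functions\<close>

text \<open>
  For a subring \<open>K\<close>, each such function is a sum of terms \<open>x\<^sub>i s(y\<^sub>i)\<close> with \<open>y\<^sub>i\<close> in \<open>K\<close>. Building them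
  as products keeps the sum implicit, so that statements about it become inductions over the factors.
\<close>

inductive separating :: "'a set \<Rightarrow> (('a \<Rightarrow> 'a) \<Rightarrow> 'a) \<Rightarrow> bool" for K where
  one: "separating K (\<lambda>s. \<one>)"
| step: "separating K f \<Longrightarrow> y \<in> K \<Longrightarrow> c \<in> carrier R \<Longrightarrow> d \<in> carrier R
    \<Longrightarrow> separating K (\<lambda>s. f s \<otimes> (s y \<ominus> c) \<otimes> d)"

lemma separating_closed:
  assumes "separating K f" "K \<subseteq> carrier R" "s \<in> carrier G"
  shows "f s \<in> carrier R"
  using assms(1)
proof induction
  case (step f y c d)
  then have "s y \<in> carrier R" using assms(2,3) by auto
  then show ?case using step by simp
qed simp

text \<open>
  The factor \<open>(s(y) - t(y)) / (y - t(y))\<close> is \<open>1\<close> if \<open>s\<close> fixes \<open>y\<close> and vanishes at \<open>s = t\<close>.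
\<close>

lemma separating_exists:
  assumes "finite T" "T \<subseteq> carrier G" "T \<inter> fixer K = {}" and K: "K \<subseteq> carrier R"
  shows "\<exists>f. separating K f \<and> (\<forall>s \<in> fixer K. f s = \<one>) \<and> (\<forall>t \<in> T. f t = \<zero>)"
  using assms(1-3)
proof (induction T)
  case empty
  show ?case using separating.one by blast
next
  case (insert t T)
  then obtain f where f: "separating K f" "\<And>s. s \<in> fixer K \<Longrightarrow> f s = \<one>" "\<And>t. t \<in> T \<Longrightarrow> f t = \<zero>"
    by auto
  obtain y where y: "y \<in> K" "t y \<noteq> y"
    using insert.prems by (auto simp: fixer_def)
  have t: "t \<in> carrier G" using insert.prems by auto
  then have car: "y \<in> carrier R" "t y \<in> carrier R" using y K by auto
  let ?d = "inv (y \<ominus> t y)"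
  have ne: "y \<ominus> t y \<noteq> \<zero>" using y(2) r_right_minus_eq[OF car] by metis
  then have d: "?d \<in> carrier R" "(y \<ominus> t y) \<otimes> ?d = \<one>"
    using car by (simp_all add: field_Units)
  let ?g = "\<lambda>s. f s \<otimes> (s y \<ominus> t y) \<otimes> ?d"
  have "separating K ?g" using separating.step[OF f(1) y(1) car(2) d(1)] .
  moreover have "?g s = \<one>" if s: "s \<in> fixer K" for s
  proof -
    have "s y = y" using s y(1) by (simp add: fixer_def)
    then show ?thesis using f(2)[OF s] d car by simp
  qed
  moreover have "?g u = \<zero>" if u: "u \<in> insert t T" for u
  proof (cases "u = t")
    case True
    then show ?thesis
      using car d separating_closed[OF f(1) K t] by (simp add: r_right_minus_eq[THEN iffD2])
  next
    case False
    then have "f u = \<zero>" "u \<in> carrier G" using u f(3) insert.prems by auto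
    then show ?thesis using car d by simp
  qed
  ultimately show ?case by blast
qed

text \<open>
  For \<open>f s = \<Sum> x\<^sub>i s(y\<^sub>i)\<close> the inverse moves the \<open>y\<^sub>i\<close> out of the sum over \<open>V\<close>: the value is
  \<open>\<Sum> y\<^sub>i tr\<^sub>V(x\<^sub>i z)\<close>. It therefore lies in every field that contains the \<open>y\<^sub>i\<close> and the fixed field of
  \<open>V\<close>.
\<close>

definition averaging :: "('a \<Rightarrow> 'a) set \<Rightarrow> (('a \<Rightarrow> 'a) \<Rightarrow> 'a) \<Rightarrow> 'a \<Rightarrow> 'a" where
  "averaging V f z = (\<Oplus>s\<in>V. s (f (inv\<^bsub>G\<^esub> s) \<otimes> z))"

lemma averaging_one: "subgroup V G \<Longrightarrow> z \<in> carrier R \<Longrightarrow> averaging V (\<lambda>s. \<one>) z = trace V z"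
  unfolding averaging_def trace_def
  using subgroup.subset by (intro finsum_cong') (fastforce+)

lemma averaging_closed:
  assumes "subgroup V G" "f \<in> carrier G \<rightarrow> carrier R" "z \<in> carrier R"
  shows "averaging V f z \<in> carrier R"
proof -
  have car: "s \<in> carrier G" if "s \<in> V" for s using that subgroup.subset[OF assms(1)] by blast
  have "f (inv\<^bsub>G\<^esub> s) \<in> carrier R" if "s \<in> V" for s
    using assms(2) grp.inv_closed[OF car[OF that]] by blast
  then show ?thesis unfolding averaging_def using car assms by (intro finsum_closed) auto
qed

lemma averaging_step:
  assumes V: "subgroup V G" and f: "f \<in> carrier G \<rightarrow> carrier R"
    and car: "z \<in> carrier R" "y \<in> carrier R" "c \<in> carrier R" "d \<in> carrier R"
  shows "averaging V (\<lambda>s. f s \<otimes> (s y \<ominus> c) \<otimes> d) z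
    = y \<otimes> averaging V f (d \<otimes> z) \<ominus> averaging V f (c \<otimes> (d \<otimes> z))"
proof -
  have VG: "s \<in> carrier G" "inv\<^bsub>G\<^esub> s \<in> carrier G" if "s \<in> V" for s
    using that subgroup.subset[OF V] by auto
  have fc: "f (inv\<^bsub>G\<^esub> s) \<in> carrier R" if "s \<in> V" for s using f VG(2)[OF that] by auto
  have "averaging V (\<lambda>s. f s \<otimes> (s y \<ominus> c) \<otimes> d) z =
      (\<Oplus>s\<in>V. y \<otimes> s (f (inv\<^bsub>G\<^esub> s) \<otimes> (d \<otimes> z)) \<oplus> \<ominus> \<one> \<otimes> s (f (inv\<^bsub>G\<^esub> s) \<otimes> (c \<otimes> (d \<otimes> z))))"
    unfolding averaging_def
  proof (rule finsum_cong')
    fix s assume s: "s \<in> V"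
    let ?a = "f (inv\<^bsub>G\<^esub> s)" and ?y = "(inv\<^bsub>G\<^esub> s) y"
    have a: "?a \<in> carrier R" "?y \<in> carrier R" using fc VG s car by auto
    have "?a \<otimes> (?y \<ominus> c) \<otimes> d \<otimes> z = ?y \<otimes> (?a \<otimes> (d \<otimes> z)) \<oplus> \<ominus> (?a \<otimes> (c \<otimes> (d \<otimes> z)))"
      using a car by (simp add: minus_eq r_distr l_distr l_minus r_minus m_ac)
    moreover have "s (?y \<otimes> (?a \<otimes> (d \<otimes> z)) \<oplus> \<ominus> (?a \<otimes> (c \<otimes> (d \<otimes> z))))
        = s ?y \<otimes> s (?a \<otimes> (d \<otimes> z)) \<oplus> \<ominus> s (?a \<otimes> (c \<otimes> (d \<otimes> z)))"
      using a car VG(1)[OF s] G_add G_mult G_minus by simp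
    moreover have "s ?y = y" using inv_apply(2) VG(1)[OF s] car by simp
    moreover have "s (?a \<otimes> (c \<otimes> (d \<otimes> z))) \<in> carrier R" using a car VG(1)[OF s] by simp
    ultimately show "s (?a \<otimes> (?y \<ominus> c) \<otimes> d \<otimes> z)
        = y \<otimes> s (?a \<otimes> (d \<otimes> z)) \<oplus> \<ominus> \<one> \<otimes> s (?a \<otimes> (c \<otimes> (d \<otimes> z)))"
      by (simp add: l_minus)
  qed (use VG fc car in auto)
  also have "\<dots> = (\<Oplus>s\<in>V. y \<otimes> s (f (inv\<^bsub>G\<^esub> s) \<otimes> (d \<otimes> z)))
      \<oplus> (\<Oplus>s\<in>V. \<ominus> \<one> \<otimes> s (f (inv\<^bsub>G\<^esub> s) \<otimes> (c \<otimes> (d \<otimes> z))))"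
    using VG fc car by (intro finsum_addf) auto
  also have "\<dots> = y \<otimes> averaging V f (d \<otimes> z) \<oplus> \<ominus> \<one> \<otimes> averaging V f (c \<otimes> (d \<otimes> z))"
    unfolding averaging_def using VG fc car finite_subgroup[OF V]
    by (intro arg_cong2[of _ _ _ _ "(\<oplus>)"] finsum_rdistr[symmetric]) auto
  finally show ?thesis
    using averaging_closed[OF V f] car by (simp add: l_minus minus_eq)
qed

lemma separating_averaging:
  assumes "separating K f" "subgroup V G" and K: "subfield K R" and "fixed_field V \<subseteq> K"
    and "z \<in> carrier R"
  shows "averaging V f z \<in> K"
  using assms(1,5)
proof (induction arbitrary: z)
  case one
  then show ?case using averaging_one trace_fixed assms by auto
next
  case (step f y c d)
  have "f \<in> carrier G \<rightarrow> carrier R"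
    using separating_closed[OF step.hyps(1) subfieldE(3)[OF K]] by blast
  moreover have "y \<in> carrier R" using step.hyps subfieldE(3)[OF K] by auto
  ultimately show ?case
    using averaging_step[OF assms(2), of f z y c d] step subringE[OF subfieldE(1)[OF K]]
    by (simp add: minus_eq)
qed

lemma averaging_indicator:
  assumes V: "subgroup V G" and W: "subgroup W G" "W \<subseteq> V"
    and f: "\<And>s. s \<in> W \<Longrightarrow> f s = \<one>" "\<And>s. s \<in> V - W \<Longrightarrow> f s = \<zero>"
    and z: "z \<in> fixed_field W"
  shows "averaging V f z = [(card W)] \<cdot>\<^bsub>R\<^esub> z"
proof -
  have VG: "s \<in> carrier G" "inv\<^bsub>G\<^esub> s \<in> V" if "s \<in> V" for s
    using that subgroup.subset[OF V] subgroup.m_inv_closed[OF V] by auto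
  have zc: "z \<in> carrier R" "\<And>s. s \<in> W \<Longrightarrow> s z = z" using z by (auto simp: fixed_field_def)
  have inv_W: "inv\<^bsub>G\<^esub> s \<in> W \<longleftrightarrow> s \<in> W" if "s \<in> V" for s
    using subgroup.m_inv_closed[OF W(1)] grp.inv_inv VG(1)[OF that] by metis
  have eq: "s (f (inv\<^bsub>G\<^esub> s) \<otimes> z) = (if s \<in> W then z else \<zero>)" if s: "s \<in> V" for s
    using f inv_W[OF s] VG[OF s] zc by auto
  have "averaging V f z = (\<Oplus>s\<in>V. if s \<in> W then z else \<zero>)"
    unfolding averaging_def
  proof (rule finsum_cong')
    show "(\<lambda>s. if s \<in> W then z else \<zero>) \<in> V \<rightarrow> carrier R" using zc by simp
  qed (use eq in auto)
  also have "\<dots> = (\<Oplus>s\<in>W. z)"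
    using W(2) zc finite_subgroup[OF V] by (intro add.finprod_mono_neutral_cong_right) auto
  also have "\<dots> = [(card W)] \<cdot>\<^bsub>R\<^esub> z"
    using zc by (simp add: add.finprod_const)
  finally show ?thesis .
qed

text \<open>
  Averaging with the indicator of \<open>W = V \<inter> fixer K\<close> multiplies an element fixed by \<open>W\<close> by \<open>|W|\<close>, and the
  result lies in \<open>K\<close>; in characteristic zero \<open>|W|\<close> can be cancelled.
\<close>

lemma fixed_field_intermediate:
  assumes V: "subgroup V G" and K: "subfield K R" and "fixed_field V \<subseteq> K"
  shows "fixed_field (V \<inter> fixer K) = K"
proof
  have Kc: "K \<subseteq> carrier R" using subfieldE(3)[OF K] .
  show "K \<subseteq> fixed_field (V \<inter> fixer K)"
    using Kc by (auto simp: fixed_field_def fixer_def)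
  have W: "subgroup (V \<inter> fixer K) G"
    using grp.subgroups_Inter_pair V fixer_subgroup[OF Kc] by blast
  obtain f where f: "separating K f" "\<And>s. s \<in> fixer K \<Longrightarrow> f s = \<one>" "\<And>s. s \<in> V - fixer K \<Longrightarrow> f s = \<zero>"
    using separating_exists[of "V - fixer K" K] finite_subgroup[OF V] subgroup.subset[OF V] Kc by blast
  show "fixed_field (V \<inter> fixer K) \<subseteq> K"
  proof
    fix z assume z: "z \<in> fixed_field (V \<inter> fixer K)"
    then have zc: "z \<in> carrier R" by (simp add: fixed_field_def)
    have "[(card (V \<inter> fixer K))] \<cdot>\<^bsub>R\<^esub> z \<in> K"
      using averaging_indicator[OF V W _ _ _ z, of f] f(2,3) separating_averaging[OF f(1) V K assms(3) zc]
      by auto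
    moreover have "card (V \<inter> fixer K) > 0"
      using finite_subgroup[OF W] subgroup.one_closed[OF W] card_gt_0_iff by blast
    ultimately show "z \<in> K" using nat_mult_cancel[OF K _ zc] by blast
  qed
qed

end

section \<open>Degrees and the fixed-field correspondence\<close>

lemma (in ring) combine_eq_finsum:
  assumes "length Ks = length Us" "set Ks \<subseteq> carrier R" "set Us \<subseteq> carrier R"
  shows "combine Ks Us = (\<Oplus>i\<in>{..<length Us}. Ks ! i \<otimes> Us ! i)"
  using assms
proof (induction Ks Us rule: list_induct2)
  case Nil
  then show ?case by simp
next
  case (Cons k Ks u Us)
  let ?f = "\<lambda>i. (k # Ks) ! i \<otimes> (u # Us) ! i"
  have car: "Ks ! i \<otimes> Us ! i \<in> carrier R" if "i < length Us" for i
    using Cons that by (metis list.set_intros(2) m_closed nth_mem set_ConsD set_subset_Cons subset_iff)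
  have "{..<length (u # Us)} = insert 0 (Suc ` {..<length Us})"
    by (auto simp: lessThan_Suc_eq_insert_0)
  then have "(\<Oplus>i\<in>{..<length (u # Us)}. ?f i) = ?f 0 \<oplus> (\<Oplus>i\<in>Suc ` {..<length Us}. ?f i)"
    using Cons.prems car by (simp, subst finsum_insert) auto
  also have "(\<Oplus>i\<in>Suc ` {..<length Us}. ?f i) = (\<Oplus>i\<in>{..<length Us}. Ks ! i \<otimes> Us ! i)"
    using car finsum_reindex[of ?f Suc "{..<length Us}"] by (simp add: Pi_iff)
  finally show ?case using Cons by simp
qed

lemma (in ring) basis_coordinates:
  assumes K: "subfield K R" and "dimension n K V"
  obtains b l where "\<And>j. j < n \<Longrightarrow> b j \<in> V"
    and "\<And>x j. x \<in> V \<Longrightarrow> j < n \<Longrightarrow> l j x \<in> K"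
    and "\<And>x. x \<in> V \<Longrightarrow> (\<Oplus>j\<in>{..<n}. l j x \<otimes> b j) = x"
    and "\<And>x y j. x \<in> V \<Longrightarrow> y \<in> V \<Longrightarrow> j < n \<Longrightarrow> l j (x \<oplus> y) = l j x \<oplus> l j y"
    and "\<And>q x j. q \<in> K \<Longrightarrow> x \<in> V \<Longrightarrow> j < n \<Longrightarrow> l j (q \<otimes> x) = q \<otimes> l j x"
    and "\<And>j. j < n \<Longrightarrow> l j (b j) = \<one>"
proof -
  obtain Vs where Vs: "set Vs \<subseteq> carrier R" "independent K Vs" "length Vs = n" "Span K Vs = V"
    using exists_base[OF K assms(2)] by blast
  note Kc = subfieldE(3)[OF K] and Ks = subringE[OF subfieldE(1)[OF K]]
  have ex: "\<exists>!cs. set cs \<subseteq> K \<and> length cs = n \<and> x = combine cs Vs" if "x \<in> V" for x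
    using unique_decomposition[OF K Vs(2), of x] that Vs by simp
  define \<kappa> where "\<kappa> x = (THE cs. set cs \<subseteq> K \<and> length cs = n \<and> x = combine cs Vs)" for x
  have \<kappa>: "set (\<kappa> x) \<subseteq> K" "length (\<kappa> x) = n" "combine (\<kappa> x) Vs = x" if "x \<in> V" for x
    using theI'[OF ex[OF that]] unfolding \<kappa>_def by auto
  have \<kappa>_eq: "\<kappa> x = cs" if "set cs \<subseteq> K" "length cs = n" "x = combine cs Vs" "x \<in> V" for x cs
    using ex[OF that(4)] \<kappa>[OF that(4)] that by metis
  have \<kappa>c: "set (\<kappa> x) \<subseteq> carrier R" if "x \<in> V" for x using \<kappa>(1)[OF that] Kc by blast
  note V = space_subgroup_props[OF K assms(2)]
  show thesis
  proof (rule that[of "\<lambda>j. Vs ! j" "\<lambda>j x. \<kappa> x ! j"])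
    show bV: "Vs ! j \<in> V" if "j < n" for j
      using Span_base_incl[OF K Vs(1)] Vs that nth_mem[of j Vs] by blast
    show "\<kappa> x ! j \<in> K" if "x \<in> V" "j < n" for x j
      using \<kappa>[OF that(1)] that nth_mem[of j "\<kappa> x"] by blast
    show "(\<Oplus>j\<in>{..<n}. \<kappa> x ! j \<otimes> Vs ! j) = x" if "x \<in> V" for x
      using combine_eq_finsum[of "\<kappa> x" Vs] \<kappa>[OF that] \<kappa>c[OF that] Vs by simp
    show "\<kappa> (x \<oplus> y) ! j = \<kappa> x ! j \<oplus> \<kappa> y ! j" if "x \<in> V" "y \<in> V" "j < n" for x y j
    proof -
      have "\<kappa> (x \<oplus> y) = map2 (\<oplus>) (\<kappa> x) (\<kappa> y)"
      proof (rule \<kappa>_eq)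
        show "set (map2 (\<oplus>) (\<kappa> x) (\<kappa> y)) \<subseteq> K"
        proof -
          have "u \<oplus> v \<in> K" if "(u, v) \<in> set (zip (\<kappa> x) (\<kappa> y))" for u v
            using set_zip_leftD[OF that] set_zip_rightD[OF that] Ks(7)
              \<kappa>(1)[OF \<open>x \<in> V\<close>] \<kappa>(1)[OF \<open>y \<in> V\<close>] by blast
          then show ?thesis by auto
        qed
        show "x \<oplus> y = combine (map2 (\<oplus>) (\<kappa> x) (\<kappa> y)) Vs"
          using combine_add[of "\<kappa> x" Vs "\<kappa> y"] \<kappa>[OF that(1)] \<kappa>[OF that(2)]
            \<kappa>c[OF that(1)] \<kappa>c[OF that(2)] Vs by simp
      qed (use \<kappa> that V(3) in auto)
      then show ?thesis using \<kappa> that by simp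
    qed
    show "\<kappa> (q \<otimes> x) ! j = q \<otimes> \<kappa> x ! j" if "q \<in> K" "x \<in> V" "j < n" for q x j
    proof -
      have "\<kappa> (q \<otimes> x) = map ((\<otimes>) q) (\<kappa> x)"
      proof (rule \<kappa>_eq)
        show "set (map ((\<otimes>) q) (\<kappa> x)) \<subseteq> K"
          using \<kappa>(1)[OF that(2)] Ks(6) that(1) by auto
        show "q \<otimes> x = combine (map ((\<otimes>) q) (\<kappa> x)) Vs"
          using combine_r_distr[OF \<kappa>c[OF that(2)] Vs(1), of q] \<kappa>(3)[OF that(2)] that(1) Kc by auto
      qed (use \<kappa> that V(5) in auto)
      then show ?thesis using \<kappa> that by simp
    qed
    show "\<kappa> (Vs ! j) ! j = \<one>" if j: "j < n" for j
    proof -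
      let ?e = "map (\<lambda>i. if i = j then \<one> else \<zero>) [0..<n]"
      have e: "set ?e \<subseteq> K" using Ks(2,3) by auto
      have "combine ?e Vs = (\<Oplus>i\<in>{..<n}. ?e ! i \<otimes> Vs ! i)"
        using combine_eq_finsum[OF _ subset_trans[OF e Kc] Vs(1)] Vs(3) by simp
      also have "\<dots> = (\<Oplus>i\<in>{..<n}. if i = j then Vs ! i else \<zero>)"
        using bV V(1) by (intro finsum_cong') (auto simp: subset_iff)
      also have "\<dots> = Vs ! j"
        using add.finprod_singleton_swap[of j "{..<n}" "\<lambda>i. Vs ! i"] j bV V(1) by auto
      finally have "\<kappa> (Vs ! j) = ?e"
        using e bV[OF j] by (intro \<kappa>_eq) auto
      then show ?thesis using j by simp
    qed
  qed
qed

context galois_char_zero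
begin

lemma finite_dimension_intermediate:
  assumes K: "subfield K R" and QK: "Q \<subseteq> K"
  shows "finite_dimension Q K"
proof (rule subalbegra_incl_imp_finite_dimension[OF Q_subfield])
  show "finite_dimension Q (carrier R)" using galois by (simp add: galois_extension_def)
  show "K \<subseteq> carrier R" using subfieldE(3)[OF K] .
  show "subalgebra Q K R"
    using subring.axioms(1)[OF subfieldE(1)[OF K]] subringE(6)[OF subfieldE(1)[OF K]] QK
    by (auto simp: subalgebra_def subalgebra_axioms_def)
qed

text \<open>
  The left-hand side is the trace, in coordinates, of the \<open>Q\<close>-linear map that sends \<open>x\<close> to the average
  of \<open>zx\<close> times \<open>y\<close>. For \<open>f s = \<Sum> x\<^sub>i s(y\<^sub>i)\<close> it is the sum of the rank-one maps
  \<open>x \<mapsto> tr(x\<^sub>i z x) y y\<^sub>i\<close>, whose traces are \<open>tr(x\<^sub>i y\<^sub>i y z)\<close>; and \<open>\<Sum> x\<^sub>i y\<^sub>i\<close> is the value of \<open>f\<close> at the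
  identity.
\<close>

lemma separating_trace:
  assumes K: "subfield K R" and QK: "Q \<subseteq> K"
    and b: "\<And>j. j < n \<Longrightarrow> b j \<in> K"
    and l: "\<And>x j. x \<in> K \<Longrightarrow> j < n \<Longrightarrow> l j x \<in> Q"
    and coord: "\<And>x. x \<in> K \<Longrightarrow> (\<Oplus>j\<in>{..<n::nat}. l j x \<otimes> b j) = x"
    and l_add: "\<And>x y j. x \<in> K \<Longrightarrow> y \<in> K \<Longrightarrow> j < n \<Longrightarrow> l j (x \<oplus> y) = l j x \<oplus> l j y"
    and l_scale: "\<And>q x j. q \<in> Q \<Longrightarrow> x \<in> K \<Longrightarrow> j < n \<Longrightarrow> l j (q \<otimes> x) = q \<otimes> l j x"
    and "separating K f" "y \<in> K" "z \<in> carrier R"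
  shows "(\<Oplus>j\<in>{..<n}. l j (y \<otimes> averaging (carrier G) f (z \<otimes> b j)))
    = trace (carrier G) (f \<one>\<^bsub>G\<^esub> \<otimes> (y \<otimes> z))"
  using assms(8-)
proof (induction arbitrary: y z)
  case one
  note Kc = subfieldE(3)[OF K]
  have yc: "y \<in> carrier R" using one Kc by auto
  have lc: "l j y \<in> carrier R" "l j y \<in> Q" if "j < n" for j using l[OF one(1) that] Q_carrier by auto
  have bc: "b j \<in> carrier R" if "j < n" for j using b[OF that] Kc by auto
  have Q_fix: "q \<in> fixed_field (carrier G)" if "q \<in> Q" for q
    using that fixed_field_carrier by simp
  have "(\<Oplus>j\<in>{..<n}. l j (y \<otimes> averaging (carrier G) (\<lambda>s. \<one>) (z \<otimes> b j)))
      = (\<Oplus>j\<in>{..<n}. trace (carrier G) (l j y \<otimes> (z \<otimes> b j)))"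
  proof (rule finsum_cong')
    fix j assume "j \<in> {..<n}"
    then have j: "j < n" by simp
    have tQ: "trace (carrier G) (z \<otimes> b j) \<in> Q"
      using trace_fixed[OF grp.subgroup_self] fixed_field_carrier one bc[OF j] by auto
    have "l j (y \<otimes> trace (carrier G) (z \<otimes> b j)) = l j (trace (carrier G) (z \<otimes> b j) \<otimes> y)"
      using tQ yc Q_carrier by (auto simp: m_comm)
    also have "\<dots> = trace (carrier G) (z \<otimes> b j) \<otimes> l j y"
      using l_scale[OF tQ one(1) j] .
    also have "\<dots> = trace (carrier G) (l j y \<otimes> (z \<otimes> b j))"
      using trace_scale[OF grp.subgroup_self _ Q_fix[OF lc(2)[OF j]], of "z \<otimes> b j"] lc[OF j] bc[OF j] one
        tQ Q_carrier by (auto simp: m_comm)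
    finally show "l j (y \<otimes> averaging (carrier G) (\<lambda>s. \<one>) (z \<otimes> b j))
        = trace (carrier G) (l j y \<otimes> (z \<otimes> b j))"
      using averaging_one[OF grp.subgroup_self, of "z \<otimes> b j"] bc[OF j] one by simp
  qed (use lc bc one trace_closed[OF grp.subgroup_self] in auto)
  also have "\<dots> = trace (carrier G) (\<Oplus>j\<in>{..<n}. l j y \<otimes> (z \<otimes> b j))"
    using lc bc one trace_closed[OF grp.subgroup_self] trace_add[OF grp.subgroup_self] trace_zero[OF grp.subgroup_self]
    by (intro finsum_additive_map[symmetric]) auto
  also have "(\<Oplus>j\<in>{..<n}. l j y \<otimes> (z \<otimes> b j)) = (\<Oplus>j\<in>{..<n}. z \<otimes> (l j y \<otimes> b j))"
    using lc bc one by (intro finsum_cong') (auto simp: m_lcomm)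
  also have "\<dots> = z \<otimes> y"
    using finsum_rdistr[of "{..<n}" z "\<lambda>j. l j y \<otimes> b j"] coord[OF one(1)] lc bc one by (auto simp: Pi_iff)
  finally show ?case using yc one by (simp add: m_comm)
next
  case (step f y' c d)
  note Kc = subfieldE(3)[OF K] and Ks = subringE[OF subfieldE(1)[OF K]]
  have car: "y \<in> carrier R" "y' \<in> carrier R" "y \<otimes> y' \<in> K" "\<ominus> y \<in> K"
    using step Kc Ks by auto
  have fc: "f s \<in> carrier R" if "s \<in> carrier G" for s using separating_closed[OF step.hyps(1) Kc that] .
  have bc: "b j \<in> carrier R" if "j < n" for j using b[OF that] Kc by auto
  let ?A = "\<lambda>j. averaging (carrier G) f ((d \<otimes> z) \<otimes> b j)"
  let ?B = "\<lambda>j. averaging (carrier G) f ((c \<otimes> (d \<otimes> z)) \<otimes> b j)"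
  have avK: "averaging (carrier G) f w \<in> K" if "w \<in> carrier R" for w
    using separating_averaging[OF step.hyps(1) grp.subgroup_self K _ that] QK fixed_field_carrier by simp
  have AK: "?A j \<in> K" "?B j \<in> K" if "j < n" for j
    using avK bc[OF that] step by auto
  have lR: "l j x \<in> carrier R" if "x \<in> K" "j < n" for x j using l[OF that] Q_carrier by auto
  have "(\<Oplus>j\<in>{..<n}. l j (y \<otimes> averaging (carrier G) (\<lambda>s. f s \<otimes> (s y' \<ominus> c) \<otimes> d) (z \<otimes> b j)))
      = (\<Oplus>j\<in>{..<n}. l j ((y \<otimes> y') \<otimes> ?A j) \<oplus> l j ((\<ominus> y) \<otimes> ?B j))"
  proof (rule finsum_cong')
    fix j assume "j \<in> {..<n}"
    then have j: "j < n" by simp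
    have AR: "?A j \<in> carrier R" "?B j \<in> carrier R" using AK[OF j] Kc by auto
    have "averaging (carrier G) (\<lambda>s. f s \<otimes> (s y' \<ominus> c) \<otimes> d) (z \<otimes> b j) = y' \<otimes> ?A j \<ominus> ?B j"
      using averaging_step[OF grp.subgroup_self, of f "z \<otimes> b j" y' c d] fc car bc[OF j] step
      by (auto simp: m_assoc)
    then have "y \<otimes> averaging (carrier G) (\<lambda>s. f s \<otimes> (s y' \<ominus> c) \<otimes> d) (z \<otimes> b j)
        = (y \<otimes> y') \<otimes> ?A j \<oplus> (\<ominus> y) \<otimes> ?B j"
      using AR car by (simp add: minus_eq r_distr l_minus r_minus m_assoc)
    then show "l j (y \<otimes> averaging (carrier G) (\<lambda>s. f s \<otimes> (s y' \<ominus> c) \<otimes> d) (z \<otimes> b j))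
        = l j ((y \<otimes> y') \<otimes> ?A j) \<oplus> l j ((\<ominus> y) \<otimes> ?B j)"
      using l_add[OF _ _ j] Ks(6) AK[OF j] car by simp
  qed (use lR Ks(6) AK car in auto)
  also have "\<dots> = (\<Oplus>j\<in>{..<n}. l j ((y \<otimes> y') \<otimes> ?A j)) \<oplus> (\<Oplus>j\<in>{..<n}. l j ((\<ominus> y) \<otimes> ?B j))"
    using lR Ks(6) AK car by (intro finsum_addf) auto
  also have "\<dots> = trace (carrier G) (f \<one>\<^bsub>G\<^esub> \<otimes> ((y \<otimes> y') \<otimes> (d \<otimes> z)))
      \<oplus> trace (carrier G) (f \<one>\<^bsub>G\<^esub> \<otimes> ((\<ominus> y) \<otimes> (c \<otimes> (d \<otimes> z))))"
    using step.IH car step.hyps step.prems by simp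
  also have "\<dots> = trace (carrier G) (f \<one>\<^bsub>G\<^esub> \<otimes> ((y \<otimes> y') \<otimes> (d \<otimes> z))
      \<oplus> f \<one>\<^bsub>G\<^esub> \<otimes> ((\<ominus> y) \<otimes> (c \<otimes> (d \<otimes> z))))"
    using trace_add[OF grp.subgroup_self] fc[OF grp.one_closed] car(1,2) step.hyps step.prems by simp
  also have "f \<one>\<^bsub>G\<^esub> \<otimes> ((y \<otimes> y') \<otimes> (d \<otimes> z)) \<oplus> f \<one>\<^bsub>G\<^esub> \<otimes> ((\<ominus> y) \<otimes> (c \<otimes> (d \<otimes> z)))
      = f \<one>\<^bsub>G\<^esub> \<otimes> (\<one>\<^bsub>G\<^esub> y' \<ominus> c) \<otimes> d \<otimes> (y \<otimes> z)"
    using fc[OF grp.one_closed] car(1,2) step.hyps step.prems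
    by (simp add: one_apply minus_eq r_distr l_distr l_minus r_minus m_ac)
  finally show ?case .
qed

text \<open>
  If \<open>f\<close> is the indicator of \<open>fixer K\<close>, averaging is multiplication by \<open>|fixer K|\<close> on \<open>K\<close>. Its trace is
  \<open>dim Q K\<close> times \<open>|fixer K|\<close>, and by \<open>separating_trace\<close> it is also the trace of \<open>1\<close>, which is \<open>|G|\<close>.
\<close>

lemma degree_times_fixer:
  assumes K: "subfield K R" and QK: "Q \<subseteq> K"
  shows "dim Q K * card (fixer K) = card (carrier G)"
proof -
  note Kc = subfieldE(3)[OF K] and Ks = subringE[OF subfieldE(1)[OF K]]
  let ?n = "dim Q K"
  have "dimension ?n Q K"
    using finite_dimensionE[OF Q_subfield finite_dimension_intermediate[OF K QK]] by (simp add: over_def)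
  then obtain b l where b: "\<And>j. j < ?n \<Longrightarrow> b j \<in> K"
    and l: "\<And>x j. x \<in> K \<Longrightarrow> j < ?n \<Longrightarrow> l j x \<in> Q"
    and coord: "\<And>x. x \<in> K \<Longrightarrow> (\<Oplus>j\<in>{..<?n}. l j x \<otimes> b j) = x"
    and l_add: "\<And>x y j. x \<in> K \<Longrightarrow> y \<in> K \<Longrightarrow> j < ?n \<Longrightarrow> l j (x \<oplus> y) = l j x \<oplus> l j y"
    and l_scale: "\<And>q x j. q \<in> Q \<Longrightarrow> x \<in> K \<Longrightarrow> j < ?n \<Longrightarrow> l j (q \<otimes> x) = q \<otimes> l j x"
    and l_b: "\<And>j. j < ?n \<Longrightarrow> l j (b j) = \<one>"
    by (rule basis_coordinates[OF Q_subfield]) blast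
  have W: "subgroup (fixer K) G" using fixer_subgroup[OF Kc] .
  obtain f where f: "separating K f" "\<And>s. s \<in> fixer K \<Longrightarrow> f s = \<one>"
      "\<And>s. s \<in> carrier G - fixer K \<Longrightarrow> f s = \<zero>"
    using separating_exists[of "carrier G - fixer K" K] finite_G Kc by blast
  have eq: "l j (\<one> \<otimes> averaging (carrier G) f (\<one> \<otimes> b j)) = [(card (fixer K))] \<cdot>\<^bsub>R\<^esub> \<one>" if j: "j < ?n" for j
  proof -
    let ?w = "[(card (fixer K))] \<cdot>\<^bsub>R\<^esub> \<one>"
    have w: "?w \<in> Q" using nat_mult_closed_subfield[OF Q_subfield] subringE(3)[OF subfieldE(1)[OF Q_subfield]] .
    have bj: "b j \<in> carrier R" "b j \<in> fixed_field (fixer K)"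
      using b[OF j] Kc by (auto simp: fixed_field_def fixer_def)
    have "averaging (carrier G) f (b j) = ?w \<otimes> b j"
      using averaging_indicator[OF grp.subgroup_self W _ f(2,3) bj(2)] subgroup.subset[OF W]
        nat_mult_eq[OF bj(1)] by simp
    then have "l j (\<one> \<otimes> averaging (carrier G) f (\<one> \<otimes> b j)) = l j (?w \<otimes> b j)"
      using bj w Q_carrier by auto
    also have "\<dots> = ?w" using l_scale[OF w b[OF j] j] l_b[OF j] w Q_carrier by auto
    finally show ?thesis .
  qed
  have "(\<Oplus>j\<in>{..<?n}. l j (\<one> \<otimes> averaging (carrier G) f (\<one> \<otimes> b j)))
      = (\<Oplus>j\<in>{..<?n}. [(card (fixer K))] \<cdot>\<^bsub>R\<^esub> \<one>)"
    using eq by (intro finsum_cong') auto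
  also have "\<dots> = [(card (fixer K) * ?n)] \<cdot>\<^bsub>R\<^esub> \<one>"
    by (simp add: add.finprod_const add.nat_pow_pow)
  finally have "[(card (fixer K) * ?n)] \<cdot>\<^bsub>R\<^esub> \<one> = trace (carrier G) (f \<one>\<^bsub>G\<^esub> \<otimes> (\<one> \<otimes> \<one>))"
    using separating_trace[OF K QK b l coord l_add l_scale f(1) Ks(3) one_closed] by simp
  also have "f \<one>\<^bsub>G\<^esub> = \<one>" using f(2) subgroup.one_closed[OF W] by blast
  also have "trace (carrier G) (\<one> \<otimes> (\<one> \<otimes> \<one>)) = (\<Oplus>s\<in>carrier G. \<one>)"
    unfolding trace_def by (intro finsum_cong') auto
  also have "\<dots> = [(card (carrier G))] \<cdot>\<^bsub>R\<^esub> \<one>"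
    by (simp add: add.finprod_const)
  finally show ?thesis using nat_mult_one_inj by (metis mult.commute)
qed

lemma characters_independent_G:
  assumes "S \<subseteq> carrier G" "c \<in> S \<rightarrow> carrier R" "\<And>z. z \<in> carrier R \<Longrightarrow> (\<Oplus>s\<in>S. c s \<otimes> s z) = \<zero>"
  shows "\<forall>s \<in> S. c s = \<zero>"
proof (rule characters_independent[where K = "carrier R"])
  show "finite S" using finite_G assms(1) finite_subset by blast
  show "\<exists>x\<in>carrier R. s x \<noteq> t x" if "s \<in> S" "t \<in> S" "s \<noteq> t" for s t
    using G_eqI[of s t] that assms(1) by blast
  show "s (x \<otimes> y) = s x \<otimes> s y" if "s \<in> S" "x \<in> carrier R" "y \<in> carrier R" for s x y
    using that assms(1) G_mult[of s x y] by blast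
  show "s x \<in> carrier R" if "s \<in> S" "x \<in> carrier R" for s x
    using that assms(1) G_closed by blast
  show "s \<one> = \<one>" if "s \<in> S" for s using that assms(1) G_one by blast
qed (use assms in auto)

text \<open>
  An automorphism \<open>g\<close> that fixes all traces from \<open>W\<close> gives a relation between the sum of the
  characters in \<open>W\<close> and the sum of those in \<open>gW\<close>; by independence the two cosets cannot be disjoint.
\<close>

lemma fixer_fixed_field:
  assumes W: "subgroup W G"
  shows "fixer (fixed_field W) = W"
proof
  note WG = subgroup.subset[OF W]
  show "W \<subseteq> fixer (fixed_field W)"
    using WG by (auto simp: fixer_def fixed_field_def)
  show "fixer (fixed_field W) \<subseteq> W"
  proof
    fix g assume "g \<in> fixer (fixed_field W)"
    then have g: "g \<in> carrier G" "\<And>x. x \<in> fixed_field W \<Longrightarrow> g x = x" by (auto simp: fixer_def)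
    show "g \<in> W"
    proof (rule ccontr)
      assume gW: "g \<notin> W"
      let ?gW = "(\<lambda>w. g \<otimes>\<^bsub>G\<^esub> w) ` W"
      have disj: "W \<inter> ?gW = {}"
      proof -
        have False if w: "w \<in> W" "g \<otimes>\<^bsub>G\<^esub> w \<in> W" for w
        proof -
          have "g = (g \<otimes>\<^bsub>G\<^esub> w) \<otimes>\<^bsub>G\<^esub> inv\<^bsub>G\<^esub> w"
            using w g(1) WG by (auto simp: grp.m_assoc subset_iff)
          then show False
            using gW subgroup.m_closed[OF W w(2) subgroup.m_inv_closed[OF W w(1)]] by simp
        qed
        then show ?thesis by blast
      qed
      have gWG: "?gW \<subseteq> carrier G" using g(1) WG by auto
      define c where "c s = (if s \<in> W then \<one> else \<ominus> \<one>)" for s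
      have "\<forall>s \<in> W \<union> ?gW. c s = \<zero>"
      proof (rule characters_independent_G)
        fix z assume z: "z \<in> carrier R"
        have car: "s z \<in> carrier R" if "s \<in> W \<union> ?gW" for s using that WG gWG z by auto
        have "(\<Oplus>s\<in>W. c s \<otimes> s z) = trace W z"
          unfolding trace_def c_def using car by (intro finsum_cong') auto
        moreover have "(\<Oplus>s\<in>?gW. c s \<otimes> s z) = (\<Oplus>w\<in>W. \<ominus> \<one> \<otimes> g (w z))"
        proof -
          have inj: "inj_on (\<lambda>w. g \<otimes>\<^bsub>G\<^esub> w) W" using g(1) WG by (auto simp: inj_on_def subset_iff)
          have "(\<Oplus>s\<in>?gW. c s \<otimes> s z) = (\<Oplus>w\<in>W. c (g \<otimes>\<^bsub>G\<^esub> w) \<otimes> (g \<otimes>\<^bsub>G\<^esub> w) z)"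
            using car by (intro finsum_reindex[OF _ inj]) (auto simp: c_def)
          also have "\<dots> = (\<Oplus>w\<in>W. \<ominus> \<one> \<otimes> g (w z))"
          proof (rule finsum_cong')
            fix w assume w: "w \<in> W"
            have "g \<otimes>\<^bsub>G\<^esub> w \<notin> W" using disj w by blast
            then show "c (g \<otimes>\<^bsub>G\<^esub> w) \<otimes> (g \<otimes>\<^bsub>G\<^esub> w) z = \<ominus> \<one> \<otimes> g (w z)"
              using mult_apply[of g w z] g(1) w WG z by (auto simp: c_def)
          qed (use car g(1) in auto)
          finally show ?thesis .
        qed
        moreover have "(\<Oplus>w\<in>W. \<ominus> \<one> \<otimes> g (w z)) = \<ominus> \<one> \<otimes> g (trace W z)"
          unfolding trace_def
          using finsum_rdistr[of W "\<ominus> \<one>" "\<lambda>w. g (w z)"] G_finsum[of W "\<lambda>w. w z" g]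
            finite_subgroup[OF W] car g(1) by (auto simp: Pi_iff)
        moreover have "g (trace W z) = trace W z" using g(2) trace_fixed[OF W z] .
        moreover have "(\<Oplus>s\<in>W \<union> ?gW. c s \<otimes> s z) = (\<Oplus>s\<in>W. c s \<otimes> s z) \<oplus> (\<Oplus>s\<in>?gW. c s \<otimes> s z)"
          using disj finite_subgroup[OF W] car by (intro finsum_Un_disjoint) (auto simp: c_def)
        ultimately show "(\<Oplus>s\<in>W \<union> ?gW. c s \<otimes> s z) = \<zero>"
          using trace_closed[OF W z] by (simp add: l_minus r_neg)
      qed (use WG gWG in \<open>auto simp: c_def\<close>)
      then have "c \<one>\<^bsub>G\<^esub> = \<zero>" using subgroup.one_closed[OF W] by blast
      then show False using subgroup.one_closed[OF W] by (simp add: c_def)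
    qed
  qed
qed

end

context galois_char_zero
begin

section \<open>Radical extensions and Kummer cocycles\<close>

lemma simple_extension_subfield:
  assumes K: "subfield K R" and "Q \<subseteq> K" and x: "x \<in> carrier R"
  shows "subfield (simple_extension K x) R"
proof -
  have "(algebraic over Q) x"
    using finite_dimension_imp_algebraic[OF Q_subfield carrier_is_subring _ x] galois
    by (simp add: galois_extension_def)
  then have "(algebraic over K) x"
    using algebraic_mono[OF assms(2)] by blast
  then show ?thesis
    using finite_extension_is_subfield[OF K, of "[x]"] x by simp
qed

lemma fixer_simple_extension:
  assumes K: "subfield K R" and x: "x \<in> carrier R"
  shows "fixer (simple_extension K x) = {s \<in> fixer K. s x = x}"
proof
  note Kc = subfieldE(3)[OF K]
  show "fixer (simple_extension K x) \<subseteq> {s \<in> fixer K. s x = x}"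
    using simple_extension_mem[OF subfieldE(1)[OF K] x] simple_extension_incl[OF Kc x]
    by (auto simp: fixer_def)
  show "{s \<in> fixer K. s x = x} \<subseteq> fixer (simple_extension K x)"
  proof
    fix s assume "s \<in> {s \<in> fixer K. s x = x}"
    then have s: "s \<in> carrier G" "\<And>y. y \<in> K \<Longrightarrow> s y = y" "s x = x" by (auto simp: fixer_def)
    have "subring (fixed_field {s}) R" using fixed_field_subfield[of "{s}"] s(1) subfieldE(1) by blast
    then have "simple_extension K x \<subseteq> fixed_field {s}"
      using s x Kc by (intro simple_extension_subring_incl) (auto simp: fixed_field_def)
    then show "s \<in> fixer (simple_extension K x)" using s(1) by (auto simp: fixer_def fixed_field_def)
  qed
qed

text \<open>
  Hilbert's Theorem 90 for the cocycle \<open>c\<close>: some \<open>\<alpha>\<close> satisfies \<open>s(\<alpha>) = c(s) \<alpha>\<close> for all \<open>s\<close> in \<open>V\<close>. Then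
  \<open>\<alpha>\<^sup>n\<close> is fixed by \<open>V\<close>, and the stabilizer of \<open>\<alpha>\<close> in \<open>V\<close> is the set where \<open>c\<close> is \<open>1\<close>.
\<close>

lemma kummer_radical:
  assumes V: "subgroup V G" and c: "\<And>s. s \<in> V \<Longrightarrow> c s \<in> carrier R"
    and cocycle: "\<And>s t. s \<in> V \<Longrightarrow> t \<in> V \<Longrightarrow> c (s \<otimes>\<^bsub>G\<^esub> t) = c s \<otimes> s (c t)"
    and n: "n > 0" and root: "\<And>s. s \<in> V \<Longrightarrow> c s [^] (n::nat) = \<one>"
  shows "radical_extension R (fixed_field V) (fixed_field {s \<in> V. c s = \<one>})"
proof -
  have car: "s \<in> carrier G" if "s \<in> V" for s using that subgroup.subset[OF V] by blast
  have c_nz: "c s \<noteq> \<zero>" if "s \<in> V" for s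
    using root[OF that] n by (metis nat_pow_zero neq0_conv zero_not_one)
  obtain z where z: "z \<in> carrier R" "(\<Oplus>t\<in>V. c t \<otimes> t z) \<noteq> \<zero>"
    using characters_independent_G[OF subgroup.subset[OF V], of c] c c_nz subgroup.one_closed[OF V] by blast
  \<comment> \<open>a Lagrange resolvent of \<open>c\<close>; its inverse is the required radical\<close>
  define \<beta> where "\<beta> = (\<Oplus>t\<in>V. c t \<otimes> t z)"
  have tz: "t z \<in> carrier R" if "t \<in> V" for t using car[OF that] z(1) by simp
  have \<beta>: "\<beta> \<in> carrier R" "\<beta> \<noteq> \<zero>" using z(2) c tz unfolding \<beta>_def by (auto intro!: finsum_closed)
  have c_\<beta>: "c s \<otimes> s \<beta> = \<beta>" if s: "s \<in> V" for s
  proof -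
    have "s \<beta> = (\<Oplus>t\<in>V. s (c t \<otimes> t z))"
      unfolding \<beta>_def using finite_subgroup[OF V] car[OF s] c tz by (intro G_finsum) auto
    then have "c s \<otimes> s \<beta> = (\<Oplus>t\<in>V. c s \<otimes> s (c t \<otimes> t z))"
      using finsum_rdistr[OF finite_subgroup[OF V] c[OF s], of "\<lambda>t. s (c t \<otimes> t z)"] c tz car[OF s]
      by (auto simp: Pi_iff)
    also have "\<dots> = (\<Oplus>t\<in>V. c (s \<otimes>\<^bsub>G\<^esub> t) \<otimes> (s \<otimes>\<^bsub>G\<^esub> t) z)"
    proof (rule finsum_cong')
      fix t assume t: "t \<in> V"
      show "c s \<otimes> s (c t \<otimes> t z) = c (s \<otimes>\<^bsub>G\<^esub> t) \<otimes> (s \<otimes>\<^bsub>G\<^esub> t) z"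
        using cocycle[OF s t] mult_apply[OF car[OF s] car[OF t] z(1)] G_mult[OF car[OF s] c[OF t] tz[OF t]]
          c[OF s] c[OF t] tz[OF t] car[OF s] by (simp add: m_assoc)
    qed (use c tz subgroup.m_closed[OF V s] in auto)
    also have "\<dots> = \<beta>"
      unfolding \<beta>_def using subgroup_sum_shift[OF V s, of "\<lambda>t. c t \<otimes> t z"] c tz by auto
    finally show ?thesis .
  qed
  define \<alpha> where "\<alpha> = inv \<beta>"
  have \<alpha>: "\<alpha> \<in> carrier R" "\<beta> \<otimes> \<alpha> = \<one>"
    using \<beta> unfolding \<alpha>_def by (auto simp: field_Units)
  then have \<alpha>_nz: "\<alpha> \<noteq> \<zero>" using \<beta>(1) by auto
  have s_\<alpha>: "s \<alpha> = c s \<otimes> \<alpha>" if s: "s \<in> V" for s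
  proof -
    have closed: "s \<alpha> \<in> carrier R" "s \<beta> \<in> carrier R" using car[OF s] \<alpha> \<beta> by auto
    have 1: "s \<beta> \<otimes> s \<alpha> = \<one>"
      using G_mult[OF car[OF s] \<beta>(1) \<alpha>(1)] \<alpha>(2) car[OF s] by simp
    have "c s \<otimes> \<alpha> = c s \<otimes> (s \<beta> \<otimes> s \<alpha>) \<otimes> \<alpha>" using 1 c[OF s] by simp
    also have "\<dots> = (c s \<otimes> s \<beta>) \<otimes> \<alpha> \<otimes> s \<alpha>" using c[OF s] closed \<alpha>(1) by (simp add: m_ac)
    also have "\<dots> = s \<alpha>" using c_\<beta>[OF s] \<alpha>(2) closed by simp
    finally show ?thesis by simp
  qed
  have fixes_iff: "s \<alpha> = \<alpha> \<longleftrightarrow> c s = \<one>" if s: "s \<in> V" for s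
    using s_\<alpha>[OF s] \<alpha> \<alpha>_nz c[OF s] m_rcancel[of \<alpha> "c s" \<one>] by auto
  have pow: "\<alpha> [^] n \<in> fixed_field V"
  proof -
    have "s (\<alpha> [^] n) = \<alpha> [^] n" if s: "s \<in> V" for s
      using G_pow[OF car[OF s] \<alpha>(1)] s_\<alpha>[OF s] root[OF s] c[OF s] \<alpha>(1) by (simp add: nat_pow_distrib)
    then show ?thesis using \<alpha>(1) by (simp add: fixed_field_def)
  qed
  have K: "subfield (fixed_field V) R" using fixed_field_subfield subgroup.subset[OF V] by blast
  have QK: "Q \<subseteq> fixed_field V" using Q_fixed_field subgroup.subset[OF V] by blast
  let ?S = "simple_extension (fixed_field V) \<alpha>"
  have S: "subfield ?S R" using simple_extension_subfield[OF K QK \<alpha>(1)] .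
  have incl: "fixed_field V \<subseteq> ?S" using simple_extension_incl[OF subfieldE(3)[OF K] \<alpha>(1)] .
  have "V \<inter> fixer ?S = {s \<in> V. c s = \<one>}"
    using fixer_simple_extension[OF K \<alpha>(1)] fixer_fixed_field[OF V] fixes_iff by auto
  then have "fixed_field {s \<in> V. c s = \<one>} = ?S"
    using fixed_field_intermediate[OF V S incl] by simp
  then show ?thesis
    unfolding radical_extension_def
    using K S incl pow n simple_extension_mem[OF subfieldE(1)[OF K] \<alpha>(1)] by auto
qed

section \<open>Abelian subextensions\<close>

lemma finsum_subfield:
  assumes F: "subfield F R" and "finite A" and "f \<in> A \<rightarrow> F"
  shows "finsum (R\<lparr>carrier := F\<rparr>) f A = finsum R f A"
proof -
  interpret F: field "R\<lparr>carrier := F\<rparr>" using subfield_iff(2)[OF F] .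
  show ?thesis using assms(2,3)
  proof (induction A)
    case (insert a A)
    then have "finsum (R\<lparr>carrier := F\<rparr>) f (insert a A) = f a \<oplus> finsum (R\<lparr>carrier := F\<rparr>) f A"
      by (subst F.finsum_insert) auto
    moreover have "finsum R f (insert a A) = f a \<oplus> finsum R f A"
      using insert subfieldE(3)[OF F] by (subst finsum_insert) auto
    ultimately show ?case using insert by auto
  qed simp
qed

text \<open>
  Let \<open>\<Gamma>\<close> be the Galois group of \<open>F\<close>. Since \<open>s\<close> fixes the traces from \<open>\<Gamma>\<close>, the characters in \<open>s\<Gamma>\<close> and
  those in \<open>\<Gamma>\<close> have the same sum on \<open>F\<close>. The identity occurs in \<open>\<Gamma>\<close>, so by independence it occurs in
  \<open>s\<Gamma>\<close>, which makes \<open>s\<close> the inverse of some \<open>\<gamma>\<close> on \<open>F\<close>.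
\<close>

lemma restricts_to_subextension:
  assumes F: "subfield F R" and gal_F: "galois_extension (R\<lparr>carrier := F\<rparr>) Q" and s: "s \<in> carrier G"
  shows "\<exists>\<gamma> \<in> carrier (Gal (R\<lparr>carrier := F\<rparr>) Q). \<forall>x \<in> F. s x = \<gamma> x"
proof -
  interpret F: galois_char_zero "R\<lparr>carrier := F\<rparr>" Q
  proof (intro galois_char_zero.intro galois_char_zero_axioms.intro)
    show "field (R\<lparr>carrier := F\<rparr>)" using subfield_iff(2)[OF F] .
    show "[n] \<cdot>\<^bsub>R\<lparr>carrier := F\<rparr>\<^esub> \<one>\<^bsub>R\<lparr>carrier := F\<rparr>\<^esub> \<noteq> \<zero>\<^bsub>R\<lparr>carrier := F\<rparr>\<^esub>" if "n > 0" for n :: nat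
      using char_zero[OF that] by (simp add: add_pow_def nat_pow_def)
  qed (rule gal_F)
  note Fc = subfieldE(3)[OF F] and Fs = subringE[OF subfieldE(1)[OF F]]
  let ?\<Gamma> = "carrier F.G"
  have \<gamma>F: "\<gamma> x \<in> F" if "\<gamma> \<in> ?\<Gamma>" "x \<in> F" for \<gamma> x using F.G_closed[of \<gamma> x] that by simp
  let ?s\<Gamma> = "(\<lambda>\<gamma>. restrict (\<lambda>x. s (\<gamma> x)) F) ` ?\<Gamma>"
  have "\<one>\<^bsub>F.G\<^esub> \<in> ?s\<Gamma>"
  proof (rule ccontr)
    assume not: "\<one>\<^bsub>F.G\<^esub> \<notin> ?s\<Gamma>"
    define c where "c h = (if h \<in> ?s\<Gamma> then \<one> else \<zero>) \<ominus> (if h \<in> ?\<Gamma> then \<one> else \<zero>)" for h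
    have fin: "finite (?\<Gamma> \<union> ?s\<Gamma>)" using F.finite_G by simp
    have "\<forall>h \<in> ?\<Gamma> \<union> ?s\<Gamma>. c h = \<zero>"
    proof (rule characters_independent[OF fin Fc Fs(3) Fs(6)])
      show hR: "h x \<in> carrier R" if "h \<in> ?\<Gamma> \<union> ?s\<Gamma>" "x \<in> F" for h x
        using that \<gamma>F subsetD[OF Fc] s by auto
      show "h (x \<otimes> y) = h x \<otimes> h y" if "h \<in> ?\<Gamma> \<union> ?s\<Gamma>" "x \<in> F" "y \<in> F" for h x y
      proof -
        have *: "\<gamma> (x \<otimes> y) = \<gamma> x \<otimes> \<gamma> y" if "\<gamma> \<in> ?\<Gamma>" for \<gamma>
          using F.G_mult[OF that] \<open>x \<in> F\<close> \<open>y \<in> F\<close> by simp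
        moreover have "s (\<gamma> x \<otimes> \<gamma> y) = s (\<gamma> x) \<otimes> s (\<gamma> y)" if "\<gamma> \<in> ?\<Gamma>" for \<gamma>
          using G_mult[OF s, of "\<gamma> x" "\<gamma> y"] \<gamma>F[OF that] \<open>x \<in> F\<close> \<open>y \<in> F\<close> Fc by blast
        ultimately show ?thesis using that Fs(6) by auto
      qed
      show "h \<one> = \<one>" if "h \<in> ?\<Gamma> \<union> ?s\<Gamma>" for h
      proof -
        have "\<gamma> \<one> = \<one>" if "\<gamma> \<in> ?\<Gamma>" for \<gamma> using F.G_one[OF that] by simp
        then show ?thesis using that G_one[OF s] Fs(3) by fastforce
      qed
      show "\<exists>x\<in>F. h x \<noteq> k x" if "h \<in> ?\<Gamma> \<union> ?s\<Gamma>" "k \<in> ?\<Gamma> \<union> ?s\<Gamma>" "h \<noteq> k" for h k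
      proof (rule ccontr)
        assume "\<not> (\<exists>x\<in>F. h x \<noteq> k x)"
        moreover have "h \<in> extensional F" "k \<in> extensional F"
          using that(1,2) F.G_Bij by (auto simp: Bij_def)
        ultimately show False using that(3) extensionalityI[of h F k] by blast
      qed
      show "c \<in> ?\<Gamma> \<union> ?s\<Gamma> \<rightarrow> carrier R" by (simp add: c_def)
      fix z assume z: "z \<in> F"
      have "(\<Oplus>h\<in>?\<Gamma> \<union> ?s\<Gamma>. c h \<otimes> h z)
          = (\<Oplus>h\<in>?\<Gamma> \<union> ?s\<Gamma>. (if h \<in> ?s\<Gamma> then h z else \<zero>) \<oplus> \<ominus> \<one> \<otimes> (if h \<in> ?\<Gamma> then h z else \<zero>))"
        using hR[OF _ z] by (intro finsum_cong') (auto simp: c_def minus_eq l_distr l_minus)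
      also have "\<dots> = (\<Oplus>h\<in>?\<Gamma> \<union> ?s\<Gamma>. if h \<in> ?s\<Gamma> then h z else \<zero>)
          \<oplus> (\<Oplus>h\<in>?\<Gamma> \<union> ?s\<Gamma>. \<ominus> \<one> \<otimes> (if h \<in> ?\<Gamma> then h z else \<zero>))"
        using hR[OF _ z] by (intro finsum_addf) auto
      also have "(\<Oplus>h\<in>?\<Gamma> \<union> ?s\<Gamma>. \<ominus> \<one> \<otimes> (if h \<in> ?\<Gamma> then h z else \<zero>))
          = \<ominus> \<one> \<otimes> (\<Oplus>h\<in>?\<Gamma> \<union> ?s\<Gamma>. if h \<in> ?\<Gamma> then h z else \<zero>)"
        using hR[OF _ z] fin by (intro finsum_rdistr[symmetric]) auto
      also have "(\<Oplus>h\<in>?\<Gamma> \<union> ?s\<Gamma>. if h \<in> ?\<Gamma> then h z else \<zero>) = (\<Oplus>h\<in>?\<Gamma>. h z)"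
        using hR[OF _ z] fin by (intro add.finprod_mono_neutral_cong_right) auto
      also have "(\<Oplus>h\<in>?\<Gamma> \<union> ?s\<Gamma>. if h \<in> ?s\<Gamma> then h z else \<zero>) = (\<Oplus>h\<in>?s\<Gamma>. h z)"
        using hR[OF _ z] fin by (intro add.finprod_mono_neutral_cong_right) auto
      also have "(\<Oplus>h\<in>?s\<Gamma>. h z) = (\<Oplus>\<gamma>\<in>?\<Gamma>. s (\<gamma> z))"
      proof -
        have inj: "inj_on (\<lambda>\<gamma>. restrict (\<lambda>x. s (\<gamma> x)) F) ?\<Gamma>"
        proof (rule inj_onI)
          fix \<gamma> \<delta> assume gd: "\<gamma> \<in> ?\<Gamma>" "\<delta> \<in> ?\<Gamma>" "restrict (\<lambda>x. s (\<gamma> x)) F = restrict (\<lambda>x. s (\<delta> x)) F"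
          have "\<gamma> x = \<delta> x" if "x \<in> F" for x
          proof -
            have "s (\<gamma> x) = s (\<delta> x)" using fun_cong[OF gd(3), of x] that by simp
            then show ?thesis using G_inj[OF s, of "\<gamma> x" "\<delta> x"] \<gamma>F[OF gd(1) that] \<gamma>F[OF gd(2) that] Fc by blast
          qed
          then show "\<gamma> = \<delta>" using F.G_eqI[OF gd(1,2)] by simp
        qed
        have "(\<Oplus>h\<in>?s\<Gamma>. h z) = (\<Oplus>\<gamma>\<in>?\<Gamma>. (restrict (\<lambda>x. s (\<gamma> x)) F) z)"
          using hR[OF _ z] by (intro finsum_reindex[OF _ inj]) blast
        then show ?thesis using z by simp
      qed
      also have "\<dots> = s (\<Oplus>\<gamma>\<in>?\<Gamma>. \<gamma> z)"
        using F.finite_G s \<gamma>F[OF _ z] Fc by (intro G_finsum[symmetric]) auto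
      also have "(\<Oplus>\<gamma>\<in>?\<Gamma>. \<gamma> z) = F.trace ?\<Gamma> z"
        unfolding F.trace_def using F.finite_G \<gamma>F[OF _ z] by (intro finsum_subfield[OF F, symmetric]) auto
      finally have eq: "(\<Oplus>h\<in>?\<Gamma> \<union> ?s\<Gamma>. c h \<otimes> h z)
          = s (F.trace ?\<Gamma> z) \<oplus> \<ominus> \<one> \<otimes> F.trace ?\<Gamma> z" .
      have "F.trace ?\<Gamma> z \<in> Q"
        using F.trace_fixed[OF F.grp.subgroup_self, of z] F.fixed_field_carrier z by simp
      then show "(\<Oplus>h\<in>?\<Gamma> \<union> ?s\<Gamma>. c h \<otimes> h z) = \<zero>"
        using eq G_Q[OF s] Q_carrier by (auto simp: l_minus r_neg)
    qed
    then have "c \<one>\<^bsub>F.G\<^esub> = \<zero>" using F.grp.one_closed by blast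
    then show False using not F.grp.one_closed by (simp add: c_def minus_eq)
  qed
  then obtain \<gamma> where \<gamma>: "\<gamma> \<in> ?\<Gamma>" "restrict (\<lambda>x. s (\<gamma> x)) F = \<one>\<^bsub>F.G\<^esub>"
    by (elim imageE) metis
  have "s x = (inv\<^bsub>F.G\<^esub> \<gamma>) x" if x: "x \<in> F" for x
  proof -
    let ?y = "(inv\<^bsub>F.G\<^esub> \<gamma>) x"
    have y: "?y \<in> F" "\<gamma> ?y = x"
      using \<gamma>F[OF F.grp.inv_closed[OF \<gamma>(1)] x] F.inv_apply(2)[OF \<gamma>(1)] x by simp_all
    then show ?thesis
      using fun_cong[OF \<gamma>(2), of ?y] F.one_apply[of ?y] by simp
  qed
  then show ?thesis using F.grp.inv_closed[OF \<gamma>(1)] by blast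
qed

lemma abelian_subextension:
  assumes F: "subfield F R" and abelian: "abelian_extension (R\<lparr>carrier := F\<rparr>) Q"
    and s: "s \<in> carrier G" and t: "t \<in> carrier G" and x: "x \<in> F"
  shows "s x \<in> F" and "s (t x) = t (s x)"
proof -
  let ?\<Gamma> = "Gal (R\<lparr>carrier := F\<rparr>) Q"
  have gal_F: "galois_extension (R\<lparr>carrier := F\<rparr>) Q" and comm: "comm_group ?\<Gamma>"
    using abelian by (auto simp: abelian_extension_def)
  obtain \<gamma> where \<gamma>: "\<gamma> \<in> carrier ?\<Gamma>" "\<And>x. x \<in> F \<Longrightarrow> s x = \<gamma> x"
    using restricts_to_subextension[OF F gal_F s] by blast
  obtain \<delta> where \<delta>: "\<delta> \<in> carrier ?\<Gamma>" "\<And>x. x \<in> F \<Longrightarrow> t x = \<delta> x"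
    using restricts_to_subextension[OF F gal_F t] by blast
  have closed: "\<gamma> x \<in> F" "\<delta> x \<in> F"
    using x \<gamma>(1) \<delta>(1) Bij_imp_funcset[of _ F] by (auto simp: carrier_Gal)
  then show "s x \<in> F" using \<gamma>(2)[OF x] by simp
  have "\<gamma> \<otimes>\<^bsub>?\<Gamma>\<^esub> \<delta> = \<delta> \<otimes>\<^bsub>?\<Gamma>\<^esub> \<gamma>"
    using comm_monoid.m_comm[OF comm_group.axioms(1)[OF comm] \<gamma>(1) \<delta>(1)] .
  then have "compose F \<gamma> \<delta> = compose F \<delta> \<gamma>"
    using Gal_mult[OF \<gamma>(1) \<delta>(1)] Gal_mult[OF \<delta>(1) \<gamma>(1)] by simp
  then have "\<gamma> (\<delta> x) = \<delta> (\<gamma> x)" using x by (metis compose_eq)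
  then show "s (t x) = t (s x)" using \<gamma>(2) \<delta>(2) closed x by simp
qed

end

section \<open>Counting fibres and roots of unity\<close>

text \<open>
  The fibres of \<open>f\<close> are left cosets of \<open>H\<close>.
\<close>

lemma (in group) card_fibres:
  assumes V: "subgroup V G" "finite V" and H: "H \<subseteq> V"
    and fibre: "\<And>s t. s \<in> V \<Longrightarrow> t \<in> V \<Longrightarrow> f s = f t \<longleftrightarrow> inv s \<otimes> t \<in> H"
  shows "card V = card (f ` V) * card H"
proof -
  have car: "s \<in> carrier G" if "s \<in> V" for s using that subgroup.subset[OF V(1)] by blast
  have "card {t \<in> V. f t = y} = card H" if y: "y \<in> f ` V" for y
  proof -
    obtain s where s: "s \<in> V" "y = f s" using y by blast
    have "{t \<in> V. f t = y} = (\<lambda>h. s \<otimes> h) ` H"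
    proof
      show "{t \<in> V. f t = y} \<subseteq> (\<lambda>h. s \<otimes> h) ` H"
      proof
        fix t assume "t \<in> {t \<in> V. f t = y}"
        then have t: "t \<in> V" "inv s \<otimes> t \<in> H" using fibre[of s t] s by auto
        have "t = s \<otimes> (inv s \<otimes> t)" using car s(1) t(1) by (simp add: m_assoc[symmetric])
        then show "t \<in> (\<lambda>h. s \<otimes> h) ` H" using t(2) by blast
      qed
      show "(\<lambda>h. s \<otimes> h) ` H \<subseteq> {t \<in> V. f t = y}"
      proof
        fix t assume "t \<in> (\<lambda>h. s \<otimes> h) ` H"
        then obtain h where h: "h \<in> H" "t = s \<otimes> h" by blast
        have "t \<in> V" using h H s(1) subgroup.m_closed[OF V(1)] by blast
        moreover have "inv s \<otimes> t = h"
          using h car[OF s(1)] car[of h] H by (auto simp: m_assoc[symmetric])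
        ultimately show "t \<in> {t \<in> V. f t = y}" using fibre[of s t] s h(1) by auto
      qed
    qed
    moreover have "inj_on (\<lambda>h. s \<otimes> h) H"
      using car[OF s(1)] car H by (auto simp: inj_on_def subset_iff)
    ultimately show ?thesis by (simp add: card_image)
  qed
  moreover have "card V = (\<Sum>y\<in>f ` V. card {t \<in> V. f t = y})"
    using sum.image_gen[OF V(2), of "\<lambda>_. 1::nat" f] by simp
  ultimately show ?thesis by simp
qed

text \<open>
  The coefficient list \<open>p\<close> below, with leading coefficient first, represents \<open>X\<^sup>n - 1\<close>.
\<close>

lemma (in field) card_roots_of_unity_le:
  assumes "n > 0"
  shows "finite {x \<in> carrier R. x [^] (n::nat) = \<one>}" and "card {x \<in> carrier R. x [^] n = \<one>} \<le> n"
proof -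
  define p where "p = \<one> # replicate (n - 1) \<zero> @ [\<ominus> \<one>]"
  have p: "p \<in> carrier (poly_ring R)"
    by (auto simp: p_def univ_poly_def polynomial_def set_replicate_conv_if)
  have tail: "eval (replicate k \<zero> @ [\<ominus> \<one>]) x = \<ominus> \<one>" if "x \<in> carrier R" for k x
    using that by (induction k) auto
  have "eval p x = x [^] n \<ominus> \<one>" if "x \<in> carrier R" for x
    using tail[OF that, of "n - 1"] that assms by (simp add: p_def minus_eq)
  then have "{x \<in> carrier R. x [^] n = \<one>} \<subseteq> set_mset (roots p)"
    using roots_mem_iff_is_root[OF p] by (auto simp: is_root_def p_def)
  moreover have "card (set_mset (roots p)) \<le> n"
  proof -
    have "card (set_mset (roots p)) \<le> size (roots p)"
      by (metis card_length mset.simps(1) set_mset_mset size_mset ex_mset)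
    also have "\<dots> \<le> n" using size_roots_le_degree[OF p] assms by (simp add: p_def)
    finally show ?thesis .
  qed
  ultimately show "finite {x \<in> carrier R. x [^] n = \<one>}" "card {x \<in> carrier R. x [^] n = \<one>} \<le> n"
    by (auto intro: finite_subset order.trans[OF card_mono])
qed

lemma (in field) roots_of_unity_prime:
  assumes p: "Factorial_Ring.prime (p::nat)"
    and z: "z \<in> carrier R" "z [^] p = \<one>" "z \<noteq> \<one>"
  shows "{x \<in> carrier R. x [^] p = \<one>} = (\<lambda>i. z [^] i) ` {0..p - 1}"
    and "card {x \<in> carrier R. x [^] p = \<one>} = p"
proof -
  interpret M: group "Multiplicative_Group.mult_of R" using field_mult_group .
  have p0: "p > 0" using p prime_gt_0_nat by blast
  have zM: "z \<in> carrier (Multiplicative_Group.mult_of R)"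
    using z p0 by (auto simp: nat_pow_zero)
  have "M.ord z dvd p" using M.pow_eq_id[OF zM, of p] z(2) by (simp add: Multiplicative_Group.nat_pow_mult_of)
  moreover have "M.ord z \<noteq> 1" using M.ord_eq_1[OF zM] z(3) by simp
  ultimately have ord: "M.ord z = p" using p by (metis prime_nat_iff)
  have inj: "inj_on (\<lambda>i. z [^] i) {0..p - 1}"
    using M.ord_inj[OF zM] ord by (simp add: Multiplicative_Group.nat_pow_mult_of)
  have sub: "(\<lambda>i. z [^] i) ` {0..p - 1} \<subseteq> {x \<in> carrier R. x [^] p = \<one>}"
    using z by (auto simp: nat_pow_pow) (metis mult.commute nat_pow_one nat_pow_pow)
  have card: "card ((\<lambda>i. z [^] i) ` {0..p - 1}) = p"
    using card_image[OF inj] p0 by simp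
  show eq: "{x \<in> carrier R. x [^] p = \<one>} = (\<lambda>i. z [^] i) ` {0..p - 1}"
    using card_seteq[OF card_roots_of_unity_le(1)[OF p0] sub] card_roots_of_unity_le(2)[OF p0] card by simp
  show "card {x \<in> carrier R. x [^] p = \<one>} = p" using eq card by simp
qed

section \<open>From a radical tower to a chain of subgroups\<close>

locale quasireal_subextension = galois_char_zero R Q for R :: "('a, 'b) ring_scheme" (structure) and Q +
  fixes L F :: "'a set"
  assumes L: "subfield L R" and F: "subfield F R" and QL: "Q \<subseteq> L" and QF: "Q \<subseteq> F"
    and roots_L: "x \<in> L \<Longrightarrow> n > 0 \<Longrightarrow> x [^] (n::nat) = \<one> \<Longrightarrow> x = \<one> \<or> x = \<ominus> \<one>"
    and roots_F: "x \<in> carrier R \<Longrightarrow> n > 0 \<Longrightarrow> x [^] (n::nat) = \<one> \<Longrightarrow> x \<in> F"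
    and abelian: "abelian_extension (R\<lparr>carrier := F\<rparr>) Q"
begin

abbreviation N :: "('a \<Rightarrow> 'a) set" where "N \<equiv> fixer F"
abbreviation U :: "('a \<Rightarrow> 'a) set" where "U \<equiv> fixer L"

lemma N_subgroup: "subgroup N G" and U_subgroup: "subgroup U G"
  using fixer_subgroup subfieldE(3) F L by blast+

lemma L_carrier: "L \<subseteq> carrier R" and F_carrier: "F \<subseteq> carrier R"
  using subfieldE(3) F L by blast+

lemma fixed_field_fixer:
  assumes "subfield K R" "Q \<subseteq> K"
  shows "fixed_field (fixer K) = K"
proof -
  have "carrier G \<inter> fixer K = fixer K" by (auto simp: fixer_def)
  then show ?thesis
    using fixed_field_intermediate[OF grp.subgroup_self assms(1)] fixed_field_carrier assms(2) by simp
qed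

lemma N_fixes_roots:
  assumes "s \<in> N" "x \<in> carrier R" "n > 0" "x [^] (n::nat) = \<one>"
  shows "s x = x"
  using roots_F[OF assms(2-4)] assms(1) by (simp add: fixer_def)

lemma commutator_in_N:
  assumes s: "s \<in> carrier G" and t: "t \<in> carrier G"
  shows "inv\<^bsub>G\<^esub> s \<otimes>\<^bsub>G\<^esub> inv\<^bsub>G\<^esub> t \<otimes>\<^bsub>G\<^esub> s \<otimes>\<^bsub>G\<^esub> t \<in> N"
proof -
  let ?k = "inv\<^bsub>G\<^esub> s \<otimes>\<^bsub>G\<^esub> inv\<^bsub>G\<^esub> t \<otimes>\<^bsub>G\<^esub> s \<otimes>\<^bsub>G\<^esub> t"
  have "?k x = x" if x: "x \<in> F" for x
  proof -
    have xc: "x \<in> carrier R" using x F_carrier by blast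
    have "?k x = (inv\<^bsub>G\<^esub> s) ((inv\<^bsub>G\<^esub> t) (s (t x)))"
      using s t xc by (simp add: mult_apply)
    also have "s (t x) = t (s x)" using abelian_subextension(2)[OF F abelian s t x] .
    also have "(inv\<^bsub>G\<^esub> s) ((inv\<^bsub>G\<^esub> t) (t (s x))) = x"
      using s t xc by (simp add: inv_apply)
    finally show ?thesis .
  qed
  then show ?thesis using s t by (simp add: fixer_def)
qed

lemma conjugate_in_N:
  assumes s: "s \<in> carrier G" and n: "n \<in> N"
  shows "s \<otimes>\<^bsub>G\<^esub> n \<otimes>\<^bsub>G\<^esub> inv\<^bsub>G\<^esub> s \<in> N"
proof -
  have nG: "n \<in> carrier G" using n by (simp add: fixer_def)
  have "(s \<otimes>\<^bsub>G\<^esub> n \<otimes>\<^bsub>G\<^esub> inv\<^bsub>G\<^esub> s) x = x" if x: "x \<in> F" for x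
  proof -
    have xc: "x \<in> carrier R" using x F_carrier by blast
    have "(inv\<^bsub>G\<^esub> s) x \<in> F" using abelian_subextension(1)[OF F abelian _ s x, of "inv\<^bsub>G\<^esub> s"] s by simp
    then have "n ((inv\<^bsub>G\<^esub> s) x) = (inv\<^bsub>G\<^esub> s) x" using n by (simp add: fixer_def)
    then show ?thesis using s nG xc by (simp add: mult_apply inv_apply)
  qed
  then show ?thesis using s nG by (simp add: fixer_def)
qed

text \<open>
  A link of the chain: \<open>\<chi>\<close> is the composition of the projection from \<open>B\<close> to \<open>B/A\<close> with a \<open>U\<close>-isomorphism of
  \<open>B/A\<close> onto a subgroup of the multiplicative group.
\<close>

definition radical_step :: "('a \<Rightarrow> 'a) set \<Rightarrow> ('a \<Rightarrow> 'a) set \<Rightarrow> bool" where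
  "radical_step A B \<longleftrightarrow> subgroup A G \<and> subgroup B G \<and> A \<subseteq> B
    \<and> (\<forall>u \<in> U. \<forall>a \<in> A. u \<otimes>\<^bsub>G\<^esub> a \<otimes>\<^bsub>G\<^esub> inv\<^bsub>G\<^esub> u \<in> A)
    \<and> (\<forall>u \<in> U. \<forall>b \<in> B. u \<otimes>\<^bsub>G\<^esub> b \<otimes>\<^bsub>G\<^esub> inv\<^bsub>G\<^esub> u \<in> B)
    \<and> (\<exists>p. Factorial_Ring.prime (p::nat) \<and> card B = p * card A)
    \<and> (\<exists>\<chi>. (\<forall>b \<in> B. \<chi> b \<in> carrier R - {\<zero>})
        \<and> (\<forall>b \<in> B. \<forall>c \<in> B. \<chi> (b \<otimes>\<^bsub>G\<^esub> c) = \<chi> b \<otimes> \<chi> c)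
        \<and> A = {b \<in> B. \<chi> b = \<one>}
        \<and> (\<forall>u \<in> U. \<forall>b \<in> B. \<chi> (u \<otimes>\<^bsub>G\<^esub> b \<otimes>\<^bsub>G\<^esub> inv\<^bsub>G\<^esub> u) = u (\<chi> b)))"

text \<open>
  What remains true of \<open>V\<close>, the pointwise stabilizer of a field of the tower, on the way from \<open>Q\<close> up to
  \<open>L\<close>. As \<open>|NV| = |N| |V| / |N \<inter> V|\<close>, the last clause says that \<open>|G : NV|\<close> is a power of \<open>2\<close>.
\<close>

definition tower_stage :: "('a \<Rightarrow> 'a) set \<Rightarrow> bool" where
  "tower_stage V \<longleftrightarrow> subgroup V G \<and> U \<subseteq> V \<and> radical_step\<^sup>*\<^sup>* (N \<inter> V) N
    \<and> (\<exists>k. card (carrier G) * card (N \<inter> V) = 2 ^ k * (card N * card V))"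

lemma tower_stage_carrier: "tower_stage (carrier G)"
proof -
  have "N \<inter> carrier G = N" "U \<subseteq> carrier G" by (auto simp: fixer_def)
  then show ?thesis
    unfolding tower_stage_def using grp.subgroup_self by (auto intro!: exI[of _ 0] simp: mult.commute)
qed

lemma conjugation_invariant:
  assumes "subgroup V G" "U \<subseteq> V" "u \<in> U" "b \<in> N \<inter> V"
  shows "u \<otimes>\<^bsub>G\<^esub> b \<otimes>\<^bsub>G\<^esub> inv\<^bsub>G\<^esub> u \<in> N \<inter> V"
proof -
  have "u \<in> V" "u \<in> carrier G" using assms by (auto simp: fixer_def)
  then show ?thesis
    using conjugate_in_N assms subgroup.m_closed[OF assms(1)] subgroup.m_inv_closed[OF assms(1)] by auto
qed

text \<open>
  The two cases are whether \<open>N \<inter> V\<close> fixes \<open>\<alpha>\<close>. If it does, commutators show that all conjugates \<open>s(\<alpha>)\<close>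
  lie in \<open>L\<close>, where the only roots of unity are \<open>1\<close> and \<open>-1\<close>. If it does not, \<open>s \<mapsto> s(\<alpha>)/\<alpha>\<close> takes all
  \<open>p\<close>-th roots of unity as values already on \<open>N \<inter> V\<close>, so \<open>V\<close> and \<open>N \<inter> V\<close> shrink by the same factor \<open>p\<close>.
\<close>

lemma tower_stage_prime_step:
  assumes V: "tower_stage V" and \<alpha>: "\<alpha> \<in> L" "\<alpha> \<noteq> \<zero>" and p: "Factorial_Ring.prime (p::nat)"
    and pow: "\<alpha> [^] p \<in> fixed_field V"
  shows "tower_stage {s \<in> V. s \<alpha> = \<alpha>}"
proof -
  let ?V' = "{s \<in> V. s \<alpha> = \<alpha>}"
  have VG: "subgroup V G" and UV: "U \<subseteq> V" and chain: "radical_step\<^sup>*\<^sup>* (N \<inter> V) N"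
    using V by (auto simp: tower_stage_def)
  obtain k where k: "card (carrier G) * card (N \<inter> V) = 2 ^ k * (card N * card V)"
    using V by (auto simp: tower_stage_def)
  have car: "s \<in> carrier G" if "s \<in> V" for s using that subgroup.subset[OF VG] by blast
  have \<alpha>c: "\<alpha> \<in> carrier R" using \<alpha>(1) L_carrier by blast
  have p0: "p > 0" using p prime_gt_0_nat by blast
  have i\<alpha>: "inv \<alpha> \<in> carrier R" "\<alpha> \<otimes> inv \<alpha> = \<one>" "inv \<alpha> \<otimes> \<alpha> = \<one>"
    using \<alpha>c \<alpha>(2) by (simp_all add: field_Units)
  have V'_eq: "?V' = V \<inter> fixer {\<alpha>}" using car by (auto simp: fixer_def)
  have V': "subgroup ?V' G"
    unfolding V'_eq using grp.subgroups_Inter_pair VG fixer_subgroup[of "{\<alpha>}"] \<alpha>c by blast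
  have UV': "U \<subseteq> ?V'" using UV \<alpha>(1) by (auto simp: fixer_def)
  have NV: "subgroup (N \<inter> V) G" "subgroup (N \<inter> ?V') G"
    using grp.subgroups_Inter_pair N_subgroup VG V' by blast+
  define \<chi> where "\<chi> s = s \<alpha> \<otimes> inv \<alpha>" for s
  have \<chi>c: "\<chi> s \<in> carrier R" if "s \<in> V" for s using car[OF that] \<alpha>c i\<alpha> by (simp add: \<chi>_def)
  have s\<alpha>: "s \<alpha> = \<chi> s \<otimes> \<alpha>" if "s \<in> V" for s
    using car[OF that] \<alpha>c i\<alpha> by (simp add: \<chi>_def m_assoc)
  have \<chi>_pow: "\<chi> s [^] p = \<one>" if s: "s \<in> V" for s
  proof -
    have "s (\<alpha> [^] p) = \<alpha> [^] p" using pow s by (simp add: fixed_field_def)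
    then have "s \<alpha> [^] p = \<alpha> [^] p" unfolding G_pow[OF car[OF s] \<alpha>c, of p] .
    then have "\<chi> s [^] p = \<alpha> [^] p \<otimes> inv \<alpha> [^] p"
      using car[OF s] \<alpha>c i\<alpha> by (simp add: \<chi>_def nat_pow_distrib)
    also have "\<dots> = \<one>" using nat_pow_distrib[OF \<alpha>c i\<alpha>(1), of p] i\<alpha>(2) by simp
    finally show ?thesis .
  qed
  have \<chi>_eq_iff: "\<chi> s = \<chi> t \<longleftrightarrow> inv\<^bsub>G\<^esub> s \<otimes>\<^bsub>G\<^esub> t \<in> ?V'" if st: "s \<in> V" "t \<in> V" for s t
  proof -
    have "inv\<^bsub>G\<^esub> s \<otimes>\<^bsub>G\<^esub> t \<in> V" using st subgroup.m_closed[OF VG] subgroup.m_inv_closed[OF VG] by blast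
    moreover have "(inv\<^bsub>G\<^esub> s \<otimes>\<^bsub>G\<^esub> t) \<alpha> = \<alpha> \<longleftrightarrow> t \<alpha> = s \<alpha>"
    proof -
      have "(inv\<^bsub>G\<^esub> s \<otimes>\<^bsub>G\<^esub> t) \<alpha> = (inv\<^bsub>G\<^esub> s) (t \<alpha>)"
        using car st \<alpha>c by (simp add: mult_apply)
      then show ?thesis
        using inv_apply[OF car[OF st(1)]] car[OF st(2)] \<alpha>c by (metis G_closed)
    qed
    moreover have "\<chi> s = \<chi> t \<longleftrightarrow> t \<alpha> = s \<alpha>"
      using s\<alpha>[OF st(1)] s\<alpha>[OF st(2)] unfolding \<chi>_def by auto
    ultimately show ?thesis by blast
  qed
  have cardV: "card V = card (\<chi> ` V) * card ?V'"
    by (rule grp.card_fibres[OF VG finite_subgroup[OF VG]]) (use \<chi>_eq_iff in auto)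
  have cardNV: "card (N \<inter> V) = card (\<chi> ` (N \<inter> V)) * card (N \<inter> ?V')"
  proof (rule grp.card_fibres[OF NV(1) finite_subgroup[OF NV(1)]])
    fix s t assume st: "s \<in> N \<inter> V" "t \<in> N \<inter> V"
    then have "inv\<^bsub>G\<^esub> s \<otimes>\<^bsub>G\<^esub> t \<in> N"
      using subgroup.m_closed[OF N_subgroup] subgroup.m_inv_closed[OF N_subgroup] by blast
    then show "\<chi> s = \<chi> t \<longleftrightarrow> inv\<^bsub>G\<^esub> s \<otimes>\<^bsub>G\<^esub> t \<in> N \<inter> ?V'" using \<chi>_eq_iff[of s t] st by blast
  qed auto
  show ?thesis
  proof (cases "\<forall>s \<in> N \<inter> V. s \<alpha> = \<alpha>")
    case True
    then have NV': "N \<inter> ?V' = N \<inter> V" by auto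
    have "\<chi> s \<in> {\<one>, \<ominus> \<one>}" if s: "s \<in> V" for s
    proof -
      have "s \<alpha> \<in> fixed_field U"
      proof -
        have "u (s \<alpha>) = s \<alpha>" if u: "u \<in> U" for u
        proof -
          have uV: "u \<in> V" and u\<alpha>: "u \<alpha> = \<alpha>" using u UV \<alpha>(1) by (auto simp: fixer_def)
          \<comment> \<open>a commutator in \<open>N \<inter> V\<close>; as \<open>u\<close> fixes \<open>\<alpha>\<close>, this commutator fixes \<open>\<alpha>\<close> only if \<open>u\<close> fixes \<open>s(\<alpha>)\<close>\<close>
          let ?k = "inv\<^bsub>G\<^esub> s \<otimes>\<^bsub>G\<^esub> inv\<^bsub>G\<^esub> u \<otimes>\<^bsub>G\<^esub> s \<otimes>\<^bsub>G\<^esub> u"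
          have "?k \<in> V" using s uV subgroup.m_closed[OF VG] subgroup.m_inv_closed[OF VG] by auto
          then have "?k \<alpha> = \<alpha>" using True commutator_in_N[OF car[OF s] car[OF uV]] by blast
          moreover have "?k \<alpha> = (inv\<^bsub>G\<^esub> s) ((inv\<^bsub>G\<^esub> u) (s \<alpha>))"
            using car[OF s] car[OF uV] \<alpha>c u\<alpha> by (simp add: mult_apply)
          ultimately have "s ((inv\<^bsub>G\<^esub> s) ((inv\<^bsub>G\<^esub> u) (s \<alpha>))) = s \<alpha>" by simp
          then have "(inv\<^bsub>G\<^esub> u) (s \<alpha>) = s \<alpha>"
            using car[OF s] car[OF uV] \<alpha>c by (simp add: inv_apply)
          then show ?thesis
            using inv_apply(2)[OF car[OF uV], of "s \<alpha>"] car[OF s] \<alpha>c by simp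
        qed
        then show ?thesis using car[OF s] \<alpha>c by (simp add: fixed_field_def)
      qed
      then have "s \<alpha> \<in> L" using fixed_field_fixer[OF L QL] by simp
      moreover have "inv \<alpha> \<in> L" using subfield_m_inv(1)[OF L] \<alpha> by blast
      ultimately have "\<chi> s \<in> L" unfolding \<chi>_def using subringE(6)[OF subfieldE(1)[OF L]] by blast
      then show ?thesis using roots_L[OF _ p0 \<chi>_pow[OF s]] by blast
    qed
    then have sub: "\<chi> ` V \<subseteq> {\<one>, \<ominus> \<one>}" by blast
    have "card (\<chi> ` V) \<le> 2"
      using card_mono[OF _ sub] by (simp add: card_insert_if split: if_splits)
    moreover have "card (\<chi> ` V) > 0"
      using finite_subgroup[OF VG] subgroup.one_closed[OF VG] by (auto simp: card_gt_0_iff)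
    ultimately have "card (\<chi> ` V) = 2 ^ 0 \<or> card (\<chi> ` V) = 2 ^ 1" by auto
    then obtain j where "card (\<chi> ` V) = 2 ^ j" by blast
    then have "card (carrier G) * card (N \<inter> ?V') = 2 ^ (k + j) * (card N * card ?V')"
      using k cardV unfolding NV' by (simp add: power_add)
    then show ?thesis
      unfolding tower_stage_def using V' UV' chain NV' by auto
  next
    case False
    then obtain t where t: "t \<in> N \<inter> V" "t \<alpha> \<noteq> \<alpha>" by blast
    have \<chi>t: "\<chi> t \<in> carrier R" "\<chi> t [^] p = \<one>" "\<chi> t \<noteq> \<one>"
      using \<chi>c \<chi>_pow t s\<alpha>[of t] \<alpha>c by auto
    let ?\<mu> = "{x \<in> carrier R. x [^] p = \<one>}"
    have \<chi>_mult: "\<chi> (b \<otimes>\<^bsub>G\<^esub> c) = \<chi> b \<otimes> \<chi> c" if "b \<in> N \<inter> V" "c \<in> N \<inter> V" for b c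
    proof -
      have bc: "b \<in> V" "c \<in> V" "b \<in> carrier G" "c \<in> carrier G" using that car by auto
      have "(b \<otimes>\<^bsub>G\<^esub> c) \<alpha> = b (\<chi> c \<otimes> \<alpha>)" using mult_apply[OF bc(3,4) \<alpha>c] s\<alpha>[OF bc(2)] by simp
      also have "\<dots> = b (\<chi> c) \<otimes> b \<alpha>" using G_mult[OF bc(3) \<chi>c[OF bc(2)] \<alpha>c] .
      also have "b (\<chi> c) = \<chi> c"
        using N_fixes_roots[OF _ \<chi>c[OF bc(2)] p0 \<chi>_pow[OF bc(2)]] that(1) by blast
      finally have "\<chi> (b \<otimes>\<^bsub>G\<^esub> c) = \<chi> c \<otimes> b \<alpha> \<otimes> inv \<alpha>" by (simp add: \<chi>_def)
      also have "\<dots> = \<chi> c \<otimes> \<chi> b"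
        using \<chi>c[OF bc(2)] bc(3) \<alpha>c i\<alpha>(1) by (simp add: \<chi>_def m_assoc)
      finally show ?thesis using \<chi>c bc by (simp add: m_comm)
    qed
    have one: "\<chi> \<one>\<^bsub>G\<^esub> = \<one>" using one_apply[OF \<alpha>c] i\<alpha>(2) by (simp add: \<chi>_def)
    have "\<chi> (t [^]\<^bsub>G\<^esub> i) = \<chi> t [^] i \<and> t [^]\<^bsub>G\<^esub> i \<in> N \<inter> V" for i :: nat
    proof (induction i)
      case 0
      then show ?case using one subgroup.one_closed[OF NV(1)] by simp
    next
      case (Suc i)
      then show ?case using \<chi>_mult[of "t [^]\<^bsub>G\<^esub> i" t] t(1) subgroup.m_closed[OF NV(1)] by simp
    qed
    then have "?\<mu> \<subseteq> \<chi> ` (N \<inter> V)"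
      unfolding roots_of_unity_prime(1)[OF p \<chi>t] by (smt (verit) image_iff subsetI)
    moreover have "\<chi> ` V \<subseteq> ?\<mu>" using \<chi>c \<chi>_pow by blast
    ultimately have images: "\<chi> ` (N \<inter> V) = ?\<mu>" "\<chi> ` V = ?\<mu>" by blast+
    have card_images: "card (\<chi> ` (N \<inter> V)) = p" "card (\<chi> ` V) = p"
      unfolding images using roots_of_unity_prime(2)[OF p \<chi>t] by simp_all
    have "radical_step (N \<inter> ?V') (N \<inter> V)"
      unfolding radical_step_def
    proof (intro conjI exI[of _ p] exI[of _ \<chi>] ballI)
      show "\<chi> b \<in> carrier R - {\<zero>}" if "b \<in> N \<inter> V" for b
        using \<chi>c[of b] \<chi>_pow[of b] that p0 nat_pow_zero[of p] by auto
      show "N \<inter> ?V' = {b \<in> N \<inter> V. \<chi> b = \<one>}"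
      proof -
        have "\<chi> b = \<one> \<longleftrightarrow> b \<alpha> = \<alpha>" if "b \<in> V" for b
        proof
          show "b \<alpha> = \<alpha>" if "\<chi> b = \<one>" using s\<alpha>[OF \<open>b \<in> V\<close>] that \<alpha>c by simp
          show "\<chi> b = \<one>" if "b \<alpha> = \<alpha>" using that i\<alpha>(2) by (simp add: \<chi>_def)
        qed
        then show ?thesis by blast
      qed
      show "u \<otimes>\<^bsub>G\<^esub> a \<otimes>\<^bsub>G\<^esub> inv\<^bsub>G\<^esub> u \<in> N \<inter> ?V'" if "u \<in> U" "a \<in> N \<inter> ?V'" for u a
        using conjugation_invariant[OF V' UV' that] .
      show "u \<otimes>\<^bsub>G\<^esub> b \<otimes>\<^bsub>G\<^esub> inv\<^bsub>G\<^esub> u \<in> N \<inter> V" if "u \<in> U" "b \<in> N \<inter> V" for u b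
        using conjugation_invariant[OF VG UV that] .
      show "\<chi> (u \<otimes>\<^bsub>G\<^esub> b \<otimes>\<^bsub>G\<^esub> inv\<^bsub>G\<^esub> u) = u (\<chi> b)" if "u \<in> U" "b \<in> N \<inter> V" for u b
      proof -
        have u: "u \<in> carrier G" "u \<alpha> = \<alpha>" and b: "b \<in> V" "b \<in> carrier G"
          using that \<alpha>(1) car by (auto simp: fixer_def)
        have "(inv\<^bsub>G\<^esub> u) \<alpha> = \<alpha>" using inv_apply(1)[OF u(1) \<alpha>c] u(2) by simp
        then have "(u \<otimes>\<^bsub>G\<^esub> b \<otimes>\<^bsub>G\<^esub> inv\<^bsub>G\<^esub> u) \<alpha> = u (b \<alpha>)"
          using u b \<alpha>c by (simp add: mult_apply)
        also have "\<dots> = u (\<chi> b) \<otimes> \<alpha>"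
          using s\<alpha>[OF b(1)] G_mult[OF u(1) \<chi>c[OF b(1)] \<alpha>c] u(2) by simp
        finally show ?thesis
          using u(1) \<chi>c[OF b(1)] \<alpha>c i\<alpha> by (simp add: \<chi>_def m_assoc)
      qed
    qed (use NV p cardNV card_images \<chi>_mult in auto)
    then have "radical_step\<^sup>*\<^sup>* (N \<inter> ?V') N"
      using chain by (rule converse_rtranclp_into_rtranclp)
    moreover have "card (carrier G) * card (N \<inter> ?V') = 2 ^ k * (card N * card ?V')"
      using k p0 unfolding cardNV cardV card_images by simp
    ultimately show ?thesis
      unfolding tower_stage_def using V' UV' by blast
  qed
qed

text \<open>
  For \<open>n = m p\<close> with \<open>p\<close> prime, pass first to the stabilizer of \<open>\<alpha>\<^sup>m\<close>, whose \<open>p\<close>-th power is fixed,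
  and then to that of \<open>\<alpha>\<close>.
\<close>

lemma tower_stage_radical_step:
  assumes "tower_stage V" "\<alpha> \<in> L" "n > 0" "\<alpha> [^] (n::nat) \<in> fixed_field V"
  shows "tower_stage {s \<in> V. s \<alpha> = \<alpha>}"
  using assms
proof (induction n arbitrary: V rule: less_induct)
  case (less n)
  have VG: "subgroup V G" using less.prems(1) by (simp add: tower_stage_def)
  have car: "s \<in> carrier G" if "s \<in> V" for s using that subgroup.subset[OF VG] by blast
  have \<alpha>c: "\<alpha> \<in> carrier R" using less.prems(2) L_carrier by blast
  show ?case
  proof (cases "n = 1 \<or> \<alpha> = \<zero>")
    case True
    then have "s \<alpha> = \<alpha>" if "s \<in> V" for s
      using less.prems(4) \<alpha>c car[OF that] that by (auto simp: fixed_field_def)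
    then have "{s \<in> V. s \<alpha> = \<alpha>} = V" by blast
    then show ?thesis using less.prems(1) by simp
  next
    case False
    then obtain p where p: "Factorial_Ring.prime p" "p dvd n"
      using prime_factor_nat by blast
    then obtain m where m: "n = m * p" by (metis dvd_def mult.commute)
    then have m': "m > 0" "m < n"
      using less.prems(3) prime_gt_1_nat[OF p(1)] by auto
    let ?\<beta> = "\<alpha> [^] m"
    have \<beta>: "?\<beta> \<in> L" "?\<beta> \<noteq> \<zero>"
    proof -
      show "?\<beta> \<in> L"
        using subringE(3,6)[OF subfieldE(1)[OF L]] less.prems(2) by (induction m) auto
      show "?\<beta> \<noteq> \<zero>"
        using False \<alpha>c by (induction m) (auto simp: integral_iff)
    qed
    let ?V1 = "{s \<in> V. s ?\<beta> = ?\<beta>}"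
    have "tower_stage ?V1"
      using tower_stage_prime_step[OF less.prems(1) \<beta> p(1)] less.prems(4) \<alpha>c by (simp add: nat_pow_pow m)
    moreover have "?\<beta> \<in> fixed_field ?V1" using \<alpha>c by (simp add: fixed_field_def)
    ultimately have "tower_stage {s \<in> ?V1. s \<alpha> = \<alpha>}"
      using less.IH[OF m'(2) _ less.prems(2) m'(1)] by blast
    moreover have "{s \<in> ?V1. s \<alpha> = \<alpha>} = {s \<in> V. s \<alpha> = \<alpha>}"
    proof -
      have "s ?\<beta> = ?\<beta>" if "s \<in> V" "s \<alpha> = \<alpha>" for s
        using G_pow[OF car[OF that(1)] \<alpha>c, of m] unfolding that(2) .
      then show ?thesis by blast
    qed
    ultimately show ?thesis by simp
  qed
qed

lemma repeated_radical_imp_tower_stage: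
  assumes "repeated_radical_extension R Q L"
  shows "tower_stage U"
proof -
  obtain T n where T: "T 0 = Q" "T n = L" "\<And>i. i < n \<Longrightarrow> radical_extension R (T i) (T (Suc i))"
    using assms unfolding repeated_radical_extension_def by blast
  have mono: "T i \<subseteq> T j" if "i \<le> j" "j \<le> n" for i j
    using that
  proof (induction j rule: dec_induct)
    case (step j)
    then show ?case using T(3)[of j] by (auto simp: radical_extension_def)
  qed simp
  have "tower_stage (fixer (T i))" if "i \<le> n" for i
    using that
  proof (induction i)
    case 0
    have "fixer Q = carrier G" using G_Q by (auto simp: fixer_def)
    then show ?case using T(1) tower_stage_carrier by simp
  next
    case (Suc i)
    have i: "i < n" using Suc.prems by simp
    have K: "subfield (T i) R" and QK: "Q \<subseteq> T i"
      using T(3)[OF i] mono[of 0 i] T(1) i by (auto simp: radical_extension_def)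
    obtain \<alpha> m where \<alpha>: "\<alpha> \<in> T (Suc i)" "m > 0" "\<alpha> [^] (m::nat) \<in> T i"
        "T (Suc i) = simple_extension (T i) \<alpha>"
      using T(3)[OF i] unfolding radical_extension_def by blast
    have \<alpha>L: "\<alpha> \<in> L" using \<alpha>(1) mono[of "Suc i" n] Suc.prems T(2) by auto
    have "fixer (T (Suc i)) = {s \<in> fixer (T i). s \<alpha> = \<alpha>}"
      using fixer_simple_extension[OF K, of \<alpha>] \<alpha>L L_carrier unfolding \<alpha>(4) by blast
    then show ?case
      using tower_stage_radical_step[OF _ \<alpha>L \<alpha>(2)] Suc.IH i \<alpha>(3) fixed_field_fixer[OF K QK] by simp
  qed
  then show ?thesis using T(2) by blast
qed

end

context quasireal_subextension
begin

section \<open>From a chain of subgroups to a radical tower\<close>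

lemma mult_U_subgroup:
  assumes A: "subgroup A G" and inv: "\<And>u a. u \<in> U \<Longrightarrow> a \<in> A \<Longrightarrow> u \<otimes>\<^bsub>G\<^esub> a \<otimes>\<^bsub>G\<^esub> inv\<^bsub>G\<^esub> u \<in> A"
  shows "subgroup (A <#>\<^bsub>G\<^esub> U) G"
proof (rule grp.subgroupI)
  have car: "a \<in> carrier G" if "a \<in> A" for a using that subgroup.subset[OF A] by blast
  have carU: "u \<in> carrier G" if "u \<in> U" for u using that subgroup.subset[OF U_subgroup] by blast
  show "A <#>\<^bsub>G\<^esub> U \<subseteq> carrier G" using car carU by (auto simp: set_mult_def)
  show "A <#>\<^bsub>G\<^esub> U \<noteq> {}"
    using subgroup.one_closed[OF A] subgroup.one_closed[OF U_subgroup] by (auto simp: set_mult_def)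
  show "inv\<^bsub>G\<^esub> s \<in> A <#>\<^bsub>G\<^esub> U" if s: "s \<in> A <#>\<^bsub>G\<^esub> U" for s
  proof -
    obtain a u where au: "a \<in> A" "u \<in> U" "s = a \<otimes>\<^bsub>G\<^esub> u" using s by (auto simp: set_mult_def)
    let ?v = "inv\<^bsub>G\<^esub> u"
    have v: "?v \<in> U" using subgroup.m_inv_closed[OF U_subgroup au(2)] .
    have "?v \<otimes>\<^bsub>G\<^esub> inv\<^bsub>G\<^esub> a \<otimes>\<^bsub>G\<^esub> inv\<^bsub>G\<^esub> ?v \<in> A"
      using inv[OF v subgroup.m_inv_closed[OF A au(1)]] .
    moreover have "inv\<^bsub>G\<^esub> s = (?v \<otimes>\<^bsub>G\<^esub> inv\<^bsub>G\<^esub> a \<otimes>\<^bsub>G\<^esub> inv\<^bsub>G\<^esub> ?v) \<otimes>\<^bsub>G\<^esub> ?v"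
      using car[OF au(1)] carU[OF au(2)] au(3) by (simp add: grp.inv_mult_group grp.m_assoc)
    ultimately show ?thesis using v by (auto simp: set_mult_def)
  qed
  show "s \<otimes>\<^bsub>G\<^esub> t \<in> A <#>\<^bsub>G\<^esub> U" if st: "s \<in> A <#>\<^bsub>G\<^esub> U" "t \<in> A <#>\<^bsub>G\<^esub> U" for s t
  proof -
    obtain a u where au: "a \<in> A" "u \<in> U" "s = a \<otimes>\<^bsub>G\<^esub> u" using st(1) by (auto simp: set_mult_def)
    obtain b v where bv: "b \<in> A" "v \<in> U" "t = b \<otimes>\<^bsub>G\<^esub> v" using st(2) by (auto simp: set_mult_def)
    have "s \<otimes>\<^bsub>G\<^esub> t = (a \<otimes>\<^bsub>G\<^esub> (u \<otimes>\<^bsub>G\<^esub> b \<otimes>\<^bsub>G\<^esub> inv\<^bsub>G\<^esub> u)) \<otimes>\<^bsub>G\<^esub> (u \<otimes>\<^bsub>G\<^esub> v)"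
      using car[OF au(1)] carU[OF au(2)] au(3) car[OF bv(1)] carU[OF bv(2)] bv(3)
      by (simp add: grp.m_assoc grp.inv_solve_left)
    moreover have "a \<otimes>\<^bsub>G\<^esub> (u \<otimes>\<^bsub>G\<^esub> b \<otimes>\<^bsub>G\<^esub> inv\<^bsub>G\<^esub> u) \<in> A"
      using subgroup.m_closed[OF A au(1) inv[OF au(2) bv(1)]] .
    moreover have "u \<otimes>\<^bsub>G\<^esub> v \<in> U" using subgroup.m_closed[OF U_subgroup au(2) bv(2)] .
    ultimately show ?thesis by (auto simp: set_mult_def)
  qed
qed

text \<open>
  The cocycle is \<open>bu \<mapsto> \<chi>(b)\<close>. It is well defined because \<open>B \<inter> U\<close> lies in \<open>N \<inter> U\<close> and hence in the
  kernel \<open>A\<close>. The cocycle identity combines the equivariance of \<open>\<chi>\<close> with the fact that \<open>B\<close>, being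
  contained in \<open>N\<close>, fixes the values of \<open>\<chi>\<close>.
\<close>

lemma radical_step_fixed_fields:
  assumes step: "radical_step A B" and BN: "B \<subseteq> N" and NU: "N \<inter> U \<subseteq> A"
  shows "radical_extension R (fixed_field (B <#>\<^bsub>G\<^esub> U)) (fixed_field (A <#>\<^bsub>G\<^esub> U))"
proof -
  have B: "subgroup B G" and AB: "A \<subseteq> B"
    and B_inv: "\<And>u b. u \<in> U \<Longrightarrow> b \<in> B \<Longrightarrow> u \<otimes>\<^bsub>G\<^esub> b \<otimes>\<^bsub>G\<^esub> inv\<^bsub>G\<^esub> u \<in> B"
    using step by (auto simp: radical_step_def)
  obtain \<chi> where \<chi>: "(\<forall>b \<in> B. \<chi> b \<in> carrier R - {\<zero>})
      \<and> (\<forall>b \<in> B. \<forall>c \<in> B. \<chi> (b \<otimes>\<^bsub>G\<^esub> c) = \<chi> b \<otimes> \<chi> c)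
      \<and> A = {b \<in> B. \<chi> b = \<one>}
      \<and> (\<forall>u \<in> U. \<forall>b \<in> B. \<chi> (u \<otimes>\<^bsub>G\<^esub> b \<otimes>\<^bsub>G\<^esub> inv\<^bsub>G\<^esub> u) = u (\<chi> b))"
    using step unfolding radical_step_def by (elim conjE) (erule exE)
  have \<chi>c: "\<And>b. b \<in> B \<Longrightarrow> \<chi> b \<in> carrier R - {\<zero>}"
    and \<chi>_mult: "\<And>b c. b \<in> B \<Longrightarrow> c \<in> B \<Longrightarrow> \<chi> (b \<otimes>\<^bsub>G\<^esub> c) = \<chi> b \<otimes> \<chi> c"
    and ker: "A = {b \<in> B. \<chi> b = \<one>}"
    and equiv: "\<And>u b. u \<in> U \<Longrightarrow> b \<in> B \<Longrightarrow> \<chi> (u \<otimes>\<^bsub>G\<^esub> b \<otimes>\<^bsub>G\<^esub> inv\<^bsub>G\<^esub> u) = u (\<chi> b)"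
    using \<chi> by (elim conjE; simp)+
  have car: "b \<in> carrier G" if "b \<in> B" for b using that subgroup.subset[OF B] by blast
  have carU: "u \<in> carrier G" if "u \<in> U" for u using that subgroup.subset[OF U_subgroup] by blast
  have \<chi>_one: "\<chi> \<one>\<^bsub>G\<^esub> = \<one>"
  proof -
    have "\<chi> \<one>\<^bsub>G\<^esub> = \<chi> \<one>\<^bsub>G\<^esub> \<otimes> \<chi> \<one>\<^bsub>G\<^esub>"
      using \<chi>_mult[OF subgroup.one_closed[OF B] subgroup.one_closed[OF B]] by simp
    then show ?thesis
      using \<chi>c[OF subgroup.one_closed[OF B]] m_lcancel[of "\<chi> \<one>\<^bsub>G\<^esub>" "\<chi> \<one>\<^bsub>G\<^esub>" \<one>] by auto
  qed
  \<comment> \<open>an exponent that kills every value of \<open>\<chi>\<close>\<close>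
  let ?n = "card (carrier G)"
  have n0: "?n > 0" using finite_G grp.one_closed card_gt_0_iff by blast
  have \<chi>_pow: "\<chi> b [^] ?n = \<one>" if b: "b \<in> B" for b
  proof -
    have "\<chi> (b [^]\<^bsub>G\<^esub> i) = \<chi> b [^] i \<and> b [^]\<^bsub>G\<^esub> i \<in> B" for i :: nat
    proof (induction i)
      case 0
      then show ?case using \<chi>_one subgroup.one_closed[OF B] by simp
    next
      case (Suc i)
      then show ?case using \<chi>_mult[of "b [^]\<^bsub>G\<^esub> i" b] b subgroup.m_closed[OF B] by simp
    qed
    moreover have "b [^]\<^bsub>G\<^esub> ?n = \<one>\<^bsub>G\<^esub>"
      using grp.pow_order_eq_1[OF car[OF b]] by (simp add: order_def)
    ultimately show ?thesis using \<chi>_one by metis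
  qed
  define c where "c s = \<chi> (SOME b. b \<in> B \<and> (\<exists>u \<in> U. s = b \<otimes>\<^bsub>G\<^esub> u))" for s
  have c_eq: "c (b \<otimes>\<^bsub>G\<^esub> u) = \<chi> b" if bu: "b \<in> B" "u \<in> U" for b u
  proof -
    let ?P = "\<lambda>d. d \<in> B \<and> (\<exists>v \<in> U. b \<otimes>\<^bsub>G\<^esub> u = d \<otimes>\<^bsub>G\<^esub> v)"
    let ?d = "SOME d. ?P d"
    have "?P ?d" using someI[of ?P b] bu by blast
    then obtain v where dv: "?d \<in> B" "v \<in> U" "b \<otimes>\<^bsub>G\<^esub> u = ?d \<otimes>\<^bsub>G\<^esub> v" by blast
    have "inv\<^bsub>G\<^esub> ?d \<otimes>\<^bsub>G\<^esub> b = v \<otimes>\<^bsub>G\<^esub> inv\<^bsub>G\<^esub> u"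
    proof -
      have "inv\<^bsub>G\<^esub> ?d \<otimes>\<^bsub>G\<^esub> (b \<otimes>\<^bsub>G\<^esub> u) \<otimes>\<^bsub>G\<^esub> inv\<^bsub>G\<^esub> u = inv\<^bsub>G\<^esub> ?d \<otimes>\<^bsub>G\<^esub> (?d \<otimes>\<^bsub>G\<^esub> v) \<otimes>\<^bsub>G\<^esub> inv\<^bsub>G\<^esub> u"
        using dv(3) by simp
      moreover have "inv\<^bsub>G\<^esub> ?d \<otimes>\<^bsub>G\<^esub> (b \<otimes>\<^bsub>G\<^esub> u) \<otimes>\<^bsub>G\<^esub> inv\<^bsub>G\<^esub> u = inv\<^bsub>G\<^esub> ?d \<otimes>\<^bsub>G\<^esub> b"
        using car[OF dv(1)] car[OF bu(1)] carU[OF bu(2)] by (simp add: grp.m_assoc)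
      moreover have "inv\<^bsub>G\<^esub> ?d \<otimes>\<^bsub>G\<^esub> (?d \<otimes>\<^bsub>G\<^esub> v) = v"
        using car[OF dv(1)] carU[OF dv(2)] by (simp add: grp.m_assoc[symmetric])
      ultimately show ?thesis by simp
    qed
    moreover have "v \<otimes>\<^bsub>G\<^esub> inv\<^bsub>G\<^esub> u \<in> U"
      using subgroup.m_closed[OF U_subgroup dv(2) subgroup.m_inv_closed[OF U_subgroup bu(2)]] .
    moreover have dB: "inv\<^bsub>G\<^esub> ?d \<otimes>\<^bsub>G\<^esub> b \<in> B"
      using subgroup.m_closed[OF B subgroup.m_inv_closed[OF B dv(1)] bu(1)] .
    ultimately have "inv\<^bsub>G\<^esub> ?d \<otimes>\<^bsub>G\<^esub> b \<in> A" using BN NU by auto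
    then have "\<chi> (inv\<^bsub>G\<^esub> ?d \<otimes>\<^bsub>G\<^esub> b) = \<one>" using ker by blast
    moreover have "?d \<otimes>\<^bsub>G\<^esub> (inv\<^bsub>G\<^esub> ?d \<otimes>\<^bsub>G\<^esub> b) = b"
      using car[OF dv(1)] car[OF bu(1)] by (simp add: grp.m_assoc[symmetric])
    ultimately have "\<chi> b = \<chi> ?d" using \<chi>_mult[OF dv(1) dB] \<chi>c[OF dv(1)] by simp
    then show ?thesis by (simp add: c_def)
  qed
  have "radical_extension R (fixed_field (B <#>\<^bsub>G\<^esub> U)) (fixed_field {s \<in> B <#>\<^bsub>G\<^esub> U. c s = \<one>})"
  proof (rule kummer_radical[OF mult_U_subgroup[OF B B_inv] _ _ n0])
    show "c s \<in> carrier R" "c s [^] ?n = \<one>" if "s \<in> B <#>\<^bsub>G\<^esub> U" for s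
      using that c_eq \<chi>c \<chi>_pow by (auto simp: set_mult_def)
    show "c (s \<otimes>\<^bsub>G\<^esub> t) = c s \<otimes> s (c t)" if st: "s \<in> B <#>\<^bsub>G\<^esub> U" "t \<in> B <#>\<^bsub>G\<^esub> U" for s t
    proof -
      obtain a u where au: "a \<in> B" "u \<in> U" "s = a \<otimes>\<^bsub>G\<^esub> u" using st(1) by (auto simp: set_mult_def)
      obtain b v where bv: "b \<in> B" "v \<in> U" "t = b \<otimes>\<^bsub>G\<^esub> v" using st(2) by (auto simp: set_mult_def)
      let ?b = "u \<otimes>\<^bsub>G\<^esub> b \<otimes>\<^bsub>G\<^esub> inv\<^bsub>G\<^esub> u"
      have b': "?b \<in> B" using B_inv[OF au(2) bv(1)] .
      have "s \<otimes>\<^bsub>G\<^esub> t = (a \<otimes>\<^bsub>G\<^esub> ?b) \<otimes>\<^bsub>G\<^esub> (u \<otimes>\<^bsub>G\<^esub> v)"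
        using car[OF au(1)] carU[OF au(2)] au(3) car[OF bv(1)] carU[OF bv(2)] bv(3)
        by (simp add: grp.m_assoc grp.inv_solve_left)
      then have "c (s \<otimes>\<^bsub>G\<^esub> t) = \<chi> (a \<otimes>\<^bsub>G\<^esub> ?b)"
        using c_eq subgroup.m_closed[OF B au(1) b'] subgroup.m_closed[OF U_subgroup au(2) bv(2)] by simp
      also have "\<dots> = \<chi> a \<otimes> u (\<chi> b)"
        using \<chi>_mult[OF au(1) b'] equiv[OF au(2) bv(1)] by simp
      also have "u (\<chi> b) = s (\<chi> b)"
      proof -
        have "\<chi> b \<in> carrier R" using \<chi>c[OF bv(1)] by simp
        moreover from this have "a (u (\<chi> b)) = u (\<chi> b)"
          using N_fixes_roots[of a "u (\<chi> b)", OF _ _ n0] au(1) BN carU[OF au(2)]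
            G_pow[OF carU[OF au(2)], of "\<chi> b" ?n] \<chi>_pow[OF bv(1)] by auto
        ultimately show ?thesis
          using mult_apply[OF car[OF au(1)] carU[OF au(2)]] au(3) by simp
      qed
      finally show ?thesis using c_eq[OF au(1,2)] c_eq[OF bv(1,2)] au(3) bv(3) by simp
    qed
  qed
  moreover have "{s \<in> B <#>\<^bsub>G\<^esub> U. c s = \<one>} = A <#>\<^bsub>G\<^esub> U"
    using c_eq AB ker by (auto simp: set_mult_def subset_iff)
  ultimately show ?thesis by simp
qed

lemma radical_step_chain:
  assumes "radical_step\<^sup>*\<^sup>* A N" "N \<inter> U \<subseteq> A"
  shows "A \<subseteq> N \<and> (radical_extension R)\<^sup>*\<^sup>* (fixed_field (N <#>\<^bsub>G\<^esub> U)) (fixed_field (A <#>\<^bsub>G\<^esub> U))"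
  using assms
proof (induction rule: converse_rtranclp_induct)
  case base
  then show ?case by simp
next
  case (step A B)
  have AB: "A \<subseteq> B" using step.hyps(1) by (simp add: radical_step_def)
  then have IH: "B \<subseteq> N" "(radical_extension R)\<^sup>*\<^sup>* (fixed_field (N <#>\<^bsub>G\<^esub> U)) (fixed_field (B <#>\<^bsub>G\<^esub> U))"
    using step.IH step.prems by auto
  then show ?case
    using radical_step_fixed_fields[OF step.hyps(1) IH(1) step.prems] AB by auto
qed

lemma N_mult_U_subgroup: "subgroup (N <#>\<^bsub>G\<^esub> U) G"
  using mult_U_subgroup[OF N_subgroup] conjugate_in_N by (auto simp: fixer_def)

lemma in_mult_U:
  assumes "subgroup A G"
  shows "A \<subseteq> A <#>\<^bsub>G\<^esub> U" "U \<subseteq> A <#>\<^bsub>G\<^esub> U"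
proof -
  have car: "a \<in> carrier G" if "a \<in> A \<or> a \<in> U" for a
    using that subgroup.subset[OF assms] subgroup.subset[OF U_subgroup] by blast
  show "A \<subseteq> A <#>\<^bsub>G\<^esub> U"
  proof
    fix a assume a: "a \<in> A"
    then have "a = a \<otimes>\<^bsub>G\<^esub> \<one>\<^bsub>G\<^esub>" using car by simp
    then show "a \<in> A <#>\<^bsub>G\<^esub> U"
      using a subgroup.one_closed[OF U_subgroup] unfolding set_mult_def by blast
  qed
  show "U \<subseteq> A <#>\<^bsub>G\<^esub> U"
  proof
    fix u assume u: "u \<in> U"
    then have "u = \<one>\<^bsub>G\<^esub> \<otimes>\<^bsub>G\<^esub> u" using car by simp
    then show "u \<in> A <#>\<^bsub>G\<^esub> U"
      using u subgroup.one_closed[OF assms] unfolding set_mult_def by blast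
  qed
qed

lemma fixed_field_N_mult_U: "fixed_field (N <#>\<^bsub>G\<^esub> U) = F \<inter> L"
proof
  have "fixed_field (N <#>\<^bsub>G\<^esub> U) \<subseteq> fixed_field N \<inter> fixed_field U"
    using in_mult_U[OF N_subgroup] by (auto simp: fixed_field_def)
  then show "fixed_field (N <#>\<^bsub>G\<^esub> U) \<subseteq> F \<inter> L"
    using fixed_field_fixer[OF F QF] fixed_field_fixer[OF L QL] by simp
  show "F \<inter> L \<subseteq> fixed_field (N <#>\<^bsub>G\<^esub> U)"
  proof
    fix x assume x: "x \<in> F \<inter> L"
    then have xc: "x \<in> carrier R" using F_carrier by blast
    have "(n \<otimes>\<^bsub>G\<^esub> u) x = x" if "n \<in> N" "u \<in> U" for n u
      using mult_apply[of n u x] that x xc by (simp add: fixer_def)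
    then show "x \<in> fixed_field (N <#>\<^bsub>G\<^esub> U)"
      using xc by (auto simp: fixed_field_def set_mult_def)
  qed
qed

lemma intersection_subfield: "subfield (F \<inter> L) R" and Q_intersection: "Q \<subseteq> F \<inter> L"
  using fixed_field_subfield[OF subgroup.subset[OF N_mult_U_subgroup]] fixed_field_N_mult_U QF QL by auto

lemma fixer_intersection: "fixer (F \<inter> L) = N <#>\<^bsub>G\<^esub> U"
  using fixer_fixed_field[OF N_mult_U_subgroup] fixed_field_N_mult_U by simp

text \<open>
  Restriction to \<open>F\<close> has the same image on \<open>NU\<close> as on \<open>U\<close>, with fibres of size \<open>|N|\<close> and \<open>|N \<inter> U|\<close>.
\<close>

lemma card_N_mult_U: "card (N <#>\<^bsub>G\<^esub> U) * card (N \<inter> U) = card N * card U"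
proof -
  define f where "f s = restrict s F" for s :: "'a \<Rightarrow> 'a"
  have f_eq: "f s = f t \<longleftrightarrow> inv\<^bsub>G\<^esub> s \<otimes>\<^bsub>G\<^esub> t \<in> N" if st: "s \<in> carrier G" "t \<in> carrier G" for s t
  proof -
    have "(inv\<^bsub>G\<^esub> s \<otimes>\<^bsub>G\<^esub> t) x = x \<longleftrightarrow> s x = t x" if "x \<in> F" for x
    proof -
      have xc: "x \<in> carrier R" using that F_carrier by blast
      have "(inv\<^bsub>G\<^esub> s \<otimes>\<^bsub>G\<^esub> t) x = (inv\<^bsub>G\<^esub> s) (t x)" using st xc by (simp add: mult_apply)
      then show ?thesis using inv_apply[OF st(1)] G_closed[OF st(2) xc] xc by metis
    qed
    moreover have "f s = f t \<longleftrightarrow> (\<forall>x \<in> F. s x = t x)"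
      unfolding f_def by (metis restrict_apply' restrict_ext)
    ultimately show ?thesis using st by (auto simp: fixer_def)
  qed
  have NU: "N <#>\<^bsub>G\<^esub> U \<subseteq> carrier G" using subgroup.subset[OF N_mult_U_subgroup] .
  have UG: "U \<subseteq> carrier G" using subgroup.subset[OF U_subgroup] .
  have 1: "card (N <#>\<^bsub>G\<^esub> U) = card (f ` (N <#>\<^bsub>G\<^esub> U)) * card N"
    by (rule grp.card_fibres[OF N_mult_U_subgroup finite_subgroup[OF N_mult_U_subgroup] in_mult_U(1)[OF N_subgroup]])
       (use f_eq NU in blast)
  have 2: "card U = card (f ` U) * card (N \<inter> U)"
  proof (rule grp.card_fibres[OF U_subgroup finite_subgroup[OF U_subgroup]])
    fix s t assume st: "s \<in> U" "t \<in> U"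
    have "inv\<^bsub>G\<^esub> s \<otimes>\<^bsub>G\<^esub> t \<in> U"
      using st subgroup.m_closed[OF U_subgroup] subgroup.m_inv_closed[OF U_subgroup] by blast
    then show "f s = f t \<longleftrightarrow> inv\<^bsub>G\<^esub> s \<otimes>\<^bsub>G\<^esub> t \<in> N \<inter> U" using f_eq[of s t] st UG by blast
  qed simp
  have "f (n \<otimes>\<^bsub>G\<^esub> u) = f u" if nu: "n \<in> N" "u \<in> U" for n u
  proof -
    have "(n \<otimes>\<^bsub>G\<^esub> u) x = u x" if x: "x \<in> F" for x
    proof -
      have "u \<in> carrier G" "n \<in> carrier G" using nu by (auto simp: fixer_def)
      then show ?thesis
        using mult_apply[of n u x] x F_carrier abelian_subextension(1)[OF F abelian _ _ x, of u u] nu(1)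
        by (auto simp: fixer_def)
    qed
    then show ?thesis unfolding f_def by (metis restrict_ext)
  qed
  then have "f ` (N <#>\<^bsub>G\<^esub> U) = f ` U"
    using in_mult_U(2)[OF N_subgroup] by (fastforce simp: set_mult_def image_iff)
  then show ?thesis using 1 2 by simp
qed

lemma degree_intersection:
  "dim Q (F \<inter> L) * (card N * card U) = card (carrier G) * card (N \<inter> U)"
proof -
  have "dim Q (F \<inter> L) * (card N * card U) = (dim Q (F \<inter> L) * card (N <#>\<^bsub>G\<^esub> U)) * card (N \<inter> U)"
    unfolding card_N_mult_U[symmetric] by (rule mult.assoc[symmetric])
  then show ?thesis
    using degree_times_fixer[OF intersection_subfield Q_intersection] unfolding fixer_intersection by simp
qed

text \<open>
  The quotient \<open>G/W\<close> is an abelian \<open>2\<close>-group; an element \<open>g\<close> of order \<open>2\<close> in it spans a subgroup \<open>V/W\<close>, and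
  the sign character of \<open>V/W\<close> is a cocycle because \<open>-1\<close> is fixed by \<open>G\<close>.
\<close>

lemma quadratic_tower:
  assumes "subgroup W G" "N \<subseteq> W" "card (carrier G) = 2 ^ k * card W"
  shows "(radical_extension R)\<^sup>*\<^sup>* Q (fixed_field W)"
  using assms
proof (induction k arbitrary: W)
  case 0
  then have "W = carrier G"
    using card_subset_eq[OF finite_G subgroup.subset[OF 0(1)]] by simp
  then show ?case using fixed_field_carrier by simp
next
  case (Suc k)
  note W = Suc.prems(1) and NW = Suc.prems(2)
  have car: "s \<in> carrier G" if "s \<in> W" for s using that subgroup.subset[OF W] by blast
  have conj: "s \<otimes>\<^bsub>G\<^esub> w \<otimes>\<^bsub>G\<^esub> inv\<^bsub>G\<^esub> s \<in> W" if s: "s \<in> carrier G" and w: "w \<in> W" for s w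
  proof -
    have "inv\<^bsub>G\<^esub> (inv\<^bsub>G\<^esub> s) \<otimes>\<^bsub>G\<^esub> inv\<^bsub>G\<^esub> (inv\<^bsub>G\<^esub> w) \<otimes>\<^bsub>G\<^esub> inv\<^bsub>G\<^esub> s \<otimes>\<^bsub>G\<^esub> inv\<^bsub>G\<^esub> w \<in> W"
      using commutator_in_N[of "inv\<^bsub>G\<^esub> s" "inv\<^bsub>G\<^esub> w"] s car[OF w] NW by auto
    then have "(inv\<^bsub>G\<^esub> (inv\<^bsub>G\<^esub> s) \<otimes>\<^bsub>G\<^esub> inv\<^bsub>G\<^esub> (inv\<^bsub>G\<^esub> w) \<otimes>\<^bsub>G\<^esub> inv\<^bsub>G\<^esub> s \<otimes>\<^bsub>G\<^esub> inv\<^bsub>G\<^esub> w) \<otimes>\<^bsub>G\<^esub> w \<in> W"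
      using subgroup.m_closed[OF W _ w] by blast
    then show ?thesis using s car[OF w] by (simp add: grp.m_assoc)
  qed
  have normal: "W \<lhd> G" using grp.normal_inv_iff W conj by blast
  interpret Quot: group "G Mod W" using normal.factorgroup_is_group[OF normal] .
  have order: "order (G Mod W) = 2 ^ Suc k"
  proof -
    have "card (rcosets\<^bsub>G\<^esub> W) * card W = 2 ^ Suc k * card W"
      using grp.lagrange[OF W] Suc.prems(3) by (simp add: order_def)
    moreover have "card W > 0" using finite_subgroup[OF W] subgroup.one_closed[OF W] card_gt_0_iff by blast
    ultimately show ?thesis by (simp add: order_def FactGroup_def)
  qed
  have in_W_iff: "W #>\<^bsub>G\<^esub> s = W \<longleftrightarrow> s \<in> W" if "s \<in> carrier G" for s
    using that grp.coset_join1[OF _ _ W] grp.coset_join2[OF _ W] subgroup.subset[OF W] by blast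
  have "card W > 0" using finite_subgroup[OF W] subgroup.one_closed[OF W] card_gt_0_iff by blast
  then have "W \<noteq> carrier G" using Suc.prems(3) by auto
  then obtain h where h: "h \<in> carrier G" "h \<notin> W" using subgroup.subset[OF W] by blast
  have "h [^]\<^bsub>G\<^esub> ((2::nat) ^ Suc k) \<in> W"
  proof -
    have "W #>\<^bsub>G\<^esub> h \<in> carrier (G Mod W)" using h(1) by (auto simp: carrier_FactGroup)
    then have "(W #>\<^bsub>G\<^esub> h) [^]\<^bsub>G Mod W\<^esub> ((2::nat) ^ Suc k) = W"
      using Quot.pow_order_eq_1[of "W #>\<^bsub>G\<^esub> h"] order by simp
    then show ?thesis
      using normal.FactGroup_pow[OF normal h(1), of "2 ^ Suc k"] in_W_iff[of "h [^]\<^bsub>G\<^esub> ((2::nat) ^ Suc k)"] grp.nat_pow_closed[OF h(1)]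
      by metis
  qed
  then have ex: "\<exists>j. h [^]\<^bsub>G\<^esub> ((2::nat) ^ j) \<in> W" by blast
  \<comment> \<open>squaring \<open>h\<close> until it enters \<open>W\<close>; the last power outside \<open>W\<close> has order \<open>2\<close> modulo \<open>W\<close>\<close>
  define j where "j = (LEAST j. h [^]\<^bsub>G\<^esub> ((2::nat) ^ j) \<in> W)"
  have j: "h [^]\<^bsub>G\<^esub> ((2::nat) ^ j) \<in> W" "\<And>i. i < j \<Longrightarrow> h [^]\<^bsub>G\<^esub> ((2::nat) ^ i) \<notin> W"
    using LeastI_ex[OF ex] not_less_Least unfolding j_def by blast+
  have "j \<noteq> 0" using j(1) h by (auto intro: ccontr)
  then obtain i where i: "j = Suc i" using not0_implies_Suc by blast
  define g where "g = h [^]\<^bsub>G\<^esub> ((2::nat) ^ i)"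
  have g: "g \<in> carrier G" "g \<notin> W" "g \<otimes>\<^bsub>G\<^esub> g \<in> W"
  proof -
    show "g \<in> carrier G" using h(1) by (simp add: g_def)
    show "g \<notin> W" using j(2)[of i] i by (simp add: g_def)
    have "g \<otimes>\<^bsub>G\<^esub> g = h [^]\<^bsub>G\<^esub> ((2::nat) ^ j)"
      unfolding g_def i using grp.nat_pow_mult[OF h(1), of "2 ^ i" "2 ^ i"] by (simp add: mult_2)
    then show "g \<otimes>\<^bsub>G\<^esub> g \<in> W" using j(1) by simp
  qed
  have ig: "inv\<^bsub>G\<^esub> g \<in> carrier G" "inv\<^bsub>G\<^esub> g \<otimes>\<^bsub>G\<^esub> inv\<^bsub>G\<^esub> g \<in> W"
    using g(1) subgroup.m_inv_closed[OF W g(3)] by (simp_all add: grp.inv_mult_group)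
  note Wm = subgroup.m_closed[OF W] and Wi = subgroup.m_inv_closed[OF W]
  have conj': "inv\<^bsub>G\<^esub> g \<otimes>\<^bsub>G\<^esub> w \<otimes>\<^bsub>G\<^esub> g \<in> W" if "w \<in> W" for w
    using conj[OF ig(1) that] g(1) by simp
  define V where "V = {s \<in> carrier G. s \<in> W \<or> s \<otimes>\<^bsub>G\<^esub> g \<in> W}"
  have WV: "W \<subseteq> V" using car by (auto simp: V_def)
  have V: "subgroup V G"
  proof (rule grp.subgroupI)
    show "V \<subseteq> carrier G" by (auto simp: V_def)
    show "V \<noteq> {}" using WV subgroup.one_closed[OF W] by blast
    show "inv\<^bsub>G\<^esub> s \<in> V" if "s \<in> V" for s
    proof (cases "s \<in> W")
      case True
      then show ?thesis using Wi WV by blast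
    next
      case False
      then have s: "s \<in> carrier G" "s \<otimes>\<^bsub>G\<^esub> g \<in> W" using that by (auto simp: V_def)
      have "(g \<otimes>\<^bsub>G\<^esub> inv\<^bsub>G\<^esub> (s \<otimes>\<^bsub>G\<^esub> g) \<otimes>\<^bsub>G\<^esub> inv\<^bsub>G\<^esub> g) \<otimes>\<^bsub>G\<^esub> (g \<otimes>\<^bsub>G\<^esub> g) \<in> W"
        using Wm conj[OF g(1)] Wi s(2) g(3) by blast
      then have "inv\<^bsub>G\<^esub> s \<otimes>\<^bsub>G\<^esub> g \<in> W"
        using s(1) g(1) by (simp add: grp.m_assoc grp.inv_mult_group) (simp add: grp.m_assoc[symmetric])
      then show ?thesis using s(1) by (simp add: V_def)
    qed
    show "s \<otimes>\<^bsub>G\<^esub> t \<in> V" if st: "s \<in> V" "t \<in> V" for s t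
    proof -
      have c: "s \<in> carrier G" "t \<in> carrier G" using st by (auto simp: V_def)
      consider "s \<in> W" "t \<in> W" | "s \<in> W" "t \<otimes>\<^bsub>G\<^esub> g \<in> W" | "s \<otimes>\<^bsub>G\<^esub> g \<in> W" "t \<in> W"
        | "s \<otimes>\<^bsub>G\<^esub> g \<in> W" "t \<otimes>\<^bsub>G\<^esub> g \<in> W" using st by (auto simp: V_def)
      then show ?thesis
      proof cases
        case 1
        then show ?thesis using Wm WV by blast
      next
        case 2
        then have "s \<otimes>\<^bsub>G\<^esub> (t \<otimes>\<^bsub>G\<^esub> g) \<in> W" using Wm by blast
        then show ?thesis using c g(1) by (simp add: V_def grp.m_assoc)
      next
        case 3
        then have "(s \<otimes>\<^bsub>G\<^esub> g) \<otimes>\<^bsub>G\<^esub> (inv\<^bsub>G\<^esub> g \<otimes>\<^bsub>G\<^esub> t \<otimes>\<^bsub>G\<^esub> g) \<in> W" using Wm conj' by blast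
        moreover have "(s \<otimes>\<^bsub>G\<^esub> g) \<otimes>\<^bsub>G\<^esub> (inv\<^bsub>G\<^esub> g \<otimes>\<^bsub>G\<^esub> t \<otimes>\<^bsub>G\<^esub> g) = s \<otimes>\<^bsub>G\<^esub> t \<otimes>\<^bsub>G\<^esub> g"
        proof -
          have "g \<otimes>\<^bsub>G\<^esub> (inv\<^bsub>G\<^esub> g \<otimes>\<^bsub>G\<^esub> (t \<otimes>\<^bsub>G\<^esub> g)) = t \<otimes>\<^bsub>G\<^esub> g"
            using c g(1) by (simp add: grp.m_assoc[symmetric])
          then show ?thesis using c g(1) by (simp add: grp.m_assoc)
        qed
        ultimately show ?thesis using c by (simp add: V_def)
      next
        case 4
        then have "(s \<otimes>\<^bsub>G\<^esub> g) \<otimes>\<^bsub>G\<^esub> ((inv\<^bsub>G\<^esub> g \<otimes>\<^bsub>G\<^esub> (t \<otimes>\<^bsub>G\<^esub> g) \<otimes>\<^bsub>G\<^esub> g) \<otimes>\<^bsub>G\<^esub> (inv\<^bsub>G\<^esub> g \<otimes>\<^bsub>G\<^esub> inv\<^bsub>G\<^esub> g)) \<in> W"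
          using Wm conj' ig(2) by blast
        moreover have "(s \<otimes>\<^bsub>G\<^esub> g) \<otimes>\<^bsub>G\<^esub> ((inv\<^bsub>G\<^esub> g \<otimes>\<^bsub>G\<^esub> (t \<otimes>\<^bsub>G\<^esub> g) \<otimes>\<^bsub>G\<^esub> g) \<otimes>\<^bsub>G\<^esub> (inv\<^bsub>G\<^esub> g \<otimes>\<^bsub>G\<^esub> inv\<^bsub>G\<^esub> g)) = s \<otimes>\<^bsub>G\<^esub> t"
        proof -
          have cancel: "x \<otimes>\<^bsub>G\<^esub> (inv\<^bsub>G\<^esub> x \<otimes>\<^bsub>G\<^esub> y) = y" if "x \<in> carrier G" "y \<in> carrier G" for x y
            using that by (simp add: grp.m_assoc[symmetric])
          show ?thesis using c g(1) ig(1) by (simp add: grp.m_assoc cancel)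
        qed
        ultimately show ?thesis using WV by auto
      qed
    qed
  qed
  have same_side: "(s \<in> W) = (t \<in> W) \<longleftrightarrow> inv\<^bsub>G\<^esub> s \<otimes>\<^bsub>G\<^esub> t \<in> W" if st: "s \<in> V" "t \<in> V" for s t
  proof -
    have c: "s \<in> carrier G" "t \<in> carrier G" using st by (auto simp: V_def)
    have prod: "s \<otimes>\<^bsub>G\<^esub> (inv\<^bsub>G\<^esub> s \<otimes>\<^bsub>G\<^esub> t) = t" using c by (simp add: grp.m_assoc[symmetric])
    have prod': "t \<otimes>\<^bsub>G\<^esub> inv\<^bsub>G\<^esub> (inv\<^bsub>G\<^esub> s \<otimes>\<^bsub>G\<^esub> t) = s"
      using c by (simp add: grp.inv_mult_group grp.m_assoc[symmetric])
    show ?thesis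
    proof
      assume "inv\<^bsub>G\<^esub> s \<otimes>\<^bsub>G\<^esub> t \<in> W"
      then show "(s \<in> W) = (t \<in> W)" using Wm Wi prod prod' by metis
    next
      assume eq: "(s \<in> W) = (t \<in> W)"
      show "inv\<^bsub>G\<^esub> s \<otimes>\<^bsub>G\<^esub> t \<in> W"
      proof (cases "s \<in> W")
        case True
        then show ?thesis using eq Wm Wi by blast
      next
        case False
        then have "s \<otimes>\<^bsub>G\<^esub> g \<in> W" "t \<otimes>\<^bsub>G\<^esub> g \<in> W" using eq st by (auto simp: V_def)
        then have "g \<otimes>\<^bsub>G\<^esub> (inv\<^bsub>G\<^esub> (s \<otimes>\<^bsub>G\<^esub> g) \<otimes>\<^bsub>G\<^esub> (t \<otimes>\<^bsub>G\<^esub> g)) \<otimes>\<^bsub>G\<^esub> inv\<^bsub>G\<^esub> g \<in> W"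
          using conj[OF g(1)] Wm Wi by blast
        moreover have "g \<otimes>\<^bsub>G\<^esub> (inv\<^bsub>G\<^esub> (s \<otimes>\<^bsub>G\<^esub> g) \<otimes>\<^bsub>G\<^esub> (t \<otimes>\<^bsub>G\<^esub> g)) \<otimes>\<^bsub>G\<^esub> inv\<^bsub>G\<^esub> g = inv\<^bsub>G\<^esub> s \<otimes>\<^bsub>G\<^esub> t"
        proof -
          have cancel: "x \<otimes>\<^bsub>G\<^esub> (inv\<^bsub>G\<^esub> x \<otimes>\<^bsub>G\<^esub> y) = y" if "x \<in> carrier G" "y \<in> carrier G" for x y
            using that by (simp add: grp.m_assoc[symmetric])
          show ?thesis using c g(1) ig(1) by (simp add: grp.m_assoc grp.inv_mult_group cancel)
        qed
        ultimately show ?thesis by simp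
      qed
    qed
  qed
  have "inv\<^bsub>G\<^esub> g \<in> V" using ig(1) g(1) subgroup.one_closed[OF W] by (simp add: V_def)
  moreover have "inv\<^bsub>G\<^esub> g \<notin> W" using Wi g(1,2) grp.inv_inv by metis
  ultimately have "(\<lambda>s. s \<in> W) ` V = {True, False}"
    using WV subgroup.one_closed[OF W] by blast
  moreover have "card V = card ((\<lambda>s. s \<in> W) ` V) * card W"
    by (rule grp.card_fibres[OF V finite_subgroup[OF V] WV]) (use same_side in auto)
  ultimately have cardV: "card V = 2 * card W" by simp
  then have "(radical_extension R)\<^sup>*\<^sup>* Q (fixed_field V)"
    using Suc.IH[OF V] NW WV Suc.prems(3) by simp
  moreover have "radical_extension R (fixed_field V) (fixed_field W)"
  proof -
    define c where "c s = (if s \<in> W then \<one> else \<ominus> \<one>)" for s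
    have minus_one: "\<ominus> \<one> \<noteq> \<one>"
    proof
      assume "\<ominus> \<one> = \<one>"
      then have "\<one> \<oplus> \<one> = \<zero>" using r_neg[OF one_closed] by simp
      then show False using char_zero[of 2] by (simp add: numeral_2_eq_2)
    qed
    have "radical_extension R (fixed_field V) (fixed_field {s \<in> V. c s = \<one>})"
    proof (rule kummer_radical[OF V])
      show "c (s \<otimes>\<^bsub>G\<^esub> t) = c s \<otimes> s (c t)" if st: "s \<in> V" "t \<in> V" for s t
      proof -
        have c: "s \<in> carrier G" using st by (auto simp: V_def)
        have "s \<otimes>\<^bsub>G\<^esub> t \<in> W \<longleftrightarrow> (inv\<^bsub>G\<^esub> s \<in> W) = (t \<in> W)"
          using same_side[OF subgroup.m_inv_closed[OF V st(1)] st(2)] c by simp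
        also have "inv\<^bsub>G\<^esub> s \<in> W \<longleftrightarrow> s \<in> W" using Wi c grp.inv_inv by metis
        finally have iff: "s \<otimes>\<^bsub>G\<^esub> t \<in> W \<longleftrightarrow> (s \<in> W) = (t \<in> W)" .
        have "s (\<ominus> \<one>) = \<ominus> \<one>" using G_minus[OF c one_closed] c by simp
        then have "s (c t) = c t" using c by (simp add: c_def)
        then show ?thesis using iff by (simp add: c_def l_minus)
      qed
      show "c s [^] (2::nat) = \<one>" for s
        by (simp add: c_def numeral_2_eq_2 l_minus)
    qed (auto simp: c_def)
    moreover have "{s \<in> V. c s = \<one>} = W" using WV minus_one by (auto simp: c_def)
    ultimately show ?thesis by simp
  qed
  ultimately show ?case by (rule rtranclp.rtrancl_into_rtrancl)
qed

lemma chain_imp_radical_tower: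
  assumes chain: "radical_step\<^sup>*\<^sup>* (N \<inter> U) N" and deg: "dim Q (F \<inter> L) = 2 ^ k"
  shows "(radical_extension R)\<^sup>*\<^sup>* Q L"
proof -
  have "card (carrier G) = 2 ^ k * card (N <#>\<^bsub>G\<^esub> U)"
    using degree_times_fixer[OF intersection_subfield Q_intersection] deg by (simp add: fixer_intersection)
  then have "(radical_extension R)\<^sup>*\<^sup>* Q (fixed_field (N <#>\<^bsub>G\<^esub> U))"
    using quadratic_tower[OF N_mult_U_subgroup in_mult_U(1)[OF N_subgroup]] by blast
  also have "(radical_extension R)\<^sup>*\<^sup>* (fixed_field (N <#>\<^bsub>G\<^esub> U)) (fixed_field ((N \<inter> U) <#>\<^bsub>G\<^esub> U))"
    using radical_step_chain[OF chain] by blast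
  also have "(N \<inter> U) <#>\<^bsub>G\<^esub> U = U"
  proof
    show "(N \<inter> U) <#>\<^bsub>G\<^esub> U \<subseteq> U"
      using subgroup.m_closed[OF U_subgroup] by (auto simp: set_mult_def)
    show "U \<subseteq> (N \<inter> U) <#>\<^bsub>G\<^esub> U"
      using in_mult_U(2) grp.subgroups_Inter_pair N_subgroup U_subgroup by blast
  qed
  also have "fixed_field U = L" using fixed_field_fixer[OF L QL] .
  finally show ?thesis .
qed

end

section \<open>Factors as U-groups\<close>

text \<open>
  The inverse of \<open>u\<close> acts by the inverse map, so bijectivity follows from the other conditions.
\<close>

lemma U_groupI:
  assumes "group U" "group K"
    and ext: "\<And>u. u \<in> carrier U \<Longrightarrow> \<phi> u \<in> extensional (carrier K)"
    and closed: "\<And>u x. u \<in> carrier U \<Longrightarrow> x \<in> carrier K \<Longrightarrow> \<phi> u x \<in> carrier K"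
    and hom: "\<And>u x y. u \<in> carrier U \<Longrightarrow> x \<in> carrier K \<Longrightarrow> y \<in> carrier K
      \<Longrightarrow> \<phi> u (x \<otimes>\<^bsub>K\<^esub> y) = \<phi> u x \<otimes>\<^bsub>K\<^esub> \<phi> u y"
    and comp: "\<And>u v x. u \<in> carrier U \<Longrightarrow> v \<in> carrier U \<Longrightarrow> x \<in> carrier K
      \<Longrightarrow> \<phi> (u \<otimes>\<^bsub>U\<^esub> v) x = \<phi> u (\<phi> v x)"
    and one: "\<And>x. x \<in> carrier K \<Longrightarrow> \<phi> \<one>\<^bsub>U\<^esub> x = x"
  shows "U_group U K \<phi>"
proof -
  interpret U: group U by (rule assms(1))
  have inv: "\<phi> (inv\<^bsub>U\<^esub> u) (\<phi> u x) = x" "\<phi> u (\<phi> (inv\<^bsub>U\<^esub> u) x) = x"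
    if "u \<in> carrier U" "x \<in> carrier K" for u x
    using comp[of "inv\<^bsub>U\<^esub> u" u x] comp[of u "inv\<^bsub>U\<^esub> u" x] one that by simp_all
  have Bij: "\<phi> u \<in> Bij (carrier K)" if "u \<in> carrier U" for u
  proof -
    have "bij_betw (\<phi> u) (carrier K) (carrier K)"
      using that inv closed by (intro bij_betwI[where g = "\<phi> (inv\<^bsub>U\<^esub> u)"]) auto
    then show ?thesis using ext[OF that] by (simp add: Bij_def)
  qed
  have auto: "\<phi> u \<in> auto K" if "u \<in> carrier U" for u
    using Bij[OF that] closed hom that by (auto simp: auto_def hom_def)
  have "\<phi> \<in> hom U (AutoGroup K)"
  proof (rule homI)
    show "\<phi> u \<in> carrier (AutoGroup K)" if "u \<in> carrier U" for u
      using auto[OF that] by (simp add: AutoGroup_def)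
    show "\<phi> (u \<otimes>\<^bsub>U\<^esub> v) = \<phi> u \<otimes>\<^bsub>AutoGroup K\<^esub> \<phi> v" if uv: "u \<in> carrier U" "v \<in> carrier U" for u v
    proof -
      have "\<phi> (u \<otimes>\<^bsub>U\<^esub> v) = compose (carrier K) (\<phi> u) (\<phi> v)"
        using uv ext comp by (intro extensionalityI[where A = "carrier K"]) (auto simp: compose_def)
      then show ?thesis using Bij uv by (simp add: AutoGroup_def BijGroup_def)
    qed
  qed
  then show ?thesis using assms(1,2) by (simp add: U_group_def)
qed

context quasireal_subextension
begin

lemma U_invariant_iff:
  assumes H: "subgroup H G"
  shows "U_invariant G U H \<longleftrightarrow> (\<forall>u \<in> U. \<forall>h \<in> H. u \<otimes>\<^bsub>G\<^esub> h \<otimes>\<^bsub>G\<^esub> inv\<^bsub>G\<^esub> u \<in> H)"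
proof
  show "\<forall>u \<in> U. \<forall>h \<in> H. u \<otimes>\<^bsub>G\<^esub> h \<otimes>\<^bsub>G\<^esub> inv\<^bsub>G\<^esub> u \<in> H" if "U_invariant G U H"
    using that unfolding U_invariant_def l_coset_def r_coset_def by blast
next
  assume inv: "\<forall>u \<in> U. \<forall>h \<in> H. u \<otimes>\<^bsub>G\<^esub> h \<otimes>\<^bsub>G\<^esub> inv\<^bsub>G\<^esub> u \<in> H"
  show "U_invariant G U H"
    unfolding U_invariant_def
  proof
    fix u assume u: "u \<in> U"
    then have uG: "u \<in> carrier G" by (simp add: fixer_def)
    have "h \<in> u <#\<^bsub>G\<^esub> H #>\<^bsub>G\<^esub> inv\<^bsub>G\<^esub> u" if h: "h \<in> H" for h
    proof -
      have hG: "h \<in> carrier G" using h subgroup.subset[OF H] by blast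
      have "inv\<^bsub>G\<^esub> u \<otimes>\<^bsub>G\<^esub> h \<otimes>\<^bsub>G\<^esub> inv\<^bsub>G\<^esub> (inv\<^bsub>G\<^esub> u) \<in> H"
        using inv subgroup.m_inv_closed[OF U_subgroup u] h by blast
      moreover have "u \<otimes>\<^bsub>G\<^esub> (inv\<^bsub>G\<^esub> u \<otimes>\<^bsub>G\<^esub> h \<otimes>\<^bsub>G\<^esub> inv\<^bsub>G\<^esub> (inv\<^bsub>G\<^esub> u)) \<otimes>\<^bsub>G\<^esub> inv\<^bsub>G\<^esub> u = h"
      proof -
        have "u \<otimes>\<^bsub>G\<^esub> (inv\<^bsub>G\<^esub> u \<otimes>\<^bsub>G\<^esub> h) = h"
          using uG hG by (simp add: grp.m_assoc[symmetric])
        then show ?thesis using uG hG by (simp add: grp.m_assoc)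
      qed
      ultimately show ?thesis unfolding l_coset_def r_coset_def by (metis (mono_tags, lifting) UN_I insertI1)
    qed
    then show "u <#\<^bsub>G\<^esub> H #>\<^bsub>G\<^esub> inv\<^bsub>G\<^esub> u = H"
      using inv u unfolding l_coset_def r_coset_def by blast
  qed
qed

lemma conjugate_coset:
  assumes A: "subgroup A G" and inv: "U_invariant G U A" and u: "u \<in> U" and b: "b \<in> carrier G"
  shows "u <#\<^bsub>G\<^esub> (A #>\<^bsub>G\<^esub> b) #>\<^bsub>G\<^esub> inv\<^bsub>G\<^esub> u = A #>\<^bsub>G\<^esub> (u \<otimes>\<^bsub>G\<^esub> b \<otimes>\<^bsub>G\<^esub> inv\<^bsub>G\<^esub> u)"
proof -
  have uG: "u \<in> carrier G" using u by (simp add: fixer_def)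
  have AG: "A \<subseteq> carrier G" using subgroup.subset[OF A] .
  have uAG: "u <#\<^bsub>G\<^esub> A \<subseteq> carrier G" using grp.l_coset_subset_G[OF AG uG] .
  have "u <#\<^bsub>G\<^esub> (A #>\<^bsub>G\<^esub> b) #>\<^bsub>G\<^esub> inv\<^bsub>G\<^esub> u = (u <#\<^bsub>G\<^esub> A) #>\<^bsub>G\<^esub> (b \<otimes>\<^bsub>G\<^esub> inv\<^bsub>G\<^esub> u)"
    using grp.coset_assoc[OF uG b AG] grp.coset_mult_assoc[OF uAG b, of "inv\<^bsub>G\<^esub> u"] uG by simp
  also have "u <#\<^bsub>G\<^esub> A = A #>\<^bsub>G\<^esub> u"
  proof -
    have "(u <#\<^bsub>G\<^esub> A) #>\<^bsub>G\<^esub> inv\<^bsub>G\<^esub> u #>\<^bsub>G\<^esub> u = A #>\<^bsub>G\<^esub> u"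
      using inv u unfolding U_invariant_def by simp
    then show ?thesis
      using grp.coset_mult_assoc[OF uAG, of "inv\<^bsub>G\<^esub> u" u] uG uAG by simp
  qed
  also have "(A #>\<^bsub>G\<^esub> u) #>\<^bsub>G\<^esub> (b \<otimes>\<^bsub>G\<^esub> inv\<^bsub>G\<^esub> u) = A #>\<^bsub>G\<^esub> (u \<otimes>\<^bsub>G\<^esub> b \<otimes>\<^bsub>G\<^esub> inv\<^bsub>G\<^esub> u)"
    using grp.coset_mult_assoc[OF AG uG, of "b \<otimes>\<^bsub>G\<^esub> inv\<^bsub>G\<^esub> u"] uG b by (simp add: grp.m_assoc)
  finally show ?thesis .
qed

lemma subgroup_index_mult:
  assumes "subgroup A G" "subgroup B G" "A \<subseteq> B"
  shows "subgroup_index G B A * card A = card B"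
proof -
  have "group (G\<lparr>carrier := B\<rparr>)" using subgroup.subgroup_is_group[OF assms(2) grp.group_axioms] .
  moreover have "subgroup A (G\<lparr>carrier := B\<rparr>)" using grp.subgroup_incl[OF assms] .
  ultimately show ?thesis
    unfolding subgroup_index_def using group.lagrange by (fastforce simp: order_def)
qed

lemma factor_U_group:
  assumes A: "subgroup A G" and B: "subgroup B G"
    and invA: "U_invariant G U A" and invB: "U_invariant G U B"
    and normal: "A \<lhd> G\<lparr>carrier := B\<rparr>"
  shows "U_group (Gal R L) (G\<lparr>carrier := B\<rparr> Mod A) (conj_action G (carrier (G\<lparr>carrier := B\<rparr> Mod A)))"
    and "\<And>u b. u \<in> U \<Longrightarrow> b \<in> B \<Longrightarrow>
      conj_action G (carrier (G\<lparr>carrier := B\<rparr> Mod A)) u (A #>\<^bsub>G\<^esub> b) = A #>\<^bsub>G\<^esub> (u \<otimes>\<^bsub>G\<^esub> b \<otimes>\<^bsub>G\<^esub> inv\<^bsub>G\<^esub> u)"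
proof -
  let ?K = "G\<lparr>carrier := B\<rparr> Mod A"
  have carK: "carrier ?K = (\<lambda>b. A #>\<^bsub>G\<^esub> b) ` B"
    by (auto simp: carrier_FactGroup r_coset_def)
  have multK: "(A #>\<^bsub>G\<^esub> b) \<otimes>\<^bsub>?K\<^esub> (A #>\<^bsub>G\<^esub> c) = A #>\<^bsub>G\<^esub> (b \<otimes>\<^bsub>G\<^esub> c)" if "b \<in> B" "c \<in> B" for b c
    using normal.rcos_sum[OF normal, of b c] that by (simp add: r_coset_def)
  have BG: "b \<in> carrier G" if "b \<in> B" for b using that subgroup.subset[OF B] by blast
  have UG: "u \<in> carrier G" if "u \<in> U" for u using that by (simp add: fixer_def)
  have B_conj: "u \<otimes>\<^bsub>G\<^esub> b \<otimes>\<^bsub>G\<^esub> inv\<^bsub>G\<^esub> u \<in> B" if "u \<in> U" "b \<in> B" for u b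
    using invB U_invariant_iff[OF B] that by blast
  have act: "conj_action G (carrier ?K) u (A #>\<^bsub>G\<^esub> b) = A #>\<^bsub>G\<^esub> (u \<otimes>\<^bsub>G\<^esub> b \<otimes>\<^bsub>G\<^esub> inv\<^bsub>G\<^esub> u)"
    if "u \<in> U" "b \<in> B" for u b
    using conjugate_coset[OF A invA that(1) BG[OF that(2)]] that(2) by (simp add: conj_action_def carK)
  then show "\<And>u b. u \<in> U \<Longrightarrow> b \<in> B \<Longrightarrow>
      conj_action G (carrier ?K) u (A #>\<^bsub>G\<^esub> b) = A #>\<^bsub>G\<^esub> (u \<otimes>\<^bsub>G\<^esub> b \<otimes>\<^bsub>G\<^esub> inv\<^bsub>G\<^esub> u)" by blast
  show "U_group (Gal R L) ?K (conj_action G (carrier ?K))"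
    unfolding Gal_fixer[OF QL]
  proof (rule U_groupI)
    show "group (G\<lparr>carrier := U\<rparr>)" using subgroup.subgroup_is_group[OF U_subgroup grp.group_axioms] .
    show "group ?K" using normal.factorgroup_is_group[OF normal] .
    show "conj_action G (carrier ?K) u \<in> extensional (carrier ?K)" for u
      by (simp add: conj_action_def)
    fix x assume "x \<in> carrier ?K"
    then obtain b where b: "b \<in> B" "x = A #>\<^bsub>G\<^esub> b" using carK by auto
    show "conj_action G (carrier ?K) u x \<in> carrier ?K" if "u \<in> carrier (G\<lparr>carrier := U\<rparr>)" for u
      using act b B_conj carK that by auto
    show "conj_action G (carrier ?K) \<one>\<^bsub>G\<lparr>carrier := U\<rparr>\<^esub> x = x"
      using act[OF subgroup.one_closed[OF U_subgroup] b(1)] b BG by simp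
    show "conj_action G (carrier ?K) (u \<otimes>\<^bsub>G\<lparr>carrier := U\<rparr>\<^esub> v) x
        = conj_action G (carrier ?K) u (conj_action G (carrier ?K) v x)"
      if uv: "u \<in> carrier (G\<lparr>carrier := U\<rparr>)" "v \<in> carrier (G\<lparr>carrier := U\<rparr>)" for u v
    proof -
      have uvU: "u \<in> U" "v \<in> U" using uv by simp_all
      have "u \<otimes>\<^bsub>G\<^esub> v \<otimes>\<^bsub>G\<^esub> b \<otimes>\<^bsub>G\<^esub> inv\<^bsub>G\<^esub> (u \<otimes>\<^bsub>G\<^esub> v)
          = u \<otimes>\<^bsub>G\<^esub> (v \<otimes>\<^bsub>G\<^esub> b \<otimes>\<^bsub>G\<^esub> inv\<^bsub>G\<^esub> v) \<otimes>\<^bsub>G\<^esub> inv\<^bsub>G\<^esub> u"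
        using UG[OF uvU(1)] UG[OF uvU(2)] BG[OF b(1)] by (simp add: grp.m_assoc grp.inv_mult_group)
      then show ?thesis
        using act[OF subgroup.m_closed[OF U_subgroup uvU] b(1)] act[OF uvU(2) b(1)]
          act[OF uvU(1) B_conj[OF uvU(2) b(1)]] b(2) by simp
    qed
    fix y assume "y \<in> carrier ?K"
    then obtain c where c: "c \<in> B" "y = A #>\<^bsub>G\<^esub> c" using carK by auto
    show "conj_action G (carrier ?K) u (x \<otimes>\<^bsub>?K\<^esub> y)
        = conj_action G (carrier ?K) u x \<otimes>\<^bsub>?K\<^esub> conj_action G (carrier ?K) u y"
      if "u \<in> carrier (G\<lparr>carrier := U\<rparr>)" for u
    proof -
      have u: "u \<in> U" using that by simp
      have "u \<otimes>\<^bsub>G\<^esub> (b \<otimes>\<^bsub>G\<^esub> c) \<otimes>\<^bsub>G\<^esub> inv\<^bsub>G\<^esub> u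
          = (u \<otimes>\<^bsub>G\<^esub> b \<otimes>\<^bsub>G\<^esub> inv\<^bsub>G\<^esub> u) \<otimes>\<^bsub>G\<^esub> (u \<otimes>\<^bsub>G\<^esub> c \<otimes>\<^bsub>G\<^esub> inv\<^bsub>G\<^esub> u)"
      proof -
        have "inv\<^bsub>G\<^esub> u \<otimes>\<^bsub>G\<^esub> (u \<otimes>\<^bsub>G\<^esub> (c \<otimes>\<^bsub>G\<^esub> inv\<^bsub>G\<^esub> u)) = c \<otimes>\<^bsub>G\<^esub> inv\<^bsub>G\<^esub> u"
          using UG[OF u] BG[OF c(1)] by (simp add: grp.m_assoc[symmetric])
        then show ?thesis
          using UG[OF u] BG[OF b(1)] BG[OF c(1)] by (simp add: grp.m_assoc)
      qed
      then show ?thesis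
        using act[OF u b(1)] act[OF u c(1)] act[OF u subgroup.m_closed[OF B b(1) c(1)]]
          multK[OF b(1) c(1)] multK[OF B_conj[OF u b(1)] B_conj[OF u c(1)]] b(2) c(2)
        by (simp del: mult_FactGroup)
    qed
  qed
qed

lemma roots_U_group:
  assumes C: "subgroup C (Multiplicative_Group.mult_of R)"
    and stable: "\<And>u x. u \<in> U \<Longrightarrow> x \<in> C \<Longrightarrow> u x \<in> C"
  shows "U_group (Gal R L) ((Multiplicative_Group.mult_of R)\<lparr>carrier := C\<rparr>) (galois_action C)"
  unfolding Gal_fixer[OF QL]
proof (rule U_groupI)
  have CR: "x \<in> carrier R" if "x \<in> C" for x using that subgroup.subset[OF C] by auto
  have UG: "u \<in> carrier G" if "u \<in> U" for u using that by (simp add: fixer_def)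
  show "group (G\<lparr>carrier := U\<rparr>)" using subgroup.subgroup_is_group[OF U_subgroup grp.group_axioms] .
  show "group ((Multiplicative_Group.mult_of R)\<lparr>carrier := C\<rparr>)"
    using subgroup.subgroup_is_group[OF C field_mult_group] .
  show "galois_action C u \<in> extensional (carrier ((Multiplicative_Group.mult_of R)\<lparr>carrier := C\<rparr>))" for u
    by (simp add: galois_action_def)
  fix x assume "x \<in> carrier ((Multiplicative_Group.mult_of R)\<lparr>carrier := C\<rparr>)"
  then have x: "x \<in> C" by simp
  show "galois_action C u x \<in> carrier ((Multiplicative_Group.mult_of R)\<lparr>carrier := C\<rparr>)"
    if "u \<in> carrier (G\<lparr>carrier := U\<rparr>)" for u
    using x stable that by (simp add: galois_action_def)
  show "galois_action C \<one>\<^bsub>G\<lparr>carrier := U\<rparr>\<^esub> x = x"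
    using x CR one_apply by (simp add: galois_action_def)
  show "galois_action C (u \<otimes>\<^bsub>G\<lparr>carrier := U\<rparr>\<^esub> v) x = galois_action C u (galois_action C v x)"
    if "u \<in> carrier (G\<lparr>carrier := U\<rparr>)" "v \<in> carrier (G\<lparr>carrier := U\<rparr>)" for u v
    using x stable that CR[OF x] mult_apply[of u v x] UG by (simp add: galois_action_def)
  fix y assume "y \<in> carrier ((Multiplicative_Group.mult_of R)\<lparr>carrier := C\<rparr>)"
  then have y: "y \<in> C" by simp
  have xy: "x \<otimes> y \<in> C" using subgroup.m_closed[OF C x y] by (simp add: Multiplicative_Group.mult_mult_of)
  show "galois_action C u (x \<otimes>\<^bsub>(Multiplicative_Group.mult_of R)\<lparr>carrier := C\<rparr>\<^esub> y)
      = galois_action C u x \<otimes>\<^bsub>(Multiplicative_Group.mult_of R)\<lparr>carrier := C\<rparr>\<^esub> galois_action C u y"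
    if "u \<in> carrier (G\<lparr>carrier := U\<rparr>)" for u
    using x y xy that G_mult[OF UG CR[OF x] CR[OF y], of u]
    by (simp add: galois_action_def Multiplicative_Group.mult_mult_of)
qed

text \<open>
  From left to right, \<open>C\<close> is the image of \<open>\<chi>\<close> and the isomorphism comes from the first isomorphism
  theorem.
\<close>

lemma radical_step_iff:
  "radical_step A B \<longleftrightarrow> subgroup A G \<and> subgroup B G \<and> U_invariant G U A \<and> U_invariant G U B \<and> A \<subseteq> B
    \<and> Factorial_Ring.prime (subgroup_index G B A) \<and> A \<lhd> G\<lparr>carrier := B\<rparr>
    \<and> (\<exists>C. subgroup C (Multiplicative_Group.mult_of R)
        \<and> U_isomorphic (Gal R L)
            (G\<lparr>carrier := B\<rparr> Mod A)
            (conj_action G (carrier (G\<lparr>carrier := B\<rparr> Mod A)))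
            ((Multiplicative_Group.mult_of R)\<lparr>carrier := C\<rparr>)
            (galois_action C))"
  (is "?step \<longleftrightarrow> ?factor")
proof
  assume step: ?step
  have A: "subgroup A G" and B: "subgroup B G" and AB: "A \<subseteq> B"
    and invA: "U_invariant G U A" and invB: "U_invariant G U B"
    using step U_invariant_iff by (auto simp: radical_step_def)
  obtain p where p: "Factorial_Ring.prime (p::nat)" "card B = p * card A"
    using step unfolding radical_step_def by blast
  obtain \<chi> where \<chi>: "(\<forall>b \<in> B. \<chi> b \<in> carrier R - {\<zero>})
      \<and> (\<forall>b \<in> B. \<forall>c \<in> B. \<chi> (b \<otimes>\<^bsub>G\<^esub> c) = \<chi> b \<otimes> \<chi> c)
      \<and> A = {b \<in> B. \<chi> b = \<one>}
      \<and> (\<forall>u \<in> U. \<forall>b \<in> B. \<chi> (u \<otimes>\<^bsub>G\<^esub> b \<otimes>\<^bsub>G\<^esub> inv\<^bsub>G\<^esub> u) = u (\<chi> b))"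
    using step unfolding radical_step_def by (elim conjE) (erule exE)
  let ?GB = "G\<lparr>carrier := B\<rparr>" and ?M = "Multiplicative_Group.mult_of R" and ?C = "\<chi> ` B"
  have cardA: "card A > 0"
    using finite_subgroup[OF A] subgroup.one_closed[OF A] card_gt_0_iff by blast
  have "subgroup_index G B A = p"
    using subgroup_index_mult[OF A B AB] p(2) cardA by simp
  have grpB: "group ?GB" using subgroup.subgroup_is_group[OF B grp.group_axioms] .
  have hom: "\<chi> \<in> hom ?GB ?M"
    using \<chi> by (auto simp: hom_def Multiplicative_Group.mult_mult_of)
  interpret \<chi>M: group_hom ?GB ?M \<chi>
    using grpB field_mult_group hom by (simp add: group_hom_def group_hom_axioms_def)
  have C: "subgroup ?C ?M" using \<chi>M.img_is_subgroup by simp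
  interpret \<chi>C: group_hom ?GB "?M\<lparr>carrier := ?C\<rparr>" \<chi>
    using grpB subgroup.subgroup_is_group[OF C field_mult_group] hom
    by (auto simp: group_hom_def group_hom_axioms_def hom_def)
  have ker: "kernel ?GB (?M\<lparr>carrier := ?C\<rparr>) \<chi> = A"
    using \<chi> by (auto simp: kernel_def)
  have normal: "A \<lhd> ?GB" using \<chi>C.normal_kernel unfolding ker .
  define f where "f S = the_elem (\<chi> ` S)" for S
  have f_iso: "f \<in> iso (?GB Mod A) (?M\<lparr>carrier := ?C\<rparr>)"
    using \<chi>C.FactGroup_iso_set unfolding ker f_def by simp
  have BG: "b \<in> carrier G" if "b \<in> B" for b using that subgroup.subset[OF B] by blast
  have f_coset: "f (A #>\<^bsub>G\<^esub> b) = \<chi> b" if b: "b \<in> B" for b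
  proof -
    have "\<chi> (a \<otimes>\<^bsub>G\<^esub> b) = \<chi> b" if "a \<in> A" for a
    proof -
      have "a \<in> B" "\<chi> a = \<one>" using \<chi> that by blast+
      then show ?thesis using \<chi> b by simp
    qed
    then have "(\<lambda>a. \<chi> (a \<otimes>\<^bsub>G\<^esub> b)) ` A = {\<chi> b}"
      using subgroup.one_closed[OF A] by auto
    moreover have "\<chi> ` (A #>\<^bsub>G\<^esub> b) = (\<lambda>a. \<chi> (a \<otimes>\<^bsub>G\<^esub> b)) ` A"
      by (auto simp: r_coset_def)
    ultimately have "\<chi> ` (A #>\<^bsub>G\<^esub> b) = {\<chi> b}" by simp
    then show ?thesis by (simp add: f_def)
  qed
  have B_conj: "u \<otimes>\<^bsub>G\<^esub> b \<otimes>\<^bsub>G\<^esub> inv\<^bsub>G\<^esub> u \<in> B" if "u \<in> U" "b \<in> B" for u b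
    using invB U_invariant_iff[OF B] that by blast
  have stable: "u x \<in> ?C" if u: "u \<in> U" and x: "x \<in> ?C" for u x
  proof -
    obtain b where b: "b \<in> B" "x = \<chi> b" using x by blast
    have "u x = \<chi> (u \<otimes>\<^bsub>G\<^esub> b \<otimes>\<^bsub>G\<^esub> inv\<^bsub>G\<^esub> u)" using \<chi> b u by simp
    then show ?thesis using B_conj[OF u b(1)] by blast
  qed
  have equiv: "f (conj_action G (carrier (?GB Mod A)) u x) = galois_action ?C u (f x)"
    if u: "u \<in> carrier (Gal R L)" and x: "x \<in> carrier (?GB Mod A)" for u x
  proof -
    have u: "u \<in> U" using u carrier_Gal_fixer[OF QL] by simp
    obtain b where b: "b \<in> B" "x = A #>\<^bsub>G\<^esub> b"
      using x by (auto simp: carrier_FactGroup r_coset_def)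
    show ?thesis
      using factor_U_group(2)[OF A B invA invB normal u b(1)] f_coset[OF B_conj[OF u b(1)]]
        f_coset[OF b(1)] \<chi> u b by (simp add: galois_action_def)
  qed
  have "U_group (Gal R L) (?M\<lparr>carrier := ?C\<rparr>) (galois_action ?C)"
    by (rule roots_U_group[OF C]) (rule stable)
  then have "U_isomorphic (Gal R L) (?GB Mod A) (conj_action G (carrier (?GB Mod A)))
      (?M\<lparr>carrier := ?C\<rparr>) (galois_action ?C)"
    unfolding U_isomorphic_def
    using factor_U_group(1)[OF A B invA invB normal] f_iso equiv by blast
  then show ?factor
    using A B AB invA invB normal C p(1) \<open>subgroup_index G B A = p\<close> by blast
next
  assume factor: ?factor
  then have A: "subgroup A G" and B: "subgroup B G" and AB: "A \<subseteq> B"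
    and invA: "U_invariant G U A" and invB: "U_invariant G U B"
    and prime: "Factorial_Ring.prime (subgroup_index G B A)" and normal: "A \<lhd> G\<lparr>carrier := B\<rparr>"
    by blast+
  let ?K = "G\<lparr>carrier := B\<rparr> Mod A" and ?M = "Multiplicative_Group.mult_of R"
  obtain C f where C: "subgroup C ?M" and f: "f \<in> iso ?K (?M\<lparr>carrier := C\<rparr>)"
    and f_equiv: "\<And>u x. u \<in> carrier (Gal R L) \<Longrightarrow> x \<in> carrier ?K \<Longrightarrow>
      f (conj_action G (carrier ?K) u x) = galois_action C u (f x)"
    using factor unfolding U_isomorphic_def by blast
  have carK: "carrier ?K = (\<lambda>b. A #>\<^bsub>G\<^esub> b) ` B"
    by (auto simp: carrier_FactGroup r_coset_def)
  have multK: "(A #>\<^bsub>G\<^esub> b) \<otimes>\<^bsub>?K\<^esub> (A #>\<^bsub>G\<^esub> c) = A #>\<^bsub>G\<^esub> (b \<otimes>\<^bsub>G\<^esub> c)" if "b \<in> B" "c \<in> B" for b c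
    using normal.rcos_sum[OF normal, of b c] that by (simp add: r_coset_def)
  interpret f: group_hom ?K "?M\<lparr>carrier := C\<rparr>" f
    using normal.factorgroup_is_group[OF normal] subgroup.subgroup_is_group[OF C field_mult_group] f
    by (simp add: group_hom_def group_hom_axioms_def iso_def)
  have BG: "b \<in> carrier G" if "b \<in> B" for b using that subgroup.subset[OF B] by blast
  define \<chi> where "\<chi> b = f (A #>\<^bsub>G\<^esub> b)" for b
  have \<chi>C: "\<chi> b \<in> C" if "b \<in> B" for b
    using f.hom_closed[of "A #>\<^bsub>G\<^esub> b"] that carK by (simp add: \<chi>_def)
  have kernel: "\<chi> b = \<one> \<longleftrightarrow> b \<in> A" if b: "b \<in> B" for b
  proof -
    have "A \<in> carrier ?K" using f.G.one_closed by simp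
    moreover have "f A = \<one>" using f.hom_one by simp
    moreover have "inj_on f (carrier ?K)" using f by (simp add: iso_def bij_betw_def)
    moreover have "A #>\<^bsub>G\<^esub> b \<in> carrier ?K" using b carK by blast
    ultimately have "\<chi> b = \<one> \<longleftrightarrow> A #>\<^bsub>G\<^esub> b = A" unfolding \<chi>_def by (metis inj_on_eq_iff)
    also have "\<dots> \<longleftrightarrow> b \<in> A"
      using grp.coset_join1[OF _ BG[OF b] A] grp.coset_join2[OF BG[OF b] A] by blast
    finally show ?thesis .
  qed
  show ?step
    unfolding radical_step_def
  proof (intro conjI exI[of _ "subgroup_index G B A"] exI[of _ \<chi>] ballI)
    show "card B = subgroup_index G B A * card A" using subgroup_index_mult[OF A B AB] by simp
    show "\<chi> b \<in> carrier R - {\<zero>}" if "b \<in> B" for b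
      using \<chi>C[OF that] subgroup.subset[OF C] by auto
    show "\<chi> (b \<otimes>\<^bsub>G\<^esub> c) = \<chi> b \<otimes> \<chi> c" if "b \<in> B" "c \<in> B" for b c
      using f.hom_mult[of "A #>\<^bsub>G\<^esub> b" "A #>\<^bsub>G\<^esub> c"] multK[OF that] carK that
      by (simp add: \<chi>_def Multiplicative_Group.mult_mult_of del: mult_FactGroup)
    show "A = {b \<in> B. \<chi> b = \<one>}" using kernel AB by blast
    show "\<chi> (u \<otimes>\<^bsub>G\<^esub> b \<otimes>\<^bsub>G\<^esub> inv\<^bsub>G\<^esub> u) = u (\<chi> b)" if "u \<in> U" "b \<in> B" for u b
      using f_equiv[of u "A #>\<^bsub>G\<^esub> b"] factor_U_group(2)[OF A B invA invB normal that] that carK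
        carrier_Gal_fixer[OF QL] \<chi>C[OF that(2)] by (simp add: \<chi>_def galois_action_def)
  qed (use A B AB invA invB prime U_invariant_iff[OF A] U_invariant_iff[OF B] in auto)
qed

lemma repeated_radical_iff:
  "repeated_radical_extension R Q L \<longleftrightarrow> radical_step\<^sup>*\<^sup>* (N \<inter> U) N \<and> (\<exists>k. dim Q (F \<inter> L) = 2 ^ k)"
proof
  assume "repeated_radical_extension R Q L"
  then have tower_stage: "tower_stage U" by (rule repeated_radical_imp_tower_stage)
  then obtain k where k: "card (carrier G) * card (N \<inter> U) = 2 ^ k * (card N * card U)"
    by (auto simp: tower_stage_def)
  have "card N > 0" "card U > 0"
    using finite_subgroup subgroup.one_closed N_subgroup U_subgroup card_gt_0_iff by blast+
  then have "dim Q (F \<inter> L) = 2 ^ k"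
    using degree_intersection k by simp
  then show "radical_step\<^sup>*\<^sup>* (N \<inter> U) N \<and> (\<exists>k. dim Q (F \<inter> L) = 2 ^ k)"
    using tower_stage by (auto simp: tower_stage_def)
next
  assume "radical_step\<^sup>*\<^sup>* (N \<inter> U) N \<and> (\<exists>k. dim Q (F \<inter> L) = 2 ^ k)"
  then have "(radical_extension R)\<^sup>*\<^sup>* Q L" using chain_imp_radical_tower by blast
  then show "repeated_radical_extension R Q L"
    unfolding repeated_radical_extension_def
    using Q_subfield L by (auto simp: rtranclp_power relpowp_fun_conv)
qed

lemma radical_step_chain_iff:
  "radical_step\<^sup>*\<^sup>* (N \<inter> U) N \<longleftrightarrow>
    (\<exists>(H :: nat \<Rightarrow> ('a \<Rightarrow> 'a) set) r. H 0 = N \<inter> U \<and> H r = N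
      \<and> (\<forall>i \<le> r. subgroup (H i) G \<and> U_invariant G U (H i)) \<and> (\<forall>i < r. radical_step (H i) (H (Suc i))))"
proof
  assume "radical_step\<^sup>*\<^sup>* (N \<inter> U) N"
  then obtain H r where H: "H 0 = N \<inter> U" "H r = N" "\<forall>i < r. radical_step (H i) (H (Suc i))"
    by (auto simp: rtranclp_power relpowp_fun_conv)
  have "subgroup (H i) G \<and> U_invariant G U (H i)" if "i \<le> r" for i
  proof (cases i)
    case 0
    have "subgroup (N \<inter> U) G" using grp.subgroups_Inter_pair N_subgroup U_subgroup by blast
    then show ?thesis
      using 0 H(1) U_invariant_iff[of "N \<inter> U"] conjugation_invariant[OF U_subgroup subset_refl] by simp
  next
    case (Suc j)
    then show ?thesis using H(3) that radical_step_iff[of "H j" "H (Suc j)"] by simp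
  qed
  then show "\<exists>(H :: nat \<Rightarrow> ('a \<Rightarrow> 'a) set) r. H 0 = N \<inter> U \<and> H r = N
      \<and> (\<forall>i \<le> r. subgroup (H i) G \<and> U_invariant G U (H i)) \<and> (\<forall>i < r. radical_step (H i) (H (Suc i)))"
    using H by blast
qed (auto simp: rtranclp_power relpowp_fun_conv)

end

theorem theorem3p1:
  fixes E :: "('a, 'b) ring_scheme" and Q L F :: "'a set"
    and G N U :: "('a \<Rightarrow> 'a) monoid" and M :: "('a \<Rightarrow> 'a) set"
  assumes "field E" and "subfield Q E" and "subfield L E" and "subfield F E"
    and "Q \<subseteq> L" and "Q \<subseteq> F"
    and "quasireal (E\<lparr>carrier := L\<rparr>)"
    and "galois_extension E Q"
    and "abelian_extension (E\<lparr>carrier := F\<rparr>) Q"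
    and "\<And>x (n::nat). x \<in> carrier E \<Longrightarrow> n > 0 \<Longrightarrow> x [^]\<^bsub>E\<^esub> n = \<one>\<^bsub>E\<^esub> \<Longrightarrow> x \<in> F"
    and "G = Gal E Q" and "N = Gal E F" and "U = Gal E L"
    and "M = carrier N \<inter> carrier U"
  shows "repeated_radical_extension E Q L \<longleftrightarrow>
    (\<exists>(H :: nat \<Rightarrow> ('a \<Rightarrow> 'a) set) r.
        H 0 = M \<and> H r = carrier N
      \<and> (\<forall>i \<le> r. subgroup (H i) G \<and> U_invariant G (carrier U) (H i))
      \<and> (\<forall>i < r. H i \<subseteq> H (Suc i))
      \<and> (\<exists>k. ring.dim E Q (F \<inter> L) = 2 ^ k)
      \<and> (\<forall>i < r. Factorial_Ring.prime (subgroup_index G (H (Suc i)) (H i)))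
      \<and> (\<forall>i < r. H i \<lhd> G\<lparr>carrier := H (Suc i)\<rparr>)
      \<and> (\<forall>i < r. \<exists>C. subgroup C (Multiplicative_Group.mult_of E)
            \<and> U_isomorphic U
                (G\<lparr>carrier := H (Suc i)\<rparr> Mod H i)
                (conj_action G (carrier (G\<lparr>carrier := H (Suc i)\<rparr> Mod H i)))
                ((Multiplicative_Group.mult_of E)\<lparr>carrier := C\<rparr>)
                (galois_action C)))"
proof -
  interpret E: field E by fact
  interpret E: quasireal_subextension E Q L F
  proof (intro quasireal_subextension.intro galois_char_zero.intro galois_char_zero_axioms.intro
      quasireal_subextension_axioms.intro)
    \<comment> \<open>\<open>E\<close> and \<open>L\<close> share their unit and addition, hence their characteristic.\<close>
    show "[n] \<cdot>\<^bsub>E\<^esub> \<one>\<^bsub>E\<^esub> \<noteq> \<zero>\<^bsub>E\<^esub>" if "n > 0" for n :: nat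
      using assms(7) that by (auto simp: quasireal_def add_pow_def nat_pow_def)
    show "x = \<one>\<^bsub>E\<^esub> \<or> x = \<ominus>\<^bsub>E\<^esub> \<one>\<^bsub>E\<^esub>" if x: "x \<in> L" "n > 0" "x [^]\<^bsub>E\<^esub> n = \<one>\<^bsub>E\<^esub>" for x and n :: nat
    proof -
      have "\<ominus>\<^bsub>E\<lparr>carrier := L\<rparr>\<^esub> \<one>\<^bsub>E\<^esub> = \<ominus>\<^bsub>E\<^esub> \<one>\<^bsub>E\<^esub>"
      proof -
        interpret EL: field "E\<lparr>carrier := L\<rparr>" using E.subfield_iff(2)[OF \<open>subfield L E\<close>] .
        have "\<ominus>\<^bsub>E\<lparr>carrier := L\<rparr>\<^esub> \<one>\<^bsub>E\<^esub> \<in> L" "\<ominus>\<^bsub>E\<lparr>carrier := L\<rparr>\<^esub> \<one>\<^bsub>E\<^esub> \<oplus>\<^bsub>E\<^esub> \<one>\<^bsub>E\<^esub> = \<zero>\<^bsub>E\<^esub>"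
          using EL.a_inv_closed[OF EL.one_closed] EL.l_neg[OF EL.one_closed] by simp_all
        then show ?thesis
          using E.minus_equality subfieldE(3)[OF \<open>subfield L E\<close>] by (metis E.one_closed subsetD)
      qed
      then show ?thesis
        using assms(7) x unfolding quasireal_def by (auto simp: nat_pow_def)
    qed
  qed (use assms in auto)
  have N: "carrier N = E.fixer F" and U: "carrier U = E.fixer L" and M: "M = E.fixer F \<inter> E.fixer L"
    using assms(12-14) E.carrier_Gal_fixer assms(5,6) by simp_all
  \<comment> \<open>Kept opaque, so that only the quantifiers over \<open>i\<close> remain to be rearranged.\<close>
  define unit_factor where "unit_factor A B \<longleftrightarrow> (\<exists>C. subgroup C (Multiplicative_Group.mult_of E)
      \<and> U_isomorphic U
          (G\<lparr>carrier := B\<rparr> Mod A)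
          (conj_action G (carrier (G\<lparr>carrier := B\<rparr> Mod A)))
          ((Multiplicative_Group.mult_of E)\<lparr>carrier := C\<rparr>)
          (galois_action C))" for A B
  have step: "E.radical_step A B \<longleftrightarrow> subgroup A G \<and> subgroup B G
      \<and> U_invariant G (E.fixer L) A \<and> U_invariant G (E.fixer L) B \<and> A \<subseteq> B
      \<and> Factorial_Ring.prime (subgroup_index G B A) \<and> A \<lhd> G\<lparr>carrier := B\<rparr> \<and> unit_factor A B" for A B
    unfolding unit_factor_def \<open>G = Gal E Q\<close> \<open>U = Gal E L\<close> by (rule E.radical_step_iff)
  have chain: "E.radical_step\<^sup>*\<^sup>* M (E.fixer F) \<longleftrightarrow>
      (\<exists>(H :: nat \<Rightarrow> ('a \<Rightarrow> 'a) set) r. H 0 = M \<and> H r = E.fixer F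
        \<and> (\<forall>i \<le> r. subgroup (H i) G \<and> U_invariant G (E.fixer L) (H i))
        \<and> (\<forall>i < r. E.radical_step (H i) (H (Suc i))))"
    unfolding M \<open>G = Gal E Q\<close> by (rule E.radical_step_chain_iff)
  show ?thesis
    unfolding E.repeated_radical_iff M[symmetric] N U unit_factor_def[symmetric]
  proof (intro iffI; elim exE conjE)
    fix k assume "E.radical_step\<^sup>*\<^sup>* M (E.fixer F)" and k: "E.dim Q (F \<inter> L) = 2 ^ k"
    then obtain H r where "H 0 = M" "H r = E.fixer F"
        "\<forall>i \<le> r. subgroup (H i) G \<and> U_invariant G (E.fixer L) (H i)"
        "\<forall>i < r. E.radical_step (H i) (H (Suc i))"
      unfolding chain by blast
    then show "\<exists>H r. H 0 = M \<and> H r = E.fixer F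
        \<and> (\<forall>i \<le> r. subgroup (H i) G \<and> U_invariant G (E.fixer L) (H i))
        \<and> (\<forall>i < r. H i \<subseteq> H (Suc i)) \<and> (\<exists>k. E.dim Q (F \<inter> L) = 2 ^ k)
        \<and> (\<forall>i < r. Factorial_Ring.prime (subgroup_index G (H (Suc i)) (H i)))
        \<and> (\<forall>i < r. H i \<lhd> G\<lparr>carrier := H (Suc i)\<rparr>) \<and> (\<forall>i < r. unit_factor (H i) (H (Suc i)))"
      using k by (intro exI[of _ H] exI[of _ r]) (simp add: step)
  next
    fix H :: "nat \<Rightarrow> ('a \<Rightarrow> 'a) set" and r k
    assume H: "H 0 = M" "H r = E.fixer F"
        "\<forall>i \<le> r. subgroup (H i) G \<and> U_invariant G (E.fixer L) (H i)" "\<forall>i < r. H i \<subseteq> H (Suc i)"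
        "\<forall>i < r. Factorial_Ring.prime (subgroup_index G (H (Suc i)) (H i))"
        "\<forall>i < r. H i \<lhd> G\<lparr>carrier := H (Suc i)\<rparr>" "\<forall>i < r. unit_factor (H i) (H (Suc i))"
      and k: "E.dim Q (F \<inter> L) = 2 ^ k"
    have "\<forall>i < r. E.radical_step (H i) (H (Suc i))"
      using H(3-7) by (simp add: step)
    then show "E.radical_step\<^sup>*\<^sup>* M (E.fixer F) \<and> (\<exists>k. E.dim Q (F \<inter> L) = 2 ^ k)"
      unfolding chain using H(1-3) k by blast
  qed
qed

end
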